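(* Let $(M,Q)$ be a quaternionic manifold, and let $I$ be a complex structure compatible with $Q$. Suppose that an $S^{1}$-action on $M$ preserves both $Q$ and $I$. If $I$ is of closed type, then there exists a unique quaternionic connection $\nabla^{I}$ such that $\nabla^{I}I=0$. Moreover, the complex structure $I$ is locally induced from a locally defined (nowhere vanishing) twistor function $\mu$, and $\nabla^{I}$ locally coincides with the $\mu$-connection.
   Context: All manifolds are smooth and without boundary. A quaternionic manifold $(M,Q)$ of dimension $4n>4$ is a manifold with a rank-3 subbundle $Q\subset \mathrm{End}(TM)$ which at every point is spanned by $I_1,I_2,I_3$ with $I_1^2=I_2^2=I_3^2=-\mathrm{id}$, $I_1I_2=-I_2I_1=I_3$ (an admissible frame), and which admits a torsion-free affine connection $\nabla$ with $\nabla_X\Gamma(Q)\subset\Gamma(Q)$ for all $X$ (a quaternionic connection; not unique). In dimension 4 it is by definition a self-dual conformal manifold ($Q$ being the rank-3 bundle spanned by the local orthogonal almost complex structures inducing the opposite orientation; quaternionic connections are the torsion-free connections preserving $Q$). $Q$ carries the metric $(A,B)=-\frac1{4n}\mathrm{Tr}(AB)$, $\|A\|=\sqrt{(A,A)}$. A complex structure $I$ is compatible with $Q$ if $I\in\Gamma(Q)$. Closed type: for an admissible frame with $I_1=I$ and a quaternionic connection $\nabla$ write $\nabla I_\alpha=\omega_\gamma^\nabla\otimes I_\beta-\omega_\beta^\nabla\otimes I_\gamma$ for $(\alpha,\beta,\gamma)$ cyclic, and put $\eta_I^\nabla=\omega_2^\nabla\circ I_2+\omega_3^\nabla\circ I_3$,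 a globally defined one-form. $I$ is of closed type if $\eta_I^\nabla$ is closed for one (equivalently any) quaternionic connection $\nabla$ whose Ricci tensor is symmetric. Twistor functions: for $s\in\mathbb{R}$ let $L^s$ be the real line bundle with transition functions $|\det(\partial x^\beta_i/\partial x^\alpha_j)|^{-s}$ between charts, so $L^s\otimes L^{s'}\cong L^{s+s'}$ and (using the canonical orientation) $L^1\cong\Lambda^{4n}T^*M$. A quaternionic connection $\nabla$ induces connections $\nabla^{Q,s}$ on $Q\otimes L^s$. Put $s_0=-\frac{1}{2(n+1)}$. A twistor function is a section $\mu\in\Gamma(Q\otimes L^{s_0})$ such that for one (equivalently any) quaternionic connection $\nabla$, and any local nowhere vanishing section $e$ of $L^{s_0}$, locally $\nabla^{Q,s_0}\mu=\sum_{\alpha=1}^3(\xi\circ I_\alpha)\otimes I_\alpha\otimes e$ for some one-form $\xi$. An associated pair $(e,\nu)$ consists of a volume form $\nu$ and $e\in\Gamma(L^{s_0})$ with $e^{\otimes 2(n+1)}=\nu^*\in\Gamma(L^{-1})$, $\nu^*$ dual to $\nu$. Write $\mu=\bar\mu\otimes e$, $\bar\mu\in\Gamma(Q)$. If $\mu$ vanishes nowhere, the complex structure induced by $\mu$ is $\bar\mu/\|\bar\mu\|$ (well defined up to sign); the volume form $\nu^\mu=\|\bar\mu\|^{-2(n+1)}\nu$ does not depend on the associated pair, and the $\mu$-connection $\nabla^\mu$ is the unique quaternionic connection with $\nabla^\mu\nu^\mu=0$. *)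

theory Defs
  imports "HOL-Analysis.Analysis"
begin

section \<open>Smooth manifolds and tensor fields in charts\<close>

text \<open>
  A manifold is a Hausdorff, second countable type \<open>'m\<close> together with a smooth atlas \<open>A\<close>, modelled
  on \<open>real ^ 'k\<close>.  A chart is a pair (domain, coordinate map).  Every tensorial object is the family
  of its components in the charts of \<open>A\<close>, subject to the usual transformation law; components are
  functions of the point \<open>p\<close> of the manifold.  Only the values at charts \<open>c \<in> A\<close> and points
  \<open>p \<in> fst c \<inter> U\<close> are meaningful for an object living on the open set \<open>U\<close>, and all the predicates
  below only look at these.  Tangent vectors are written in chart components \<open>v :: real ^ 'k\<close>,
  endomorphisms as matrices.
\<close>

primrec Ck_on :: "nat \<Rightarrow> 'a::real_normed_vector set \<Rightarrow> ('a \<Rightarrow> 'b::real_normed_vector) \<Rightarrow> bool" where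
  "Ck_on 0 S f \<longleftrightarrow> continuous_on S f"
| "Ck_on (Suc k) S f \<longleftrightarrow> (\<forall>x\<in>S. f differentiable (at x)) \<and>
     (\<forall>v. Ck_on k S (\<lambda>x. frechet_derivative f (at x) v))"

text \<open>Meant for open sets \<open>S\<close> in finite-dimensional spaces.\<close>

definition smooth_on :: "'a::real_normed_vector set \<Rightarrow> ('a \<Rightarrow> 'b::real_normed_vector) \<Rightarrow> bool" where
  "smooth_on S f \<longleftrightarrow> (\<forall>k. Ck_on k S f)"

type_synonym ('m, 'k) chart = "'m set \<times> ('m \<Rightarrow> real ^ 'k)"
type_synonym ('m, 'k) atlas = "('m, 'k) chart set"
type_synonym ('m, 'k) scalar_comp = "('m, 'k) chart \<Rightarrow> 'm \<Rightarrow> real"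
type_synonym ('m, 'k) vector_comp = "('m, 'k) chart \<Rightarrow> 'm \<Rightarrow> real ^ 'k"
type_synonym ('m, 'k) matrix_comp = "('m, 'k) chart \<Rightarrow> 'm \<Rightarrow> real ^ 'k ^ 'k"
type_synonym ('m, 'k) endo_bundle = "('m, 'k) chart \<Rightarrow> 'm \<Rightarrow> (real ^ 'k ^ 'k) set"
type_synonym ('m, 'k) connection_comp = "('m, 'k) chart \<Rightarrow> 'm \<Rightarrow> real ^ 'k \<Rightarrow> real ^ 'k ^ 'k"

definition chart_inv :: "('m, 'k) chart \<Rightarrow> real ^ 'k \<Rightarrow> 'm" where
  "chart_inv c = inv_into (fst c) (snd c)"

definition smooth_atlas ::
  "('m::{t2_space, second_countable_topology}, 'k::finite) atlas \<Rightarrow> bool" where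
  "smooth_atlas A \<longleftrightarrow>
     (\<Union>c\<in>A. fst c) = UNIV \<and>
     (\<forall>c\<in>A. open (fst c) \<and> open (snd c ` fst c) \<and>
        homeomorphism (fst c) (snd c ` fst c) (snd c) (chart_inv c)) \<and>
     (\<forall>c\<in>A. \<forall>d\<in>A. smooth_on (snd c ` (fst c \<inter> fst d)) (snd d \<circ> chart_inv c))"

definition smooth_in :: "('m, 'k::finite) chart \<Rightarrow> 'm set \<Rightarrow> ('m \<Rightarrow> 'b::real_normed_vector) \<Rightarrow> bool" where
  "smooth_in c U f \<longleftrightarrow> smooth_on (snd c ` (fst c \<inter> U)) (f \<circ> chart_inv c)"

text \<open>Derivative of \<open>f\<close> at \<open>p\<close> along the tangent vector with components \<open>v\<close> in the chart \<open>c\<close>.\<close>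

definition deriv_in ::
  "('m, 'k::finite) chart \<Rightarrow> ('m \<Rightarrow> 'b::real_normed_vector) \<Rightarrow> 'm \<Rightarrow> real ^ 'k \<Rightarrow> 'b" where
  "deriv_in c f p v = frechet_derivative (f \<circ> chart_inv c) (at (snd c p)) v"

text \<open>Matrix of the differential at \<open>p\<close> of a map \<open>f\<close>, in the charts \<open>c\<close> around \<open>p\<close> and \<open>d\<close> around \<open>f p\<close>.\<close>

definition differential ::
  "('m, 'k::finite) chart \<Rightarrow> ('m, 'k) chart \<Rightarrow> ('m \<Rightarrow> 'm) \<Rightarrow> 'm \<Rightarrow> real ^ 'k ^ 'k" where
  "differential c d f p = matrix (frechet_derivative (snd d \<circ> f \<circ> chart_inv c) (at (snd c p)))"

text \<open>Jacobian matrix of the change of coordinates from \<open>c\<close> to \<open>d\<close>.\<close>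

abbreviation jac :: "('m, 'k::finite) chart \<Rightarrow> ('m, 'k) chart \<Rightarrow> 'm \<Rightarrow> real ^ 'k ^ 'k" where
  "jac c d p \<equiv> differential c d id p"

definition vector_field :: "('m, 'k::finite) atlas \<Rightarrow> 'm set \<Rightarrow> ('m, 'k) vector_comp \<Rightarrow> bool" where
  "vector_field A U X \<longleftrightarrow>
     (\<forall>c\<in>A. smooth_in c U (X c)) \<and>
     (\<forall>c\<in>A. \<forall>d\<in>A. \<forall>p\<in>fst c \<inter> fst d \<inter> U. X d p = jac c d p *v X c p)"

text \<open>A one-form acts on tangent vectors by the inner product with its component vector.\<close>

definition one_form :: "('m, 'k::finite) atlas \<Rightarrow> 'm set \<Rightarrow> ('m, 'k) vector_comp \<Rightarrow> bool" where
  "one_form A U \<omega> \<longleftrightarrow>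
     (\<forall>c\<in>A. smooth_in c U (\<omega> c)) \<and>
     (\<forall>c\<in>A. \<forall>d\<in>A. \<forall>p\<in>fst c \<inter> fst d \<inter> U. \<forall>v. \<omega> d p \<bullet> (jac c d p *v v) = \<omega> c p \<bullet> v)"

definition closed_one_form :: "('m, 'k::finite) atlas \<Rightarrow> 'm set \<Rightarrow> ('m, 'k) vector_comp \<Rightarrow> bool" where
  "closed_one_form A U \<omega> \<longleftrightarrow> one_form A U \<omega> \<and>
     (\<forall>c\<in>A. \<forall>p\<in>fst c \<inter> U. \<forall>v w. deriv_in c (\<omega> c) p v \<bullet> w - deriv_in c (\<omega> c) p w \<bullet> v = 0)"

text \<open>
  Sections over \<open>U\<close> of the line bundle \<open>L\<^sup>s\<close> and of \<open>End(TM) \<otimes> L\<^sup>s\<close>.  The canonical orientation of a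
  quaternionic manifold identifies \<open>L\<^sup>1\<close> with the bundle of top degree forms, so a volume form is a
  nowhere vanishing section of \<open>L\<^sup>1\<close>, and its dual is the section of \<open>L\<^sup>-\<^sup>1\<close> with inverse components.
\<close>

definition density ::
  "('m, 'k::finite) atlas \<Rightarrow> 'm set \<Rightarrow> real \<Rightarrow> ('m, 'k) scalar_comp \<Rightarrow> bool" where
  "density A U s e \<longleftrightarrow>
     (\<forall>c\<in>A. smooth_in c U (e c)) \<and>
     (\<forall>c\<in>A. \<forall>d\<in>A. \<forall>p\<in>fst c \<inter> fst d \<inter> U. e d p = \<bar>det (jac c d p)\<bar> powr (- s) * e c p)"

definition endo_density ::
  "('m, 'k::finite) atlas \<Rightarrow> 'm set \<Rightarrow> real \<Rightarrow> ('m, 'k) matrix_comp \<Rightarrow> bool" where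
  "endo_density A U s B \<longleftrightarrow>
     (\<forall>c\<in>A. smooth_in c U (B c)) \<and>
     (\<forall>c\<in>A. \<forall>d\<in>A. \<forall>p\<in>fst c \<inter> fst d \<inter> U.
        B d p ** jac c d p = \<bar>det (jac c d p)\<bar> powr (- s) *\<^sub>R (jac c d p ** B c p))"

abbreviation endo_field :: "('m, 'k::finite) atlas \<Rightarrow> 'm set \<Rightarrow> ('m, 'k) matrix_comp \<Rightarrow> bool" where
  "endo_field A U \<equiv> endo_density A U 0"

definition nowhere_zero ::
  "('m, 'k) atlas \<Rightarrow> 'm set \<Rightarrow> (('m, 'k) chart \<Rightarrow> 'm \<Rightarrow> 'b::zero) \<Rightarrow> bool" where
  "nowhere_zero A U f \<longleftrightarrow> (\<forall>c\<in>A. \<forall>p\<in>fst c \<inter> U. f c p \<noteq> 0)"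


section \<open>Affine connections\<close>

text \<open>
  A connection is given by its connection matrices \<open>\<Gamma> c p v\<close> (Christoffel symbols), i.e. in the chart
  \<open>c\<close> the covariant derivative of a vector field \<open>Y\<close> along \<open>v\<close> is
  \<open>deriv_in c (Y c) p v + \<Gamma> c p v *v Y c p\<close>.  The last condition is the transformation law expressing that
  this derivative is independent of the chart.
\<close>

definition affine_connection ::
  "('m, 'k::finite) atlas \<Rightarrow> 'm set \<Rightarrow> ('m, 'k) connection_comp \<Rightarrow> bool" where
  "affine_connection A U \<Gamma> \<longleftrightarrow>
     (\<forall>c\<in>A. \<forall>p\<in>fst c \<inter> U. linear (\<Gamma> c p)) \<and>
     (\<forall>c\<in>A. \<forall>v. smooth_in c U (\<lambda>p. \<Gamma> c p v)) \<and>
     (\<forall>c\<in>A. \<forall>d\<in>A. \<forall>p\<in>fst c \<inter> fst d \<inter> U. \<forall>v w.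
        \<Gamma> d p (jac c d p *v v) *v (jac c d p *v w) =
          jac c d p *v (\<Gamma> c p v *v w) - deriv_in c (\<lambda>q. jac c d q *v w) p v)"

definition torsion_free ::
  "('m, 'k::finite) atlas \<Rightarrow> 'm set \<Rightarrow> ('m, 'k) connection_comp \<Rightarrow> bool" where
  "torsion_free A U \<Gamma> \<longleftrightarrow> (\<forall>c\<in>A. \<forall>p\<in>fst c \<inter> U. \<forall>v w. \<Gamma> c p v *v w = \<Gamma> c p w *v v)"

text \<open>The connections induced by \<open>\<Gamma>\<close> on \<open>L\<^sup>s\<close> and on \<open>End(TM) \<otimes> L\<^sup>s\<close>.\<close>

definition cov_density ::
  "('m, 'k::finite) connection_comp \<Rightarrow> real \<Rightarrow> ('m, 'k) scalar_comp \<Rightarrow>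
   ('m, 'k) chart \<Rightarrow> 'm \<Rightarrow> real ^ 'k \<Rightarrow> real" where
  "cov_density \<Gamma> s e c p v = deriv_in c (e c) p v - s * trace (\<Gamma> c p v) * e c p"

definition cov_endo ::
  "('m, 'k::finite) connection_comp \<Rightarrow> real \<Rightarrow> ('m, 'k) matrix_comp \<Rightarrow>
   ('m, 'k) chart \<Rightarrow> 'm \<Rightarrow> real ^ 'k \<Rightarrow> real ^ 'k ^ 'k" where
  "cov_endo \<Gamma> s B c p v =
     deriv_in c (B c) p v + (\<Gamma> c p v ** B c p - B c p ** \<Gamma> c p v) - (s * trace (\<Gamma> c p v)) *\<^sub>R B c p"

definition curvature ::
  "('m, 'k::finite) connection_comp \<Rightarrow> ('m, 'k) chart \<Rightarrow> 'm \<Rightarrow> real ^ 'k \<Rightarrow> real ^ 'k \<Rightarrow> real ^ 'k ^ 'k" where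
  "curvature \<Gamma> c p v w =
     deriv_in c (\<lambda>q. \<Gamma> c q w) p v - deriv_in c (\<lambda>q. \<Gamma> c q v) p w
     + \<Gamma> c p v ** \<Gamma> c p w - \<Gamma> c p w ** \<Gamma> c p v"

definition Ricci ::
  "('m, 'k::finite) connection_comp \<Rightarrow> ('m, 'k) chart \<Rightarrow> 'm \<Rightarrow> real ^ 'k \<Rightarrow> real ^ 'k \<Rightarrow> real" where
  "Ricci \<Gamma> c p v w = trace (matrix (\<lambda>x. curvature \<Gamma> c p x v *v w))"

definition symmetric_Ricci ::
  "('m, 'k::finite) atlas \<Rightarrow> 'm set \<Rightarrow> ('m, 'k) connection_comp \<Rightarrow> bool" where
  "symmetric_Ricci A U \<Gamma> \<longleftrightarrow> (\<forall>c\<in>A. \<forall>p\<in>fst c \<inter> U. \<forall>v w. Ricci \<Gamma> c p v w = Ricci \<Gamma> c p w v)"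

definition connections_agree ::
  "('m, 'k::finite) atlas \<Rightarrow> 'm set \<Rightarrow> ('m, 'k) connection_comp \<Rightarrow> ('m, 'k) connection_comp \<Rightarrow> bool" where
  "connections_agree A U \<Gamma> \<Gamma>' \<longleftrightarrow> (\<forall>c\<in>A. \<forall>p\<in>fst c \<inter> U. \<forall>v. \<Gamma> c p v = \<Gamma>' c p v)"


section \<open>Quaternionic manifolds\<close>

definition quaternion_triple :: "real ^ 'k ^ 'k \<Rightarrow> real ^ 'k ^ 'k \<Rightarrow> real ^ 'k ^ 'k::finite \<Rightarrow> bool" where
  "quaternion_triple J1 J2 J3 \<longleftrightarrow>
     J1 ** J1 = - mat 1 \<and> J2 ** J2 = - mat 1 \<and> J3 ** J3 = - mat 1 \<and>
     J1 ** J2 = J3 \<and> J2 ** J1 = - J3"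

text \<open>
  \<open>Q c p\<close> is the fibre of \<open>Q\<close> at \<open>p\<close>, as a set of matrices in the chart \<open>c\<close>.  The conditions say that
  the fibres do not depend on the chart, that they form a smooth subbundle of rank 3, and that each
  fibre is spanned by a quaternionic triple.
\<close>

definition almost_quaternionic :: "('m::topological_space, 'k::finite) atlas \<Rightarrow> ('m, 'k) endo_bundle \<Rightarrow> bool" where
  "almost_quaternionic A Q \<longleftrightarrow>
     (\<forall>c\<in>A. \<forall>d\<in>A. \<forall>p\<in>fst c \<inter> fst d.
        Q d p = (\<lambda>B. jac c d p ** B ** matrix_inv (jac c d p)) ` Q c p) \<and>
     (\<forall>p. \<exists>V B1 B2 B3. open V \<and> p \<in> V \<and>
        endo_field A V B1 \<and> endo_field A V B2 \<and> endo_field A V B3 \<and>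
        (\<forall>c\<in>A. \<forall>q\<in>fst c \<inter> V. Q c q = span {B1 c q, B2 c q, B3 c q} \<and> dim (Q c q) = 3)) \<and>
     (\<forall>c\<in>A. \<forall>p\<in>fst c. \<exists>J1 J2 J3. quaternion_triple J1 J2 J3 \<and> Q c p = span {J1, J2, J3})"

definition admissible_frame ::
  "('m, 'k::finite) atlas \<Rightarrow> ('m, 'k) endo_bundle \<Rightarrow> 'm set \<Rightarrow>
   ('m, 'k) matrix_comp \<Rightarrow> ('m, 'k) matrix_comp \<Rightarrow> ('m, 'k) matrix_comp \<Rightarrow> bool" where
  "admissible_frame A Q V I1 I2 I3 \<longleftrightarrow>
     endo_field A V I1 \<and> endo_field A V I2 \<and> endo_field A V I3 \<and>
     (\<forall>c\<in>A. \<forall>p\<in>fst c \<inter> V. quaternion_triple (I1 c p) (I2 c p) (I3 c p) \<and>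
        Q c p = span {I1 c p, I2 c p, I3 c p})"

text \<open>Sections of \<open>Q \<otimes> L\<^sup>s\<close> over \<open>U\<close>.\<close>

definition Q_section ::
  "('m, 'k::finite) atlas \<Rightarrow> ('m, 'k) endo_bundle \<Rightarrow> 'm set \<Rightarrow> real \<Rightarrow> ('m, 'k) matrix_comp \<Rightarrow> bool" where
  "Q_section A Q U s B \<longleftrightarrow> endo_density A U s B \<and> (\<forall>c\<in>A. \<forall>p\<in>fst c \<inter> U. B c p \<in> Q c p)"

definition quaternionic_connection ::
  "('m::topological_space, 'k::finite) atlas \<Rightarrow> ('m, 'k) endo_bundle \<Rightarrow> 'm set \<Rightarrow>
   ('m, 'k) connection_comp \<Rightarrow> bool" where
  "quaternionic_connection A Q U \<Gamma> \<longleftrightarrow>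
     affine_connection A U \<Gamma> \<and> torsion_free A U \<Gamma> \<and>
     (\<forall>V B. open V \<and> V \<subseteq> U \<and> Q_section A Q V 0 B \<longrightarrow>
        (\<forall>c\<in>A. \<forall>p\<in>fst c \<inter> V. \<forall>v. cov_endo \<Gamma> 0 B c p v \<in> Q c p))"

subsection \<open>Dimension four\<close>

definition Riemannian_metric :: "('m, 'k::finite) atlas \<Rightarrow> ('m, 'k) matrix_comp \<Rightarrow> bool" where
  "Riemannian_metric A g \<longleftrightarrow>
     (\<forall>c\<in>A. smooth_in c UNIV (g c)) \<and>
     (\<forall>c\<in>A. \<forall>p\<in>fst c. transpose (g c p) = g c p \<and> (\<forall>v. v \<noteq> 0 \<longrightarrow> v \<bullet> (g c p *v v) > 0)) \<and>
     (\<forall>c\<in>A. \<forall>d\<in>A. \<forall>p\<in>fst c \<inter> fst d. transpose (jac c d p) ** g d p ** jac c d p = g c p)"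

definition Levi_Civita ::
  "('m, 'k::finite) atlas \<Rightarrow> ('m, 'k) matrix_comp \<Rightarrow> ('m, 'k) connection_comp \<Rightarrow> bool" where
  "Levi_Civita A g \<Gamma> \<longleftrightarrow> affine_connection A UNIV \<Gamma> \<and> torsion_free A UNIV \<Gamma> \<and>
     (\<forall>c\<in>A. \<forall>p\<in>fst c. \<forall>v. deriv_in c (g c) p v = transpose (\<Gamma> c p v) ** g c p + g c p ** \<Gamma> c p v)"

text \<open>An orientation of a 4-manifold, given by a nowhere vanishing 4-form.\<close>

type_synonym ('m, 'k) four_form_comp =
  "('m, 'k) chart \<Rightarrow> 'm \<Rightarrow> real ^ 'k \<Rightarrow> real ^ 'k \<Rightarrow> real ^ 'k \<Rightarrow> real ^ 'k \<Rightarrow> real"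

definition orientation_form :: "('m, 'k::finite) atlas \<Rightarrow> ('m, 'k) four_form_comp \<Rightarrow> bool" where
  "orientation_form A \<Omega> \<longleftrightarrow>
     (\<forall>c\<in>A. \<forall>v w x y. smooth_in c UNIV (\<lambda>p. \<Omega> c p v w x y)) \<and>
     (\<forall>c\<in>A. \<forall>p\<in>fst c.
        (\<forall>v w x. linear (\<lambda>y. \<Omega> c p y v w x) \<and> linear (\<lambda>y. \<Omega> c p v y w x) \<and>
                 linear (\<lambda>y. \<Omega> c p v w y x) \<and> linear (\<lambda>y. \<Omega> c p v w x y) \<and>
                 \<Omega> c p v v w x = 0 \<and> \<Omega> c p w v v x = 0 \<and> \<Omega> c p w x v v = 0) \<and>
        (\<exists>v w x y. \<Omega> c p v w x y \<noteq> 0)) \<and>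
     (\<forall>c\<in>A. \<forall>d\<in>A. \<forall>p\<in>fst c \<inter> fst d. \<forall>v w x y.
        \<Omega> d p (jac c d p *v v) (jac c d p *v w) (jac c d p *v x) (jac c d p *v y) = \<Omega> c p v w x y)"

text \<open>
  The Weyl tensor of \<open>g\<close> in dimension 4, with all indices lowered;
  \<open>P = (Ric - (scal / 6) g) / 2\<close> is the Schouten tensor.
\<close>

definition Schouten4 ::
  "('m, 'k::finite) matrix_comp \<Rightarrow> ('m, 'k) connection_comp \<Rightarrow>
   ('m, 'k) chart \<Rightarrow> 'm \<Rightarrow> real ^ 'k \<Rightarrow> real ^ 'k \<Rightarrow> real" where
  "Schouten4 g \<Gamma> c p v w =
     (let scal = trace (matrix_inv (g c p) ** (\<chi> i j. Ricci \<Gamma> c p (axis i 1) (axis j 1)))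
      in (Ricci \<Gamma> c p v w - scal / 6 * (v \<bullet> (g c p *v w))) / 2)"

definition Weyl4 ::
  "('m, 'k::finite) matrix_comp \<Rightarrow> ('m, 'k) connection_comp \<Rightarrow>
   ('m, 'k) chart \<Rightarrow> 'm \<Rightarrow> real ^ 'k \<Rightarrow> real ^ 'k \<Rightarrow> real ^ 'k \<Rightarrow> real ^ 'k \<Rightarrow> real" where
  "Weyl4 g \<Gamma> c p v w x y =
     (let G = (\<lambda>a b. a \<bullet> (g c p *v b)); P = Schouten4 g \<Gamma> c p
      in G (curvature \<Gamma> c p v w *v x) y
         - (P w x * G v y - P v x * G w y + G w x * P v y - G v x * P w y))"

text \<open>
  Vanishing of the anti-self-dual part of the Weyl tensor: when \<open>(e1, e2, e3, e4)\<close> ranges over the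
  positively oriented orthonormal frames, the multiples of \<open>e1 \<and> e2 - e3 \<and> e4\<close> exhaust the
  \<open>-1\<close>-eigenspace of the Hodge star operator on bivectors.
\<close>

definition self_dual ::
  "('m, 'k::finite) atlas \<Rightarrow> ('m, 'k) matrix_comp \<Rightarrow> ('m, 'k) four_form_comp \<Rightarrow> bool" where
  "self_dual A g \<Omega> \<longleftrightarrow>
     (\<exists>\<Gamma>. Levi_Civita A g \<Gamma> \<and>
        (\<forall>c\<in>A. \<forall>p\<in>fst c. \<forall>e :: nat \<Rightarrow> real ^ 'k.
           (\<forall>i\<in>{1..4}. \<forall>j\<in>{1..4}. e i \<bullet> (g c p *v e j) = (if i = j then 1 else 0)) \<and>
           \<Omega> c p (e 1) (e 2) (e 3) (e 4) > 0 \<longrightarrow>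
           (\<forall>x y. Weyl4 g \<Gamma> c p (e 1) (e 2) x y - Weyl4 g \<Gamma> c p (e 3) (e 4) x y = 0)))"

text \<open>
  Orthogonal complex structures \<open>J\<close> of the tangent space inducing the orientation opposite to \<open>\<Omega>\<close>,
  for which the bases \<open>(v, J v, w, J w)\<close> are negatively oriented.
\<close>

definition opposite_orthogonal_structures ::
  "('m, 'k::finite) matrix_comp \<Rightarrow> ('m, 'k) four_form_comp \<Rightarrow> ('m, 'k) endo_bundle" where
  "opposite_orthogonal_structures g \<Omega> c p =
     {J. J ** J = - mat 1 \<and> transpose J ** g c p ** J = g c p \<and>
         (\<forall>v w. \<Omega> c p v (J *v v) w (J *v w) \<le> 0)}"

definition quaternionic_manifold ::
  "nat \<Rightarrow> ('m::{t2_space, second_countable_topology}, 'k::finite) atlas \<Rightarrow> ('m, 'k) endo_bundle \<Rightarrow> bool" where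
  "quaternionic_manifold n A Q \<longleftrightarrow>
     n \<ge> 1 \<and> CARD('k) = 4 * n \<and> smooth_atlas A \<and> almost_quaternionic A Q \<and>
     (n > 1 \<longrightarrow> (\<exists>\<Gamma>. quaternionic_connection A Q UNIV \<Gamma>)) \<and>
     (n = 1 \<longrightarrow> (\<exists>g \<Omega>. Riemannian_metric A g \<and> orientation_form A \<Omega> \<and> self_dual A g \<Omega> \<and>
        (\<forall>c\<in>A. \<forall>p\<in>fst c. Q c p = span (opposite_orthogonal_structures g \<Omega> c p))))"


section \<open>Complex structures and circle actions\<close>

definition Lie_bracket ::
  "('m, 'k::finite) vector_comp \<Rightarrow> ('m, 'k) vector_comp \<Rightarrow> ('m, 'k) vector_comp" where
  "Lie_bracket X Y c p = deriv_in c (Y c) p (X c p) - deriv_in c (X c) p (Y c p)"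

definition app_endo :: "('m, 'k::finite) matrix_comp \<Rightarrow> ('m, 'k) vector_comp \<Rightarrow> ('m, 'k) vector_comp" where
  "app_endo B X c p = B c p *v X c p"

text \<open>An almost complex structure with vanishing Nijenhuis tensor.\<close>

definition complex_structure :: "('m::topological_space, 'k::finite) atlas \<Rightarrow> ('m, 'k) matrix_comp \<Rightarrow> bool" where
  "complex_structure A I \<longleftrightarrow> endo_field A UNIV I \<and>
     (\<forall>c\<in>A. \<forall>p\<in>fst c. I c p ** I c p = - mat 1) \<and>
     (\<forall>V X Y. open V \<and> vector_field A V X \<and> vector_field A V Y \<longrightarrow>
        (\<forall>c\<in>A. \<forall>p\<in>fst c \<inter> V.
           Lie_bracket (app_endo I X) (app_endo I Y) c p
           - I c p *v Lie_bracket (app_endo I X) Y c p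
           - I c p *v Lie_bracket X (app_endo I Y) c p
           - Lie_bracket X Y c p = 0))"

definition compatible_complex_structure ::
  "('m::topological_space, 'k::finite) atlas \<Rightarrow> ('m, 'k) endo_bundle \<Rightarrow> ('m, 'k) matrix_comp \<Rightarrow> bool" where
  "compatible_complex_structure A Q I \<longleftrightarrow> complex_structure A I \<and> Q_section A Q UNIV 0 I"

text \<open>
  Smooth actions of the circle group, realised as the unit circle in \<open>\<complex>\<close>.  Smoothness is expressed
  through the local diffeomorphism \<open>cis\<close> from the real line onto the circle.
\<close>

definition circle_action ::
  "('m::topological_space, 'k::finite) atlas \<Rightarrow> (complex \<Rightarrow> 'm \<Rightarrow> 'm) \<Rightarrow> bool" where
  "circle_action A \<rho> \<longleftrightarrow>
     (\<forall>p. \<rho> 1 p = p) \<and>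
     (\<forall>z\<in>sphere 0 1. \<forall>w\<in>sphere 0 1. \<forall>p. \<rho> (z * w) p = \<rho> z (\<rho> w p)) \<and>
     continuous_on (sphere 0 1 \<times> UNIV) (\<lambda>(z, p). \<rho> z p) \<and>
     (\<forall>c\<in>A. \<forall>d\<in>A.
        smooth_on {(t, x). x \<in> snd c ` fst c \<and> \<rho> (cis t) (chart_inv c x) \<in> fst d}
          (\<lambda>(t, x). snd d (\<rho> (cis t) (chart_inv c x))))"

definition preserves_endo ::
  "('m, 'k::finite) atlas \<Rightarrow> (complex \<Rightarrow> 'm \<Rightarrow> 'm) \<Rightarrow> ('m, 'k) matrix_comp \<Rightarrow> bool" where
  "preserves_endo A \<rho> B \<longleftrightarrow>
     (\<forall>z\<in>sphere 0 1. \<forall>c\<in>A. \<forall>d\<in>A. \<forall>p\<in>fst c. \<rho> z p \<in> fst d \<longrightarrow>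
        differential c d (\<rho> z) p ** B c p = B d (\<rho> z p) ** differential c d (\<rho> z) p)"

definition preserves_bundle ::
  "('m, 'k::finite) atlas \<Rightarrow> (complex \<Rightarrow> 'm \<Rightarrow> 'm) \<Rightarrow> ('m, 'k) endo_bundle \<Rightarrow> bool" where
  "preserves_bundle A \<rho> Q \<longleftrightarrow>
     (\<forall>z\<in>sphere 0 1. \<forall>c\<in>A. \<forall>d\<in>A. \<forall>p\<in>fst c. \<rho> z p \<in> fst d \<longrightarrow>
        Q d (\<rho> z p) = (\<lambda>B. differential c d (\<rho> z) p ** B ** matrix_inv (differential c d (\<rho> z) p)) ` Q c p)"


section \<open>Closed type\<close>

text \<open>The one-forms \<open>\<omega>1, \<omega>2, \<omega>3\<close> of the connection in an admissible frame over \<open>V\<close>.\<close>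

definition frame_forms ::
  "('m, 'k::finite) atlas \<Rightarrow> 'm set \<Rightarrow> ('m, 'k) connection_comp \<Rightarrow>
   ('m, 'k) matrix_comp \<Rightarrow> ('m, 'k) matrix_comp \<Rightarrow> ('m, 'k) matrix_comp \<Rightarrow>
   ('m, 'k) vector_comp \<Rightarrow> ('m, 'k) vector_comp \<Rightarrow> ('m, 'k) vector_comp \<Rightarrow> bool" where
  "frame_forms A V \<Gamma> I1 I2 I3 \<omega>1 \<omega>2 \<omega>3 \<longleftrightarrow>
     one_form A V \<omega>1 \<and> one_form A V \<omega>2 \<and> one_form A V \<omega>3 \<and>
     (\<forall>c\<in>A. \<forall>p\<in>fst c \<inter> V. \<forall>v.
        cov_endo \<Gamma> 0 I1 c p v = (\<omega>3 c p \<bullet> v) *\<^sub>R I2 c p - (\<omega>2 c p \<bullet> v) *\<^sub>R I3 c p \<and>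
        cov_endo \<Gamma> 0 I2 c p v = (\<omega>1 c p \<bullet> v) *\<^sub>R I3 c p - (\<omega>3 c p \<bullet> v) *\<^sub>R I1 c p \<and>
        cov_endo \<Gamma> 0 I3 c p v = (\<omega>2 c p \<bullet> v) *\<^sub>R I1 c p - (\<omega>1 c p \<bullet> v) *\<^sub>R I2 c p)"

definition eta_form ::
  "('m::topological_space, 'k::finite) atlas \<Rightarrow> ('m, 'k) endo_bundle \<Rightarrow> ('m, 'k) connection_comp \<Rightarrow>
   ('m, 'k) matrix_comp \<Rightarrow> ('m, 'k) vector_comp \<Rightarrow> bool" where
  "eta_form A Q \<Gamma> I \<eta> \<longleftrightarrow> one_form A UNIV \<eta> \<and>
     (\<forall>V I2 I3 \<omega>1 \<omega>2 \<omega>3. open V \<and> admissible_frame A Q V I I2 I3 \<and>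
        frame_forms A V \<Gamma> I I2 I3 \<omega>1 \<omega>2 \<omega>3 \<longrightarrow>
        (\<forall>c\<in>A. \<forall>p\<in>fst c \<inter> V. \<forall>v.
           \<eta> c p \<bullet> v = \<omega>2 c p \<bullet> (I2 c p *v v) + \<omega>3 c p \<bullet> (I3 c p *v v)))"

definition closed_type ::
  "('m::topological_space, 'k::finite) atlas \<Rightarrow> ('m, 'k) endo_bundle \<Rightarrow> ('m, 'k) matrix_comp \<Rightarrow> bool" where
  "closed_type A Q I \<longleftrightarrow>
     (\<exists>\<Gamma> \<eta>. quaternionic_connection A Q UNIV \<Gamma> \<and> symmetric_Ricci A UNIV \<Gamma> \<and>
        eta_form A Q \<Gamma> I \<eta> \<and> closed_one_form A UNIV \<eta>)"


section \<open>Twistor functions\<close>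

definition s0 :: "nat \<Rightarrow> real" where
  "s0 n = - 1 / (2 * (real n + 1))"

definition twistor_function ::
  "nat \<Rightarrow> ('m::topological_space, 'k::finite) atlas \<Rightarrow> ('m, 'k) endo_bundle \<Rightarrow> 'm set \<Rightarrow>
   ('m, 'k) matrix_comp \<Rightarrow> bool" where
  "twistor_function n A Q U \<mu> \<longleftrightarrow> Q_section A Q U (s0 n) \<mu> \<and>
     (\<exists>\<Gamma>. quaternionic_connection A Q U \<Gamma> \<and>
        (\<forall>V e. open V \<and> V \<subseteq> U \<and> density A V (s0 n) e \<and> nowhere_zero A V e \<longrightarrow>
           (\<forall>p\<in>V. \<exists>W I1 I2 I3 \<xi>. open W \<and> p \<in> W \<and> W \<subseteq> V \<and>
              admissible_frame A Q W I1 I2 I3 \<and> one_form A W \<xi> \<and>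
              (\<forall>c\<in>A. \<forall>q\<in>fst c \<inter> W. \<forall>v.
                 cov_endo \<Gamma> (s0 n) \<mu> c q v =
                   e c q *\<^sub>R ((\<xi> c q \<bullet> (I1 c q *v v)) *\<^sub>R I1 c q
                            + (\<xi> c q \<bullet> (I2 c q *v v)) *\<^sub>R I2 c q
                            + (\<xi> c q \<bullet> (I3 c q *v v)) *\<^sub>R I3 c q)))))"

text \<open>The norm of the fibre metric \<open>(A, B) = - Tr (A B) / (4 n)\<close> on \<open>Q\<close>.\<close>

definition Q_norm :: "nat \<Rightarrow> real ^ 'k ^ 'k::finite \<Rightarrow> real" where
  "Q_norm n B = sqrt (- trace (B ** B) / (4 * real n))"

definition associated_pair ::
  "nat \<Rightarrow> ('m, 'k::finite) atlas \<Rightarrow> 'm set \<Rightarrow> ('m, 'k) scalar_comp \<Rightarrow> ('m, 'k) scalar_comp \<Rightarrow> bool" where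
  "associated_pair n A U e \<nu> \<longleftrightarrow>
     density A U 1 \<nu> \<and> nowhere_zero A U \<nu> \<and> density A U (s0 n) e \<and>
     (\<forall>c\<in>A. \<forall>p\<in>fst c \<inter> U. e c p ^ (2 * (n + 1)) = inverse (\<nu> c p))"

text \<open>\<open>\<mu> = \<mu>' \<otimes> e\<close> for the associated pair \<open>(e, \<nu>)\<close>, with \<open>\<mu>'\<close> a section of \<open>Q\<close>.\<close>

definition decomposes ::
  "nat \<Rightarrow> ('m, 'k::finite) atlas \<Rightarrow> ('m, 'k) endo_bundle \<Rightarrow> 'm set \<Rightarrow> ('m, 'k) matrix_comp \<Rightarrow>
   ('m, 'k) matrix_comp \<Rightarrow> ('m, 'k) scalar_comp \<Rightarrow> ('m, 'k) scalar_comp \<Rightarrow> bool" where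
  "decomposes n A Q U \<mu> \<mu>' e \<nu> \<longleftrightarrow> associated_pair n A U e \<nu> \<and> Q_section A Q U 0 \<mu>' \<and>
     (\<forall>c\<in>A. \<forall>p\<in>fst c \<inter> U. \<mu> c p = e c p *\<^sub>R \<mu>' c p)"

text \<open>
  Replacing \<open>e\<close> by \<open>- e\<close> changes the sign of \<open>\<mu>'\<close>, which accounts for the sign ambiguity of the
  induced complex structure.
\<close>

definition induces ::
  "nat \<Rightarrow> ('m, 'k::finite) atlas \<Rightarrow> ('m, 'k) endo_bundle \<Rightarrow> 'm set \<Rightarrow> ('m, 'k) matrix_comp \<Rightarrow>
   ('m, 'k) matrix_comp \<Rightarrow> bool" where
  "induces n A Q U \<mu> I \<longleftrightarrow>
     (\<exists>\<mu>' e \<nu>. decomposes n A Q U \<mu> \<mu>' e \<nu> \<and>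
        (\<forall>c\<in>A. \<forall>p\<in>fst c \<inter> U. I c p = inverse (Q_norm n (\<mu>' c p)) *\<^sub>R \<mu>' c p))"

definition mu_volume ::
  "nat \<Rightarrow> ('m, 'k::finite) atlas \<Rightarrow> ('m, 'k) endo_bundle \<Rightarrow> 'm set \<Rightarrow> ('m, 'k) matrix_comp \<Rightarrow>
   ('m, 'k) scalar_comp \<Rightarrow> bool" where
  "mu_volume n A Q U \<mu> \<nu>\<mu> \<longleftrightarrow>
     (\<exists>\<mu>' e \<nu>. decomposes n A Q U \<mu> \<mu>' e \<nu> \<and>
        (\<forall>c\<in>A. \<forall>p\<in>fst c \<inter> U. \<nu>\<mu> c p = inverse (Q_norm n (\<mu>' c p) ^ (2 * (n + 1))) * \<nu> c p))"

definition parallel_volume ::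
  "('m, 'k::finite) atlas \<Rightarrow> 'm set \<Rightarrow> ('m, 'k) connection_comp \<Rightarrow> ('m, 'k) scalar_comp \<Rightarrow> bool" where
  "parallel_volume A U \<Gamma> \<nu> \<longleftrightarrow> (\<forall>c\<in>A. \<forall>p\<in>fst c \<inter> U. \<forall>v. cov_density \<Gamma> 1 \<nu> c p v = 0)"

definition mu_connection ::
  "nat \<Rightarrow> ('m::topological_space, 'k::finite) atlas \<Rightarrow> ('m, 'k) endo_bundle \<Rightarrow> 'm set \<Rightarrow>
   ('m, 'k) matrix_comp \<Rightarrow> ('m, 'k) connection_comp \<Rightarrow> bool" where
  "mu_connection n A Q U \<mu> \<Gamma> \<longleftrightarrow>
     (\<exists>\<nu>\<mu>. mu_volume n A Q U \<mu> \<nu>\<mu> \<and>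
        quaternionic_connection A Q U \<Gamma> \<and> parallel_volume A U \<Gamma> \<nu>\<mu> \<and>
        (\<forall>\<Gamma>'. quaternionic_connection A Q U \<Gamma>' \<and> parallel_volume A U \<Gamma>' \<nu>\<mu> \<longrightarrow>
           connections_agree A U \<Gamma>' \<Gamma>))"

definition parallel_endo ::
  "('m, 'k::finite) atlas \<Rightarrow> 'm set \<Rightarrow> ('m, 'k) connection_comp \<Rightarrow> ('m, 'k) matrix_comp \<Rightarrow> bool" where
  "parallel_endo A U \<Gamma> B \<longleftrightarrow> (\<forall>c\<in>A. \<forall>p\<in>fst c \<inter> U. \<forall>v. cov_endo \<Gamma> 0 B c p v = 0)"

end

theory Submission
  imports Defs
begin

text \<open>
  Two quaternionic connections differ by the tensor
  \<open>S\<^sub>X = \<theta>(X) id + X \<otimes> \<theta> - \<Sum>\<^sub>\<alpha> (\<theta>(I\<^sub>\<alpha> X) I\<^sub>\<alpha> + I\<^sub>\<alpha> X \<otimes> \<theta> \<circ> I\<^sub>\<alpha>)\<close> of a one-form \<open>\<theta>\<close>, with trace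
  \<open>4 (n + 1) \<theta>(X)\<close> and \<open>[S\<^sub>X, I\<^sub>1] = 2 \<theta>(I\<^sub>2 X) I\<^sub>3 - 2 \<theta>(I\<^sub>3 X) I\<^sub>2\<close>.  Integrability of \<open>I\<close> forces
  \<open>\<omega>\<^sub>2 \<circ> I\<^sub>2 = \<omega>\<^sub>3 \<circ> I\<^sub>3 = \<eta> / 2\<close>, so exactly \<open>\<theta> = - \<eta> / 4\<close> makes \<open>I\<close> parallel.  The trace of the resulting
  connection is that of \<open>\<nabla>\<close> minus \<open>(n + 1) \<eta>\<close>; both are closed, the first because the Ricci tensor
  is symmetric.  Hence there is locally a parallel volume form \<open>\<nu>\<close>, and \<open>\<mu> = I \<otimes> e\<close> with
  \<open>e = \<nu> powr s0\<close> is parallel, in particular a twistor function.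
\<close>

section \<open>Smooth functions on open sets\<close>

text \<open>The partners I2, I3 of I exist only locally and are not canonical, while the connection
  sought is global. So S is attached to the fibre of Q itself: \<open>Q_tensor\<close> takes any
  triple at the point, and the outcome is the same for all of them because a difference tensor is
  determined by its trace and the trace of S involves \<theta> only. The same rigidity makes a
  quaternionic connection unique once its volume form is given; commutation with I is the other
  normalisation, which gives uniqueness of the connection preserving I. That every difference has
  the form S, in dimension 4 as well, rests on the identity that expresses integrability: for a
  symmetric D the commutators of D with the members of the triple satisfy it too, so one pointwise
  lemma serves both purposes. The trace of a connection is not a one-form. Its closedness is
  therefore used in the coordinates of a single chart, and the other charts are reached through the
  Jacobian determinant. Since I has norm 1, the volume form induced by \<mu> is the parallel \<nu>
  itself, and the value of \<open>s0\<close> is what turns \<open>e\<close> to the power 2 (n + 1)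
  into the dual of \<nu>.\<close>

lemma Ck_on_cong:
  assumes "open S" "\<And>x. x \<in> S \<Longrightarrow> f x = g x"
  shows "Ck_on k S f \<longleftrightarrow> Ck_on k S g"
  using assms(2)
proof (induction k arbitrary: f g)
  case 0
  then show ?case by simp
next
  case (Suc k)
  have der: "(f has_derivative D) (at x) \<longleftrightarrow> (g has_derivative D) (at x)" if "x \<in> S" for x D
    using has_derivative_transform_within_open[OF _ assms(1) that] Suc.prems by metis
  have diff: "f differentiable (at x) \<longleftrightarrow> g differentiable (at x)" if "x \<in> S" for x
    using der[OF that] by (simp add: differentiable_def)
  have "frechet_derivative f (at x) = frechet_derivative g (at x)" if "x \<in> S" for x
    using der[OF that] by (simp add: frechet_derivative_def)
  then have "Ck_on k S (\<lambda>x. frechet_derivative f (at x) v)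
      \<longleftrightarrow> Ck_on k S (\<lambda>x. frechet_derivative g (at x) v)" for v
    by (intro Suc.IH) simp
  then show ?case using diff by simp
qed

text \<open>Lets the closure proofs below work with an explicit derivative instead of
  \<open>frechet_derivative\<close> of a compound expression.\<close>

lemma Ck_on_SucI:
  assumes "open S" "\<And>x. x \<in> S \<Longrightarrow> (f has_derivative D x) (at x)"
    and "\<And>v. Ck_on k S (\<lambda>x. D x v)"
  shows "Ck_on (Suc k) S f"
proof -
  have "Ck_on k S (\<lambda>x. frechet_derivative f (at x) v)" for v
    using Ck_on_cong[OF assms(1), of "\<lambda>x. frechet_derivative f (at x) v" "\<lambda>x. D x v" k]
      frechet_derivative_at[OF assms(2)] assms(3) by metis
  then show ?thesis
    using assms(2) by (auto simp: differentiable_def)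
qed

lemma Ck_on_Suc_has_derivative:
  "Ck_on (Suc k) S f \<Longrightarrow> x \<in> S \<Longrightarrow> (f has_derivative frechet_derivative f (at x)) (at x)"
  using frechet_derivative_works by auto

lemma Ck_on_SucD: "Ck_on (Suc k) S f \<Longrightarrow> Ck_on k S f"
proof (induction k arbitrary: f)
  case 0
  then show ?case
    by (auto intro!: continuous_at_imp_continuous_on differentiable_imp_continuous_within)
next
  case (Suc k)
  have "Ck_on k S (\<lambda>x. frechet_derivative f (at x) v)" for v
    using Suc.prems by (intro Suc.IH) simp
  then show ?case using Suc.prems by simp
qed

lemma Ck_on_continuous: "Ck_on k S f \<Longrightarrow> continuous_on S f"
  by (induction k) (use Ck_on_SucD in \<open>auto simp del: Ck_on.simps(2)\<close>)

lemma Ck_on_subset: "Ck_on k S f \<Longrightarrow> T \<subseteq> S \<Longrightarrow> Ck_on k T f"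
  by (induction k arbitrary: f) (auto intro: continuous_on_subset)

text \<open>Needed for objects defined by a choice at each point, such as \<open>Q_tensor\<close>,
  which have a smooth expression only near each point.\<close>

lemma Ck_on_local:
  assumes "\<And>x. x \<in> S \<Longrightarrow> \<exists>T. open T \<and> x \<in> T \<and> Ck_on k T f"
  shows "Ck_on k S f"
  using assms
proof (induction k arbitrary: f)
  case 0
  then have "isCont f x" if "x \<in> S" for x
    using that continuous_on_eq_continuous_at by (metis Ck_on.simps(1))
  then show ?case
    by (simp add: continuous_at_imp_continuous_on)
next
  case (Suc k)
  have "Ck_on k S (\<lambda>x. frechet_derivative f (at x) v)" for v
    by (rule Suc.IH) (use Suc.prems in fastforce)
  moreover have "f differentiable (at x)" if "x \<in> S" for x
    using Suc.prems[OF that] by auto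
  ultimately show ?case by simp
qed

lemma Ck_on_const: "open S \<Longrightarrow> Ck_on k S (\<lambda>x. c)"
  by (induction k arbitrary: c) (auto)

lemma Ck_on_bounded_linear:
  assumes "open S" "bounded_linear L" "Ck_on k S f"
  shows "Ck_on k S (\<lambda>x. L (f x))"
  using assms(3)
proof (induction k arbitrary: f)
  case 0
  then show ?case
    using bounded_linear.continuous_on[OF assms(2)] by auto
next
  case (Suc k)
  show ?case
  proof (rule Ck_on_SucI[OF assms(1)])
    show "((\<lambda>x. L (f x)) has_derivative (\<lambda>v. L (frechet_derivative f (at x) v))) (at x)"
      if "x \<in> S" for x
      by (rule bounded_linear.has_derivative[OF assms(2) Ck_on_Suc_has_derivative[OF Suc.prems that]])
    show "Ck_on k S (\<lambda>x. L (frechet_derivative f (at x) v))" for v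
      using Suc.prems by (intro Suc.IH) simp
  qed
qed

lemma Ck_on_add:
  assumes "open S" "Ck_on k S f" "Ck_on k S g"
  shows "Ck_on k S (\<lambda>x. f x + g x)"
  using assms(2,3)
proof (induction k arbitrary: f g)
  case 0
  then show ?case by (auto intro: continuous_intros)
next
  case (Suc k)
  show ?case
  proof (rule Ck_on_SucI[OF assms(1)])
    show "((\<lambda>x. f x + g x) has_derivative
        (\<lambda>v. frechet_derivative f (at x) v + frechet_derivative g (at x) v)) (at x)"
      if "x \<in> S" for x
      using Suc.prems that by (intro has_derivative_add Ck_on_Suc_has_derivative)
    show "Ck_on k S (\<lambda>x. frechet_derivative f (at x) v + frechet_derivative g (at x) v)" for v
      using Suc.prems by (intro Suc.IH) auto
  qed
qed

lemma Ck_on_bilinear: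
  assumes "bounded_bilinear pr" "open S" "Ck_on k S f" "Ck_on k S g"
  shows "Ck_on k S (\<lambda>x. pr (f x) (g x))"
  using assms(3,4)
proof (induction k arbitrary: f g)
  case 0
  then show ?case
    using bounded_bilinear.continuous_on[OF assms(1)] by auto
next
  case (Suc k)
  show ?case
  proof (rule Ck_on_SucI[OF assms(2)])
    show "((\<lambda>x. pr (f x) (g x)) has_derivative
        (\<lambda>v. pr (f x) (frechet_derivative g (at x) v) + pr (frechet_derivative f (at x) v) (g x))) (at x)"
      if "x \<in> S" for x
      using Suc.prems that
      by (intro bounded_bilinear.FDERIV[OF assms(1)] Ck_on_Suc_has_derivative)
    show "Ck_on k S (\<lambda>x. pr (f x) (frechet_derivative g (at x) v)
        + pr (frechet_derivative f (at x) v) (g x))" for v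
      using Suc.prems Ck_on_SucD[OF Suc.prems(1)] Ck_on_SucD[OF Suc.prems(2)]
      by (intro Ck_on_add[OF assms(2)] Suc.IH) auto
  qed
qed

lemma Ck_on_sum:
  assumes "open S" "finite J" "\<And>j. j \<in> J \<Longrightarrow> Ck_on k S (f j)"
  shows "Ck_on k S (\<lambda>x. \<Sum>j\<in>J. f j x)"
  using assms(2,3)
  by (induction J rule: finite_induct) (auto intro!: Ck_on_const Ck_on_add assms(1))

lemma Ck_on_powr:
  fixes N :: "'a::real_normed_vector \<Rightarrow> real"
  assumes "open S" "Ck_on k S N" "\<And>x. x \<in> S \<Longrightarrow> N x > 0"
  shows "Ck_on k S (\<lambda>x. N x powr r)"
  using assms(2)
\<comment> \<open>Differentiating lowers the exponent, so the induction hypothesis is needed at r -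
  1.\<close>
proof (induction k arbitrary: r)
  case 0
  then show ?case using assms(3) by (auto intro!: continuous_intros simp: less_imp_neq[symmetric])
next
  case (Suc k)
  show ?case
  proof (rule Ck_on_SucI[OF assms(1)])
    show "((\<lambda>x. N x powr r) has_derivative
        (\<lambda>v. (r * (N x powr (r - 1))) * frechet_derivative N (at x) v)) (at x)"
      if x: "x \<in> S" for x
      using has_derivative_compose[OF Ck_on_Suc_has_derivative[OF Suc.prems x]
        has_real_derivative_powr[OF assms(3)[OF x], unfolded has_field_derivative_def]] by simp
    show "Ck_on k S (\<lambda>x. (r * (N x powr (r - 1))) * frechet_derivative N (at x) v)" for v
    proof (intro Ck_on_bilinear[OF bounded_bilinear_mult] Ck_on_const assms(1))
      show "Ck_on k S (\<lambda>x. N x powr (r - 1))"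
        by (intro Suc.IH Ck_on_SucD[OF Suc.prems])
    qed (use Suc.prems in auto)
  qed
qed

text \<open>\<open>Ck_on\<close> controls derivatives along fixed directions, but the chain rule
  applies the derivative of \<open>h\<close> to a vector that moves with x. Expanding this vector in
  the standard basis leaves only fixed directions, with coefficients of class C^k.\<close>

lemma Ck_on_compose:
  fixes f :: "'a::real_normed_vector \<Rightarrow> 'b::euclidean_space"
  assumes "open S" "open T" "Ck_on k S f" "Ck_on k T h" "\<And>x. x \<in> S \<Longrightarrow> f x \<in> T"
  shows "Ck_on k S (\<lambda>x. h (f x))"
  using assms(3,4)
proof (induction k arbitrary: h)
  case 0
  then show ?case
    using continuous_on_compose2[of T h S f] assms(5) by auto
next
  case (Suc k)
  let ?D = "\<lambda>x v. \<Sum>b\<in>Basis. (frechet_derivative f (at x) v \<bullet> b) *\<^sub>R frechet_derivative h (at (f x)) b"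
  show ?case
  proof (rule Ck_on_SucI[OF assms(1)])
    show "((\<lambda>x. h (f x)) has_derivative ?D x) (at x)" if x: "x \<in> S" for x
    proof -
      have hd: "(h has_derivative frechet_derivative h (at (f x))) (at (f x))"
        using Ck_on_Suc_has_derivative[OF Suc.prems(2) assms(5)[OF x]] .
      have "?D x v = frechet_derivative h (at (f x)) (frechet_derivative f (at x) v)" for v
        by (subst (2) euclidean_representation[symmetric, of "frechet_derivative f (at x) v"])
           (simp add: linear_sum[OF has_derivative_linear[OF hd]]
              linear_cmul[OF has_derivative_linear[OF hd]])
      then show ?thesis
        using has_derivative_compose[OF Ck_on_Suc_has_derivative[OF Suc.prems(1) x] hd] by simp
    qed
    show "Ck_on k S (\<lambda>x. ?D x v)" for v
    proof (intro Ck_on_sum Ck_on_bilinear[OF bounded_bilinear_scaleR] assms(1) finite_Basis)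
      show "Ck_on k S (\<lambda>x. frechet_derivative f (at x) v \<bullet> b)" for b
        using Suc.prems by (intro Ck_on_bounded_linear[OF assms(1) bounded_linear_inner_left]) auto
      show "Ck_on k S (\<lambda>x. frechet_derivative h (at (f x)) b)" for b
        using Suc.prems Ck_on_SucD[OF Suc.prems(1)] by (intro Suc.IH) auto
    qed
  qed
qed

section \<open>Closure properties of smooth functions\<close>

lemma smooth_on_cong:
  "open S \<Longrightarrow> (\<And>x. x \<in> S \<Longrightarrow> f x = g x) \<Longrightarrow> smooth_on S f \<longleftrightarrow> smooth_on S g"
  unfolding smooth_on_def by (metis Ck_on_cong)

lemma smooth_on_has_derivative:
  "smooth_on S f \<Longrightarrow> x \<in> S \<Longrightarrow> (f has_derivative frechet_derivative f (at x)) (at x)"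
  unfolding smooth_on_def using Ck_on_Suc_has_derivative by blast

lemma smooth_on_deriv: "smooth_on S f \<Longrightarrow> smooth_on S (\<lambda>x. frechet_derivative f (at x) v)"
  unfolding smooth_on_def by (metis Ck_on.simps(2))

lemma smooth_on_continuous: "smooth_on S f \<Longrightarrow> continuous_on S f"
  unfolding smooth_on_def using Ck_on_continuous by blast

lemma smooth_on_subset: "smooth_on S f \<Longrightarrow> T \<subseteq> S \<Longrightarrow> smooth_on T f"
  unfolding smooth_on_def using Ck_on_subset by blast

lemma smooth_on_local:
  "(\<And>x. x \<in> S \<Longrightarrow> \<exists>T. open T \<and> x \<in> T \<and> smooth_on T f) \<Longrightarrow> smooth_on S f"
  unfolding smooth_on_def by (metis Ck_on_local)

lemma smooth_on_const: "open S \<Longrightarrow> smooth_on S (\<lambda>x. c)"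
  unfolding smooth_on_def by (simp add: Ck_on_const)

lemma smooth_on_bounded_linear:
  "open S \<Longrightarrow> bounded_linear L \<Longrightarrow> smooth_on S f \<Longrightarrow> smooth_on S (\<lambda>x. L (f x))"
  unfolding smooth_on_def by (simp add: Ck_on_bounded_linear)

lemma smooth_on_add:
  "open S \<Longrightarrow> smooth_on S f \<Longrightarrow> smooth_on S g \<Longrightarrow> smooth_on S (\<lambda>x. f x + g x)"
  unfolding smooth_on_def by (simp add: Ck_on_add)

lemma smooth_on_minus: "open S \<Longrightarrow> smooth_on S f \<Longrightarrow> smooth_on S (\<lambda>x. - f x)"
  by (rule smooth_on_bounded_linear[OF _ bounded_linear_minus[OF bounded_linear_ident]])

lemma smooth_on_diff:
  "open S \<Longrightarrow> smooth_on S f \<Longrightarrow> smooth_on S g \<Longrightarrow> smooth_on S (\<lambda>x. f x - g x)"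
  using smooth_on_add[OF _ _ smooth_on_minus, of S f g] by simp

lemma smooth_on_bilinear:
  "bounded_bilinear pr \<Longrightarrow> open S \<Longrightarrow> smooth_on S f \<Longrightarrow> smooth_on S g
    \<Longrightarrow> smooth_on S (\<lambda>x. pr (f x) (g x))"
  unfolding smooth_on_def by (simp add: Ck_on_bilinear)

lemma smooth_on_powr:
  fixes N :: "'a::real_normed_vector \<Rightarrow> real"
  shows "open S \<Longrightarrow> smooth_on S N \<Longrightarrow> (\<And>x. x \<in> S \<Longrightarrow> N x > 0) \<Longrightarrow> smooth_on S (\<lambda>x. N x powr r)"
  unfolding smooth_on_def by (simp add: Ck_on_powr)

lemma smooth_on_sum:
  "open S \<Longrightarrow> finite J \<Longrightarrow> (\<And>j. j \<in> J \<Longrightarrow> smooth_on S (f j)) \<Longrightarrow> smooth_on S (\<lambda>x. \<Sum>j\<in>J. f j x)"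
  unfolding smooth_on_def by (simp add: Ck_on_sum)

lemma smooth_on_compose:
  fixes f :: "'a::real_normed_vector \<Rightarrow> 'b::euclidean_space"
  shows "open S \<Longrightarrow> open T \<Longrightarrow> smooth_on S f \<Longrightarrow> smooth_on T h \<Longrightarrow> (\<And>x. x \<in> S \<Longrightarrow> f x \<in> T)
    \<Longrightarrow> smooth_on S (\<lambda>x. h (f x))"
  unfolding smooth_on_def by (simp add: Ck_on_compose)

text \<open>Bootstrapping: the equation expresses each derivative of \<open>h\<close> through lower ones.\<close>

lemma smooth_on_linear_ode:
  fixes h :: "'a::real_normed_vector \<Rightarrow> real"
  assumes "open S" "\<And>x. x \<in> S \<Longrightarrow> (h has_derivative (\<lambda>v. a v x * h x)) (at x)"
    and "\<And>v. smooth_on S (a v)"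
  shows "smooth_on S h"
proof -
  have "Ck_on k S h" for k
  proof (induction k)
    case 0
    have "continuous_on S h"
      using assms(2) by (meson continuous_at_imp_continuous_on has_derivative_continuous)
    then show ?case by simp
  next
    case (Suc k)
    then show ?case
      using assms(3) unfolding smooth_on_def
      by (intro Ck_on_SucI[OF assms(1,2)] Ck_on_bilinear[OF bounded_bilinear_mult] assms(1)) auto
  qed
  then show ?thesis by (simp add: smooth_on_def)
qed

text \<open>Poincare lemma: the primitive is the line integral of g along the segment from the
  centre to x. After differentiating under the integral sign, closedness turns the integrand into
  the t-derivative of t g(a + t (x - a)) \<bullet> v, whose integral over the unit interval is g x
  \<bullet> v.\<close>

lemma closed_form_has_primitive_on_ball:
  fixes g :: "'a::euclidean_space \<Rightarrow> 'a"
  assumes g: "\<And>x. x \<in> ball a r \<Longrightarrow> (g has_derivative D x) (at x)"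
    and cont: "\<And>v. continuous_on (ball a r) (\<lambda>x. D x v)"
    and closed: "\<And>x v w. x \<in> ball a r \<Longrightarrow> D x v \<bullet> w = D x w \<bullet> v"
  shows "\<exists>f :: 'a \<Rightarrow> real. \<forall>x\<in>ball a r. (f has_derivative (\<lambda>v. g x \<bullet> v)) (at x)"
proof -
  let ?B = "ball a r"
  let ?s = "\<lambda>x t. a + t *\<^sub>R (x - a)"
  have inB: "?s x t \<in> ?B" if "x \<in> ?B" "t \<in> cbox 0 1" for x and t :: real
  proof -
    have "norm (t *\<^sub>R (x - a)) \<le> 1 * norm (x - a)"
      using that(2) unfolding norm_scaleR by (intro mult_right_mono) auto
    then show ?thesis using that(1) by (simp add: dist_norm norm_minus_commute)
  qed
  define f where "f x = integral (cbox 0 1) (\<lambda>t::real. g (?s x t) \<bullet> (x - a))" for x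
  \<comment> \<open>The x-derivative of the integrand, packaged as a bounded linear map because
    \<open>leibniz_rule\<close> asks for its joint continuity in operator norm; in finite dimension
    continuity on a basis is enough.\<close>
  define F where "F x t = Blinfun (\<lambda>v. t * (D (?s x t) v \<bullet> (x - a)) + g (?s x t) \<bullet> v)" for x t
  have Dlin: "bounded_linear (D x)" if "x \<in> ?B" for x
    using g[OF that] by (rule has_derivative_bounded_linear)
  have F: "blinfun_apply (F x t) = (\<lambda>v. t * (D (?s x t) v \<bullet> (x - a)) + g (?s x t) \<bullet> v)"
    if "x \<in> ?B" "t \<in> cbox 0 1" for x t
    unfolding F_def
    by (intro bounded_linear_Blinfun_apply bounded_linear_add bounded_linear_inner_right
        bounded_linear_const_mult bounded_linear_inner_left_comp Dlin inB that)
  have gcont: "continuous_on ?B g"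
    using g by (meson continuous_at_imp_continuous_on has_derivative_continuous)
  have deriv: "(f has_derivative integral (cbox 0 1) (F x)) (at x within ?B)" if x: "x \<in> ?B" for x
    unfolding f_def
  proof (rule leibniz_rule[OF _ _ _ x convex_ball])
    fix y and t :: real assume y: "y \<in> ?B" "t \<in> cbox 0 1"
    have 1: "((\<lambda>y. ?s y t) has_derivative (\<lambda>v. t *\<^sub>R v)) (at y within ?B)"
      by (auto intro!: derivative_eq_intros)
    have "((\<lambda>y. g (?s y t)) has_derivative (\<lambda>v. D (?s y t) (t *\<^sub>R v))) (at y within ?B)"
      using has_derivative_compose[OF 1 g[OF inB[OF y]]] .
    then show "((\<lambda>y. g (?s y t) \<bullet> (y - a)) has_derivative blinfun_apply (F y t)) (at y within ?B)"
      unfolding F[OF y]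
      by (auto intro!: derivative_eq_intros
          simp: bounded_linear.linear[OF Dlin[OF inB[OF y]], THEN linear_cmul])
  next
    fix y assume y: "y \<in> ?B"
    show "(\<lambda>t. g (?s y t) \<bullet> (y - a)) integrable_on cbox 0 1"
      by (intro integrable_continuous continuous_intros continuous_on_compose2[OF gcont])
        (auto intro: inB[OF y, simplified])
  next
    have "continuous_on (?B \<times> cbox 0 1) (\<lambda>z. F (fst z) (snd z))"
    proof (rule continuous_on_blinfun_componentwise)
      fix i :: 'a assume "i \<in> Basis"
      have "continuous_on (?B \<times> cbox 0 1) (\<lambda>z. snd z * (D (?s (fst z) (snd z)) i \<bullet> (fst z - a))
          + g (?s (fst z) (snd z)) \<bullet> i)"
        by (intro continuous_intros continuous_on_compose2[OF gcont] continuous_on_compose2[OF cont])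
          (auto intro: inB[simplified])
      then show "continuous_on (?B \<times> cbox 0 1) (\<lambda>z. blinfun_apply (F (fst z) (snd z)) i)"
        by (rule continuous_on_cong[THEN iffD1, rotated -1]) (auto simp: F)
    qed
    then show "continuous_on (?B \<times> cbox 0 1) (\<lambda>(y, t). F y t)"
      by (simp add: split_beta)
  qed
  have "integral (cbox 0 1) (F x) v = g x \<bullet> v" if x: "x \<in> ?B" for x v
  proof -
    have cF: "continuous_on (cbox 0 1) (F x)"
    proof (rule continuous_on_blinfun_componentwise)
      fix i :: 'a assume "i \<in> Basis"
      have "continuous_on (cbox 0 1) (\<lambda>t. t * (D (?s x t) i \<bullet> (x - a)) + g (?s x t) \<bullet> i)"
        by (intro continuous_intros continuous_on_compose2[OF gcont] continuous_on_compose2[OF cont])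
          (auto intro: inB[OF x, simplified])
      then show "continuous_on (cbox 0 1) (\<lambda>t. blinfun_apply (F x t) i)"
        by (rule continuous_on_cong[THEN iffD1, rotated -1]) (auto simp: F[OF x])
    qed
    have "integral (cbox 0 1) (F x) v = integral (cbox 0 1) (\<lambda>t. F x t v)"
      by (rule blinfun_apply_integral[OF integrable_continuous[OF cF]])
    also have "\<dots> = integral {0..1} (\<lambda>t. t * (D (?s x t) v \<bullet> (x - a)) + g (?s x t) \<bullet> v)"
      by (auto intro!: integral_cong simp: F[OF x])
    \<comment> \<open>Boundary values of t g(a + t (x - a)) \<bullet> v at t = 1 and t = 0.\<close>
    also have "\<dots> = 1 * (g (?s x 1) \<bullet> v) - 0 * (g (?s x 0) \<bullet> v)"
    proof (intro integral_unique fundamental_theorem_of_calculus)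
      fix t :: real assume t: "t \<in> {0..1}"
      have 1: "((\<lambda>t. ?s x t) has_derivative (\<lambda>h. h *\<^sub>R (x - a))) (at t within {0..1})"
        by (auto intro!: derivative_eq_intros)
      have st: "?s x t \<in> ?B" using inB[OF x] t by auto
      have "((\<lambda>t. g (?s x t)) has_derivative (\<lambda>h. D (?s x t) (h *\<^sub>R (x - a)))) (at t within {0..1})"
        using has_derivative_compose[OF 1 g[OF st]] .
      then have "((\<lambda>t. g (?s x t) \<bullet> v) has_derivative (\<lambda>h. D (?s x t) (h *\<^sub>R (x - a)) \<bullet> v))
          (at t within {0..1})"
        by (rule has_derivative_inner_left)
      then have "((\<lambda>t. t * (g (?s x t) \<bullet> v)) has_derivative
          (\<lambda>h. t * (D (?s x t) (h *\<^sub>R (x - a)) \<bullet> v) + h * (g (?s x t) \<bullet> v))) (at t within {0..1})"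
        by (rule has_derivative_mult[OF has_derivative_ident])
      then show "((\<lambda>t. t * (g (?s x t) \<bullet> v)) has_vector_derivative
          t * (D (?s x t) v \<bullet> (x - a)) + g (?s x t) \<bullet> v) (at t within {0..1})"
        unfolding has_vector_derivative_def
      proof (rule has_derivative_eq_rhs)
        \<comment> \<open>The only use of closedness: it exchanges the radial direction x - a with
          v.\<close>
        have "D (?s x t) (h *\<^sub>R (x - a)) \<bullet> v = h * (D (?s x t) v \<bullet> (x - a))" for h
          unfolding linear_cmul[OF bounded_linear.linear[OF Dlin[OF st]]] inner_scaleR_left
          using closed[OF st] by simp
        then show "(\<lambda>h. t * (D (?s x t) (h *\<^sub>R (x - a)) \<bullet> v) + h * (g (?s x t) \<bullet> v)) =
            (\<lambda>h. h *\<^sub>R (t * (D (?s x t) v \<bullet> (x - a)) + g (?s x t) \<bullet> v))"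
          by (simp add: distrib_left mult.left_commute)
      qed
    qed auto
    finally show ?thesis by simp
  qed
  then have "(f has_derivative (\<lambda>v. g x \<bullet> v)) (at x)" if "x \<in> ?B" for x
    using deriv[OF that] that at_within_open[OF that open_ball] by (metis (no_types) ext)
  then show ?thesis by blast
qed

section \<open>Linear algebra of quaternionic structures\<close>

lemma bounded_bilinear_matrix_mult:
  "bounded_bilinear ((**) :: real^'n^'m \<Rightarrow> real^'p^'n \<Rightarrow> real^'p^'m)"
  unfolding bilinear_conv_bounded_bilinear[symmetric] bilinear_def linear_iff
  by (auto simp: vec_eq_iff matrix_matrix_mult_def sum.distrib distrib_left distrib_right
      sum_distrib_left mult.left_commute mult.assoc)

lemma bounded_bilinear_matrix_vector_mult:
  "bounded_bilinear ((*v) :: real^'n^'m \<Rightarrow> real^'n \<Rightarrow> real^'m)"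
  unfolding bilinear_conv_bounded_bilinear[symmetric] bilinear_def linear_iff
  by (auto simp: vec_eq_iff matrix_vector_mult_def sum.distrib distrib_left distrib_right
      sum_distrib_left mult.left_commute mult.assoc)

lemmas matrix_ring_simps =
  bounded_bilinear.add_left[OF bounded_bilinear_matrix_mult]
  bounded_bilinear.add_right[OF bounded_bilinear_matrix_mult]
  bounded_bilinear.diff_left[OF bounded_bilinear_matrix_mult]
  bounded_bilinear.diff_right[OF bounded_bilinear_matrix_mult]
  bounded_bilinear.minus_left[OF bounded_bilinear_matrix_mult]
  bounded_bilinear.minus_right[OF bounded_bilinear_matrix_mult]
  bounded_bilinear.scaleR_left[OF bounded_bilinear_matrix_mult]
  bounded_bilinear.scaleR_right[OF bounded_bilinear_matrix_mult]
  bounded_bilinear.zero_left[OF bounded_bilinear_matrix_mult]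
  bounded_bilinear.zero_right[OF bounded_bilinear_matrix_mult]
  matrix_mul_assoc[symmetric] matrix_mul_lid matrix_mul_rid

lemmas matrix_vector_simps =
  bounded_bilinear.add_left[OF bounded_bilinear_matrix_vector_mult]
  bounded_bilinear.add_right[OF bounded_bilinear_matrix_vector_mult]
  bounded_bilinear.diff_left[OF bounded_bilinear_matrix_vector_mult]
  bounded_bilinear.diff_right[OF bounded_bilinear_matrix_vector_mult]
  bounded_bilinear.minus_left[OF bounded_bilinear_matrix_vector_mult]
  bounded_bilinear.minus_right[OF bounded_bilinear_matrix_vector_mult]
  bounded_bilinear.scaleR_left[OF bounded_bilinear_matrix_vector_mult]
  bounded_bilinear.scaleR_right[OF bounded_bilinear_matrix_vector_mult]
  bounded_bilinear.zero_left[OF bounded_bilinear_matrix_vector_mult]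
  bounded_bilinear.zero_right[OF bounded_bilinear_matrix_vector_mult]
  matrix_vector_mul_assoc matrix_vector_mul_lid

lemma linear_trace: "linear (trace :: real^'n^'n \<Rightarrow> real)"
  by (auto simp: linear_iff trace_def sum.distrib sum_distrib_left)

lemma bounded_linear_trace: "bounded_linear (trace :: real^'n^'n \<Rightarrow> real)"
  by (simp add: linear_conv_bounded_linear[symmetric] linear_trace)

lemmas trace_simps = linear_add[OF linear_trace] linear_diff[OF linear_trace]
  linear_neg[OF linear_trace] linear_cmul[OF linear_trace] linear_0[OF linear_trace]

lemma linear_functional_inner:
  fixes f :: "'a::euclidean_space \<Rightarrow> real"
  assumes "linear f"
  obtains a where "\<And>v. f v = a \<bullet> v"
  using adjoint_works[OF assms, of _ 1] by (metis inner_commute inner_real_def mult.right_neutral)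

text \<open>The endomorphism v \<otimes> \<theta>, with \<theta> given by its component
  vector.\<close>

definition outer :: "real^'n \<Rightarrow> real^'m \<Rightarrow> real^'m^'n" where
  "outer v \<theta> = (\<chi> i j. v $ i * \<theta> $ j)"

lemma outer_mult_vector: "outer v \<theta> *v w = (\<theta> \<bullet> w) *\<^sub>R v"
  by (simp add: outer_def vec_eq_iff matrix_vector_mult_def inner_vec_def sum_distrib_left
      mult.assoc mult.commute mult.left_commute)

lemma mult_outer: "A ** outer v \<theta> = outer (A *v v) \<theta>"
  by (simp add: outer_def vec_eq_iff matrix_vector_mult_def matrix_matrix_mult_def sum_distrib_right
      mult.assoc)

lemma trace_outer: "trace (outer v \<theta>) = \<theta> \<bullet> v"
  by (simp add: outer_def trace_def inner_vec_def mult.commute)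

lemma bounded_bilinear_outer: "bounded_bilinear (outer :: real^'n \<Rightarrow> real^'m \<Rightarrow> real^'m^'n)"
  unfolding bilinear_conv_bounded_bilinear[symmetric] bilinear_def linear_iff
  by (auto simp: vec_eq_iff outer_def algebra_simps)

lemma self_eq_neg_zero: "- x = x \<Longrightarrow> x = (0 :: 'a::real_vector)"
  by (metis add.right_inverse scaleR_2 scaleR_eq_0_iff zero_neq_numeral)

lemma matrix_eqI: "(\<And>w. A *v w = B *v w) \<Longrightarrow> A = (B :: real^'n^'m)"
  by (simp add: matrix_eq)

text \<open>The inner product with J in the fibre metric of Q, hence the J-coordinate in an
  orthonormal frame. As a trace formula it is visibly linear, smooth and invariant under
  conjugation, which is how the frame forms become smooth one-forms.\<close>

definition coef :: "real^'k^'k \<Rightarrow> real^'k^'k \<Rightarrow> real" where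
  "coef J B = - trace (B ** J) / real CARD('k)"

lemma linear_coef: "linear (coef J)"
  by (auto simp: linear_iff coef_def matrix_ring_simps trace_simps add_divide_distrib diff_divide_distrib)

section \<open>Quaternionic triples on one tangent space\<close>

locale quaternion_frame =
  fixes J1 J2 J3 :: "real^'k^'k"
  assumes triple: "quaternion_triple J1 J2 J3"
begin

lemma J_mult:
  "J1 ** J1 = - mat 1" "J2 ** J2 = - mat 1" "J3 ** J3 = - mat 1"
  "J1 ** J2 = J3" "J2 ** J1 = - J3" "J2 ** J3 = J1" "J3 ** J2 = - J1" "J3 ** J1 = J2" "J1 ** J3 = - J2"
proof -
  have J: "J1 ** J1 = - mat 1" "J2 ** J2 = - mat 1" "J3 ** J3 = - mat 1" "J1 ** J2 = J3" "J2 ** J1 = - J3"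
    using triple by (auto simp: quaternion_triple_def)
  show "J3 ** J2 = - J1" "J1 ** J3 = - J2"
    by (metis J(2,4) matrix_mul_assoc matrix_mul_rid matrix_ring_simps(6),
        metis J(1,4) matrix_mul_assoc matrix_mul_lid matrix_ring_simps(5))
  show "J2 ** J3 = J1" "J3 ** J1 = J2"
    by (metis J(2,5) matrix_mul_assoc matrix_mul_lid matrix_ring_simps(5,6) J(4) minus_minus \<open>J3 ** J2 = - J1\<close> matrix_mul_rid,
        metis J(1,5) matrix_mul_assoc matrix_mul_rid matrix_ring_simps(5,6) J(4) minus_minus)
qed (use triple in \<open>auto simp: quaternion_triple_def\<close>)


text \<open>Products are normalised to the right by \<open>matrix_ring_simps\<close>, so each
  multiplication rule is also needed with a tail X.\<close>

lemma J_mult_left: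
  "J1 ** (J1 ** X) = - X" "J2 ** (J2 ** X) = - X" "J3 ** (J3 ** X) = - X"
  "J1 ** (J2 ** X) = J3 ** X" "J2 ** (J1 ** X) = - (J3 ** X)" "J2 ** (J3 ** X) = J1 ** X"
  "J3 ** (J2 ** X) = - (J1 ** X)" "J3 ** (J1 ** X) = J2 ** X" "J1 ** (J3 ** X) = - (J2 ** X)"
  by (simp_all add: matrix_mul_assoc J_mult bounded_bilinear.minus_left[OF bounded_bilinear_matrix_mult])

lemmas quaternion_simps = matrix_ring_simps J_mult J_mult_left matrix_vector_simps

text \<open>The relations of a triple are cyclic; what is proved for J1 is transferred to J2 and J3
  by interpretation.\<close>

lemma rotate: "quaternion_frame J2 J3 J1"
  by unfold_locales (simp add: quaternion_triple_def J_mult)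

lemma span_eq: "span {J1, J2, J3} = {a *\<^sub>R J1 + b *\<^sub>R J2 + c *\<^sub>R J3 | a b c. True}"
  by (auto simp: span_insert span_singleton algebra_simps)

text \<open>Each member is a product of two anticommuting matrices, and a trace does not see the
  order of the factors.\<close>

lemma trace_J: "trace J1 = 0" "trace J2 = 0" "trace J3 = 0"
proof -
  have "trace J1 = - trace J1" "trace J2 = - trace J2" "trace J3 = - trace J3"
    using trace_mul_sym[of J2 J3] trace_mul_sym[of J3 J1] trace_mul_sym[of J1 J2]
    by (simp_all add: J_mult trace_simps)
  then show "trace J1 = 0" "trace J2 = 0" "trace J3 = 0" by auto
qed

lemma coef_J:
  "coef J1 (a *\<^sub>R J1 + b *\<^sub>R J2 + c *\<^sub>R J3) = a"
  "coef J2 (a *\<^sub>R J1 + b *\<^sub>R J2 + c *\<^sub>R J3) = b"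
  "coef J3 (a *\<^sub>R J1 + b *\<^sub>R J2 + c *\<^sub>R J3) = c"
  by (simp_all add: coef_def quaternion_simps trace_simps trace_J trace_I)

lemma span_coef:
  "B \<in> span {J1, J2, J3} \<Longrightarrow> B = coef J1 B *\<^sub>R J1 + coef J2 B *\<^sub>R J2 + coef J3 B *\<^sub>R J3"
  unfolding span_eq using coef_J by force

lemma J_independent:
  assumes "a *\<^sub>R J1 + b *\<^sub>R J2 + c *\<^sub>R J3 = 0"
  shows "a = 0" "b = 0" "c = 0"
  using coef_J[of a b c] unfolding assms by (simp_all add: coef_def matrix_ring_simps trace_simps)

text \<open>Multiplying a quaternion by its conjugate, here \<open>?q (-1)\<close>, leaves the
  squared norm, so no nonzero quaternion kills a nonzero vector. The real coefficient is the one
  read off in the application.\<close>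

lemma J_vector_independent:
  assumes "a *\<^sub>R x + b *\<^sub>R (J1 *v x) + c *\<^sub>R (J2 *v x) + d *\<^sub>R (J3 *v x) = 0" "x \<noteq> 0"
  shows "a = 0"
proof -
  let ?q = "\<lambda>s. a *\<^sub>R mat 1 + s *\<^sub>R (b *\<^sub>R J1 + c *\<^sub>R J2 + d *\<^sub>R J3)"
  have "?q (-1) ** ?q 1 = (a\<^sup>2 + b\<^sup>2 + c\<^sup>2 + d\<^sup>2) *\<^sub>R mat 1"
    by (simp add: quaternion_simps algebra_simps power2_eq_square)
  moreover have "(?q (-1) ** ?q 1) *v x = 0"
    using assms(1) by (simp add: matrix_vector_mul_assoc[symmetric] matrix_vector_simps(1,7,10,12) add.assoc)
  ultimately have "(a\<^sup>2 + b\<^sup>2 + c\<^sup>2 + d\<^sup>2) *\<^sub>R x = 0"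
    by (simp add: matrix_vector_simps)
  then show ?thesis using assms(2)
    by (auto simp: add_nonneg_eq_0_iff)
qed

text \<open>The last six hypotheses are the derivatives of the relations saying that the triple
  squares to -1 and anticommutes. Their traces state that the matrix of the derivative in the
  orthonormal frame is skew, which leaves three coefficients.\<close>

lemma derivation_coefs:
  assumes "C1 \<in> span {J1, J2, J3}" "C2 \<in> span {J1, J2, J3}" "C3 \<in> span {J1, J2, J3}"
    and "C1 ** J1 + J1 ** C1 = 0" "C2 ** J2 + J2 ** C2 = 0" "C3 ** J3 + J3 ** C3 = 0"
    and "C1 ** J2 + J1 ** C2 + (C2 ** J1 + J2 ** C1) = 0"
    and "C2 ** J3 + J2 ** C3 + (C3 ** J2 + J3 ** C2) = 0"
    and "C3 ** J1 + J3 ** C1 + (C1 ** J3 + J1 ** C3) = 0"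
  shows "C1 = coef J2 C1 *\<^sub>R J2 - coef J1 C3 *\<^sub>R J3"
    and "C2 = coef J3 C2 *\<^sub>R J3 - coef J2 C1 *\<^sub>R J1"
    and "C3 = coef J1 C3 *\<^sub>R J1 - coef J3 C2 *\<^sub>R J2"
proof -
  have 1: "coef J1 C1 = 0" "coef J2 C2 = 0" "coef J3 C3 = 0"
    using assms(4-6)[THEN arg_cong[where f=trace]]
    by (simp_all add: coef_def trace_simps trace_mul_sym[of J1 C1] trace_mul_sym[of J2 C2]
        trace_mul_sym[of J3 C3])
  have "trace (C2 ** J1) = - trace (C1 ** J2)" "trace (C3 ** J2) = - trace (C2 ** J3)"
    "trace (C1 ** J3) = - trace (C3 ** J1)"
    using assms(7-9)[THEN arg_cong[where f=trace]]
    by (simp_all add: trace_simps trace_mul_sym[of J1] trace_mul_sym[of J2] trace_mul_sym[of J3])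
  then have 2: "coef J1 C2 = - coef J2 C1" "coef J2 C3 = - coef J3 C2" "coef J3 C1 = - coef J1 C3"
    by (simp_all add: coef_def)
  show "C1 = coef J2 C1 *\<^sub>R J2 - coef J1 C3 *\<^sub>R J3"
    using span_coef[OF assms(1)] 1 2 by simp
  show "C2 = coef J3 C2 *\<^sub>R J3 - coef J2 C1 *\<^sub>R J1"
    using span_coef[OF assms(2)] 1 2 by simp
  show "C3 = coef J1 C3 *\<^sub>R J1 - coef J3 C2 *\<^sub>R J2"
    using span_coef[OF assms(3)] 1 2 by simp
qed

text \<open>
  For \<open>C = \<nabla>J1\<close> with \<open>\<nabla>\<close> torsion-free the hypothesis is the vanishing of the Nijenhuis tensor of \<open>J1\<close>.
  Testing it on \<open>y = J2 x\<close> suffices, also in dimension 4.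
\<close>

lemma nijenhuis_coefs:
  assumes C: "\<And>x. C x = w3 x *\<^sub>R J2 - w2 x *\<^sub>R J3"
    and sym: "\<And>x y. C (J1 *v x) *v y - J1 *v (C x *v y) = C (J1 *v y) *v x - J1 *v (C y *v x)"
    and lin: "linear w2" "linear w3"
  shows "w2 x = w3 (J1 *v x)"
proof (cases "x = 0")
  case True
  then show ?thesis using lin by (simp add: linear_0)
next
  case False
  let ?a = "\<lambda>x. w3 (J1 *v x) - w2 x" and ?b = "\<lambda>x. w2 (J1 *v x) + w3 x"
  let ?y = "J2 *v x"
  have E: "C (J1 *v x) *v y - J1 *v (C x *v y) = ?a x *\<^sub>R (J2 *v y) - ?b x *\<^sub>R (J3 *v y)" for x y
    unfolding C by (simp add: quaternion_simps algebra_simps)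
  have "?a x *\<^sub>R (J2 *v ?y) - ?b x *\<^sub>R (J3 *v ?y) = ?a ?y *\<^sub>R (J2 *v x) - ?b ?y *\<^sub>R (J3 *v x)"
    using sym[of x ?y] unfolding E .
  \<comment> \<open>With y = J2 x both sides are combinations of x, J1 x, J2 x, J3 x, and x itself
    occurs only on the left, with coefficient \<open>- ?a x\<close>.\<close>
  then have "(- ?a x) *\<^sub>R x + ?b x *\<^sub>R (J1 *v x) + (- ?a ?y) *\<^sub>R (J2 *v x) + ?b ?y *\<^sub>R (J3 *v x) = 0"
    unfolding matrix_vector_mul_assoc J_mult
    by (simp add: matrix_vector_simps(5,12) algebra_simps)
  from J_vector_independent[OF this False] show ?thesis by simp
qed

text \<open>Symmetry carries linearity over J1 and J2 to both arguments. Pulling J1 out of the first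
  and J2 out of the second argument in either order gives J2 J1 D = J1 J2 D, that is - J3 D = J3
  D.\<close>

lemma commuting_zero:
  assumes sym: "\<And>v w. D v *v w = D w *v v"
    and com: "\<And>v. D v ** J1 = J1 ** D v" "\<And>v. D v ** J2 = J2 ** D v"
  shows "D v = 0"
proof (rule matrix_eqI)
  fix w
  have 1: "D x *v (J1 *v y) = J1 *v (D x *v y)" "D x *v (J2 *v y) = J2 *v (D x *v y)" for x y
    using com by (simp_all add: matrix_vector_mul_assoc)
  have "J2 *v (J1 *v (D v *v w)) = D (J1 *v v) *v (J2 *v w)"
    by (metis 1 sym)
  also have "\<dots> = J1 *v (J2 *v (D v *v w))"
    by (metis 1 sym)
  finally have "J3 *v (D v *v w) = 0"
    unfolding matrix_vector_mul_assoc[of _ _ "D v *v w"] J_mult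
    by (metis matrix_vector_simps(5) self_eq_neg_zero)
  then have "J3 *v (J3 *v (D v *v w)) = 0" by simp
  then show "D v *v w = 0 *v w"
    unfolding matrix_vector_mul_assoc[of _ _ "D v *v w"] J_mult
    by (simp add: matrix_vector_simps(5,12))
qed

text \<open>The difference tensor of two quaternionic connections.\<close>

definition quat_tensor :: "real^'k \<Rightarrow> real^'k \<Rightarrow> real^'k^'k" where
  "quat_tensor \<theta> v = (\<theta> \<bullet> v) *\<^sub>R mat 1 + outer v \<theta>
     - ((\<theta> \<bullet> (J1 *v v)) *\<^sub>R J1 + outer (J1 *v v) \<theta> ** J1)
     - ((\<theta> \<bullet> (J2 *v v)) *\<^sub>R J2 + outer (J2 *v v) \<theta> ** J2)
     - ((\<theta> \<bullet> (J3 *v v)) *\<^sub>R J3 + outer (J3 *v v) \<theta> ** J3)"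

lemma quat_tensor_apply: "quat_tensor \<theta> v *v w = (\<theta> \<bullet> v) *\<^sub>R w + (\<theta> \<bullet> w) *\<^sub>R v
   - ((\<theta> \<bullet> (J1 *v v)) *\<^sub>R (J1 *v w) + (\<theta> \<bullet> (J1 *v w)) *\<^sub>R (J1 *v v))
   - ((\<theta> \<bullet> (J2 *v v)) *\<^sub>R (J2 *v w) + (\<theta> \<bullet> (J2 *v w)) *\<^sub>R (J2 *v v))
   - ((\<theta> \<bullet> (J3 *v v)) *\<^sub>R (J3 *v w) + (\<theta> \<bullet> (J3 *v w)) *\<^sub>R (J3 *v v))"
  unfolding quat_tensor_def matrix_vector_simps(1-10) matrix_vector_mul_assoc[symmetric]
    outer_mult_vector matrix_vector_mul_lid ..

lemma quat_tensor_sym: "quat_tensor \<theta> v *v w = quat_tensor \<theta> w *v v"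
  unfolding quat_tensor_apply by simp

text \<open>Linearity in the second argument is that of a matrix, and symmetry moves it to the
  first.\<close>

lemma linear_quat_tensor: "linear (quat_tensor \<theta>)"
proof (rule linearI; rule matrix_eqI)
  show "quat_tensor \<theta> (x + y) *v w = (quat_tensor \<theta> x + quat_tensor \<theta> y) *v w" for x y w
    using quat_tensor_sym[of \<theta> _ w] by (simp add: matrix_vector_simps(1,2))
  show "quat_tensor \<theta> (r *\<^sub>R x) *v w = (r *\<^sub>R quat_tensor \<theta> x) *v w" for r x w
    using quat_tensor_sym[of \<theta> _ w] by (simp add: matrix_vector_simps(7,8))
qed

text \<open>The identity contributes the dimension and v \<otimes> \<theta> contributes 1. The trace
  of \<open>outer (J *v v) \<theta> ** J\<close> is \<theta>(J J v) = - \<theta>(v), so each of the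
  three subtracted terms adds 1 as well. In dimension 4n the factor is 4 (n + 1).\<close>

lemma trace_quat_tensor: "trace (quat_tensor \<theta> v) = (real CARD('k) + 4) * (\<theta> \<bullet> v)"
  unfolding quat_tensor_def trace_simps trace_mul_sym[of "outer _ _"] mult_outer trace_outer
    matrix_vector_mul_assoc J_mult trace_J trace_I
  by (simp add: matrix_vector_simps algebra_simps)

lemma quat_tensor_rotate: "quaternion_frame.quat_tensor J2 J3 J1 = quat_tensor"
  unfolding quaternion_frame.quat_tensor_def[OF rotate] quat_tensor_def fun_eq_iff by simp

lemma quat_tensor_commutator1:
  "quat_tensor \<theta> v ** J1 - J1 ** quat_tensor \<theta> v =
     (2 * (\<theta> \<bullet> (J2 *v v))) *\<^sub>R J3 - (2 * (\<theta> \<bullet> (J3 *v v))) *\<^sub>R J2"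
proof (rule matrix_eqI)
  fix w
  have "(quat_tensor \<theta> v ** J1 - J1 ** quat_tensor \<theta> v) *v w =
      quat_tensor \<theta> v *v (J1 *v w) - J1 *v (quat_tensor \<theta> v *v w)"
    by (simp add: matrix_vector_simps)
  also have "\<dots> = ((2 * (\<theta> \<bullet> (J2 *v v))) *\<^sub>R J3 - (2 * (\<theta> \<bullet> (J3 *v v))) *\<^sub>R J2) *v w"
    unfolding quat_tensor_apply by (simp add: quaternion_simps) (simp add: vec_eq_iff algebra_simps)
  finally show "(quat_tensor \<theta> v ** J1 - J1 ** quat_tensor \<theta> v) *v w =
      ((2 * (\<theta> \<bullet> (J2 *v v))) *\<^sub>R J3 - (2 * (\<theta> \<bullet> (J3 *v v))) *\<^sub>R J2) *v w" .
qed

lemma quat_tensor_commutator2: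
  "quat_tensor \<theta> v ** J2 - J2 ** quat_tensor \<theta> v =
     (2 * (\<theta> \<bullet> (J3 *v v))) *\<^sub>R J1 - (2 * (\<theta> \<bullet> (J1 *v v))) *\<^sub>R J3"
  using quaternion_frame.quat_tensor_commutator1[OF rotate] unfolding quat_tensor_rotate .

lemma quat_tensor_commutator3:
  "quat_tensor \<theta> v ** J3 - J3 ** quat_tensor \<theta> v =
     (2 * (\<theta> \<bullet> (J1 *v v))) *\<^sub>R J2 - (2 * (\<theta> \<bullet> (J2 *v v))) *\<^sub>R J1"
  using quaternion_frame.quat_tensor_commutator2[OF rotate] unfolding quat_tensor_rotate .

lemma quat_tensor_preserves:
  assumes "B \<in> span {J1, J2, J3}"
  shows "quat_tensor \<theta> v ** B - B ** quat_tensor \<theta> v \<in> span {J1, J2, J3}"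
proof -
  obtain a b c where B: "B = a *\<^sub>R J1 + b *\<^sub>R J2 + c *\<^sub>R J3"
    using assms unfolding span_eq by blast
  have "quat_tensor \<theta> v ** B - B ** quat_tensor \<theta> v =
      a *\<^sub>R (quat_tensor \<theta> v ** J1 - J1 ** quat_tensor \<theta> v)
      + b *\<^sub>R (quat_tensor \<theta> v ** J2 - J2 ** quat_tensor \<theta> v)
      + c *\<^sub>R (quat_tensor \<theta> v ** J3 - J3 ** quat_tensor \<theta> v)"
    unfolding B by (simp add: matrix_ring_simps algebra_simps)
  then show ?thesis
    unfolding quat_tensor_commutator1 quat_tensor_commutator2 quat_tensor_commutator3
    by (auto intro!: span_add span_scale span_diff intro: span_base)
qed

text \<open>The commutators of D with the triple are given by three linear forms. The Nijenhuis
  identity ties these forms to a single \<theta>, and then D and the tensor of \<theta> have equal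
  commutators, so that \<open>commuting_zero\<close> applies to their difference.\<close>

lemma difference_tensor:
  assumes lin: "linear D" and sym: "\<And>v w. D v *v w = D w *v v"
    and pres: "\<And>v B. B \<in> span {J1, J2, J3} \<Longrightarrow> D v ** B - B ** D v \<in> span {J1, J2, J3}"
  obtains \<theta> where "\<And>v. D v = quat_tensor \<theta> v"
proof -
  let ?C = "\<lambda>J v. D v ** J - J ** D v"
  define w1 w2 w3 where "w1 v = coef J3 (?C J2 v)" and "w2 v = coef J1 (?C J3 v)"
    and "w3 v = coef J2 (?C J1 v)" for v
  have linC: "linear (?C J)" for J
    using lin by (auto simp: linear_iff matrix_ring_simps algebra_simps)
  have linw: "linear w1" "linear w2" "linear w3"
    using linC[of J1] linC[of J2] linC[of J3]
    unfolding w1_def w2_def w3_def by (auto intro: linear_compose[OF _ linear_coef, unfolded o_def])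
  have d: "?C J1 v = w3 v *\<^sub>R J2 - w2 v *\<^sub>R J3 \<and> ?C J2 v = w1 v *\<^sub>R J3 - w3 v *\<^sub>R J1
    \<and> ?C J3 v = w2 v *\<^sub>R J1 - w1 v *\<^sub>R J2" for v
    unfolding w1_def w2_def w3_def
    by (intro conjI derivation_coefs[of "?C J1 v" "?C J2 v" "?C J3 v"] pres span_base)
       (simp_all add: quaternion_simps)
  then have C: "?C J1 v = w3 v *\<^sub>R J2 - w2 v *\<^sub>R J3" "?C J2 v = w1 v *\<^sub>R J3 - w3 v *\<^sub>R J1"
    "?C J3 v = w2 v *\<^sub>R J1 - w1 v *\<^sub>R J2" for v
    by blast+
  \<comment> \<open>The commutator of a symmetric D with an almost complex J satisfies the Nijenhuis
    identity automatically: expanded with J J = -1, the two sides match term by term under the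
    symmetry of D.\<close>
  have N: "?C J (J *v x) *v y - J *v (?C J x *v y) = ?C J (J *v y) *v x - J *v (?C J y *v x)"
    if "J ** J = - mat 1" for J x y
  proof -
    have JJ: "J *v (J *v z) = - z" for z
      unfolding matrix_vector_mul_assoc that by (simp add: matrix_vector_simps)
    have E: "?C J a *v b = D a *v (J *v b) - J *v (D a *v b)" for a b
      by (simp add: matrix_vector_simps)
    show ?thesis
      unfolding E matrix_vector_simps(4) JJ
      using sym[of "J *v x" "J *v y"] sym[of "J *v x" y] sym[of x "J *v y"] sym[of x y] by simp
  qed
  interpret r: quaternion_frame J2 J3 J1 by (rule rotate)
  interpret r2: quaternion_frame J3 J1 J2 by (rule r.rotate)
  \<comment> \<open>The same pointwise lemma at J1 and, after rotation, at J2; these two relations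
    already reduce the three forms to one.\<close>
  have w: "w2 x = w3 (J1 *v x)" "w3 x = w1 (J2 *v x)" for x
    by (rule nijenhuis_coefs[where C="?C J1"], auto intro!: C N J_mult linw)
       (rule r.nijenhuis_coefs[where C="?C J2"], auto intro!: C N J_mult linw)
  \<comment> \<open>Solves w2(v) = - 2 \<theta>(J2 v), the relation forced by comparing the J3-parts
    in \<open>quat_tensor_commutator1\<close>, by substituting J2 v for v.\<close>
  obtain \<theta> where "(1 / 2) * w2 (J2 *v v) = \<theta> \<bullet> v" for v
    by (rule linear_functional_inner[of "\<lambda>v. (1 / 2) * w2 (J2 *v v)"])
       (use linw in \<open>auto simp: linear_iff matrix_vector_simps algebra_simps\<close>)
  then have th: "\<theta> \<bullet> v = w2 (J2 *v v) / 2" for v by (metis mult.commute times_divide_eq_right mult_1)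
  have neg: "w2 (- x) = - w2 x" "w3 (- x) = - w3 x" "w1 (- x) = - w1 x" for x
    using linw by (simp_all add: linear_neg)
  have wth: "w2 v = - 2 * (\<theta> \<bullet> (J2 *v v))" "w3 v = - 2 * (\<theta> \<bullet> (J3 *v v))"
    "w1 v = - 2 * (\<theta> \<bullet> (J1 *v v))" for v
    unfolding th w matrix_vector_mul_assoc J_mult
    by (simp_all add: quaternion_simps neg)
  let ?E = "\<lambda>v. D v - quat_tensor \<theta> v"
  have "?E v = 0" for v
  proof (rule commuting_zero)
    show "?E v *v w = ?E w *v v" for v w
      using sym[of v w] quat_tensor_sym[of \<theta> v w] by (simp add: matrix_vector_simps)
    have com: "?C J v = quat_tensor \<theta> v ** J - J ** quat_tensor \<theta> v \<Longrightarrow> ?E v ** J = J ** ?E v" for J v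
      by (simp add: matrix_ring_simps(3,4) algebra_simps)
    show "?E v ** J1 = J1 ** ?E v" for v
      by (rule com) (simp add: C quat_tensor_commutator1 wth)
    show "?E v ** J2 = J2 ** ?E v" for v
      by (rule com) (simp add: C quat_tensor_commutator2 wth)
  qed
  then show ?thesis using that by simp
qed

lemma quat_tensor_zero: "quat_tensor 0 v = 0"
  by (rule matrix_eqI) (simp add: quat_tensor_apply matrix_vector_simps)

text \<open>The trace recovers \<theta> because its factor is positive. This yields both the
  independence of \<open>Q_tensor\<close> from the triple and the uniqueness of the connection with
  a prescribed parallel volume form.\<close>

lemma difference_tensor_trace_zero:
  assumes "linear D" "\<And>v w. D v *v w = D w *v v"
    and "\<And>v B. B \<in> span {J1, J2, J3} \<Longrightarrow> D v ** B - B ** D v \<in> span {J1, J2, J3}"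
    and "\<And>v. trace (D v) = 0"
  shows "D v = 0"
proof -
  obtain \<theta> where D: "\<And>v. D v = quat_tensor \<theta> v"
    using difference_tensor assms(1-3) by blast
  then have "\<theta> \<bullet> v = 0" for v
    using assms(4)[of v] trace_quat_tensor[of \<theta> v]
    by (metis D mult_eq_0_iff of_nat_0_le_iff add_nonneg_pos less_irrefl zero_less_numeral)
  then show ?thesis by (metis D inner_eq_zero_iff quat_tensor_zero)
qed

text \<open>The commutator with J1 alone already contains \<theta> composed with the invertible J2.
  Hence two quaternionic connections with J1 parallel coincide.\<close>

lemma difference_tensor_commuting:
  assumes "linear D" "\<And>v w. D v *v w = D w *v v"
    and "\<And>v B. B \<in> span {J1, J2, J3} \<Longrightarrow> D v ** B - B ** D v \<in> span {J1, J2, J3}"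
    and "\<And>v. D v ** J1 = J1 ** D v"
  shows "D v = 0"
proof -
  obtain \<theta> where D: "\<And>v. D v = quat_tensor \<theta> v"
    using difference_tensor assms(1-3) by blast
  have "0 *\<^sub>R J1 + (- 2 * (\<theta> \<bullet> (J3 *v v))) *\<^sub>R J2 + (2 * (\<theta> \<bullet> (J2 *v v))) *\<^sub>R J3 = 0" for v
    using quat_tensor_commutator1[of \<theta> v] assms(4)[of v] unfolding D by simp
  from J_independent(3)[OF this] have "\<theta> \<bullet> (J2 *v v) = 0" for v by simp
  from this[of "- (J2 *v _)"] have "\<theta> \<bullet> v = 0" for v
    by (simp add: quaternion_simps)
  then show ?thesis by (metis D inner_eq_zero_iff quat_tensor_zero)
qed

section \<open>Recognising triples inside a given fibre\<close>

lemma dim_span_triple: "dim (span {J1, J2, J3}) = 3"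
proof -
  have d: "J1 \<noteq> J2" "J1 \<noteq> J3" "J2 \<noteq> J3"
    using J_independent(1)[of 1 "-1" 0] J_independent(1)[of 1 0 "-1"] J_independent(2)[of 0 1 "-1"] by auto
  have "independent {J1, J2, J3}"
  proof (rule independent_if_scalars_zero)
    fix f x assume "(\<Sum>x\<in>{J1, J2, J3}. f x *\<^sub>R x) = 0" "x \<in> {J1, J2, J3}"
    then show "f x = 0"
      using J_independent[of "f J1" "f J2" "f J3"] d by (auto simp: add.assoc)
  qed simp
  then have "dim {J1, J2, J3} = card {J1, J2, J3}" by (rule dim_eq_card_independent)
  then show ?thesis using d by (simp add: dim_span)
qed

text \<open>Every triple spans three dimensions, so one inclusion is enough.\<close>

lemma span_triple_eqI:
  assumes "quaternion_triple K1 K2 K3" "{K1, K2, K3} \<subseteq> span {J1, J2, J3}"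
  shows "span {K1, K2, K3} = span {J1, J2, J3}"
proof -
  interpret K: quaternion_frame K1 K2 K3 by unfold_locales (rule assms(1))
  show ?thesis
    by (rule subspace_dim_equal) (simp_all only: subspace_span span_minimal assms(2)
        K.dim_span_triple dim_span_triple order.refl)
qed

text \<open>Elements of the span are imaginary quaternions, and \<open>C\<close> is their cross product.\<close>

lemma span_triple_mult:
  assumes "A \<in> span {J1, J2, J3}" "B \<in> span {J1, J2, J3}"
  obtains C where "C \<in> span {J1, J2, J3}" "A ** B = (trace (A ** B) / CARD('k)) *\<^sub>R mat 1 + C"
    "B ** A = (trace (A ** B) / CARD('k)) *\<^sub>R mat 1 - C"
proof -
  obtain a b c where A: "A = a *\<^sub>R J1 + b *\<^sub>R J2 + c *\<^sub>R J3"
    using assms(1) unfolding span_eq by blast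
  obtain a' b' c' where B: "B = a' *\<^sub>R J1 + b' *\<^sub>R J2 + c' *\<^sub>R J3"
    using assms(2) unfolding span_eq by blast
  let ?C = "(b * c' - c * b') *\<^sub>R J1 + (c * a' - a * c') *\<^sub>R J2 + (a * b' - b * a') *\<^sub>R J3"
  have AB: "A ** B = (- (a * a' + b * b' + c * c')) *\<^sub>R mat 1 + ?C"
    and BA: "B ** A = (- (a * a' + b * b' + c * c')) *\<^sub>R mat 1 - ?C"
    unfolding A B by (simp_all add: quaternion_simps algebra_simps)
  have "trace (A ** B) / CARD('k) = - (a * a' + b * b' + c * c')"
    unfolding AB trace_simps trace_J trace_I by simp
  then show ?thesis
    using AB BA by (intro that[of ?C]) (auto simp: span_eq)
qed

text \<open>For imaginary quaternions, orthogonality means anticommutation and unit length means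
  square -1. An orthonormal pair is thus completed by its product, as in the oriented
  three-dimensional space.\<close>

lemma orthonormal_triple:
  assumes "A \<in> span {J1, J2, J3}" "B \<in> span {J1, J2, J3}"
    and "A ** A = - mat 1" "trace (A ** B) = 0" "trace (B ** B) = - real CARD('k)"
  shows "quaternion_triple A B (A ** B)" "span {A, B, A ** B} = span {J1, J2, J3}"
proof -
  obtain C where C0: "C \<in> span {J1, J2, J3}" "A ** B = (0 / CARD('k)) *\<^sub>R mat 1 + C"
    "B ** A = (0 / CARD('k)) *\<^sub>R mat 1 - C"
    by (rule span_triple_mult[OF assms(1,2), unfolded assms(4)])
  then have C: "A ** B = C" "B ** A = - C" by simp_all
  \<comment> \<open>The cross product of B with itself appears with both signs and must
    vanish.\<close>
  obtain C' where C': "B ** B = (- real CARD('k) / CARD('k)) *\<^sub>R mat 1 + C'"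
    "B ** B = (- real CARD('k) / CARD('k)) *\<^sub>R mat 1 - C'"
    by (rule span_triple_mult[OF assms(2,2), unfolded assms(5)])
  then have "- C' = C'" by simp
  then have BB: "B ** B = - mat 1"
    using C'(1) self_eq_neg_zero[of C'] by simp
  have "A ** B ** (A ** B) = A ** (B ** A) ** B" by (simp add: matrix_mul_assoc)
  also have "\<dots> = - (A ** A ** (B ** B))"
    unfolding C(2)[folded C(1)] by (simp add: matrix_ring_simps)
  also have "\<dots> = - mat 1" by (simp add: assms(3) BB matrix_ring_simps)
  finally show t: "quaternion_triple A B (A ** B)"
    using C BB assms(3) by (simp add: quaternion_triple_def)
  show "span {A, B, A ** B} = span {J1, J2, J3}"
    by (rule span_triple_eqI[OF t]) (use C C0(1) assms(1,2) in auto)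
qed

text \<open>Definiteness of the fibre metric, which makes it possible to normalise a nonzero
  section.\<close>

lemma span_square_neg:
  assumes "B \<in> span {J1, J2, J3}" "B \<noteq> 0"
  shows "trace (B ** B) < 0"
proof -
  obtain a b c where B: "B = a *\<^sub>R J1 + b *\<^sub>R J2 + c *\<^sub>R J3"
    using assms(1) unfolding span_eq by blast
  have "trace (B ** B) = - (real CARD('k) * (a\<^sup>2 + b\<^sup>2 + c\<^sup>2))"
    unfolding B by (simp add: quaternion_simps trace_simps trace_J trace_I algebra_simps power2_eq_square)
  moreover have "a\<^sup>2 + b\<^sup>2 + c\<^sup>2 > 0"
    using assms(2) unfolding B
    by (metis add_0 scaleR_zero_left sum_power2_gt_zero_iff sum_power2_ge_zero add_nonneg_pos
        add_pos_nonneg zero_le_power2 zero_less_power2)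
  ultimately show ?thesis by simp
qed

end

text \<open>In the Leibniz expansion only the identity permutation survives, and it contributes the
  diagonal of H.\<close>

lemma det_has_derivative_mat_1:
  "((det :: real^'n^'n \<Rightarrow> real) has_derivative trace) (at (mat 1))"
proof -
  let ?P = "{p. p permutes (UNIV :: 'n set)}"
  have "((\<lambda>A :: real^'n^'n. \<Sum>p\<in>?P. of_int (sign p) * (\<Prod>i\<in>UNIV. A $ i $ p i)) has_derivative
      (\<lambda>H. \<Sum>p\<in>?P. of_int (sign p) *
        (\<Sum>i\<in>UNIV. H $ i $ p i * (\<Prod>j\<in>UNIV - {i}. (mat 1 :: real^'n^'n) $ j $ p j)))) (at (mat 1))"
    by (intro has_derivative_sum has_derivative_mult_right has_derivative_prod
        bounded_linear.has_derivative[OF bounded_linear_vec_nth] has_derivative_ident)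
  moreover have "(\<Sum>p\<in>?P. of_int (sign p) *
      (\<Sum>i\<in>UNIV. H $ i $ p i * (\<Prod>j\<in>UNIV - {i}. (mat 1 :: real^'n^'n) $ j $ p j))) = trace H"
    for H :: "real^'n^'n"
  proof -
    \<comment> \<open>A permutation other than the identity moves at least two indices.
      Differentiation removes one factor, so an off-diagonal entry 0 of the identity matrix
      remains.\<close>
    have zero: "(\<Prod>j\<in>UNIV - {i}. (mat 1 :: real^'n^'n) $ j $ p j) = 0" if p: "p \<in> ?P - {id}" for p i
    proof -
      obtain j where j: "p j \<noteq> j" using p by (auto simp: fun_eq_iff)
      have "inj p" using p permutes_inj by blast
      then have pj: "p (p j) \<noteq> p j" using j by (auto dest: injD)
      obtain k where "k \<noteq> i" "p k \<noteq> k" using j pj by metis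
      then show ?thesis by (auto simp: mat_def intro!: bexI[of _ k])
    qed
    have "(\<Sum>p\<in>?P. of_int (sign p) *
        (\<Sum>i\<in>UNIV. H $ i $ p i * (\<Prod>j\<in>UNIV - {i}. (mat 1 :: real^'n^'n) $ j $ p j)))
      = (\<Sum>p\<in>{id}. of_int (sign p) *
        (\<Sum>i\<in>UNIV. H $ i $ p i * (\<Prod>j\<in>UNIV - {i}. (mat 1 :: real^'n^'n) $ j $ p j)))"
      by (rule sum.mono_neutral_right) (auto simp: zero finite_permutations permutes_id)
    then show ?thesis by (simp add: mat_def trace_def sign_id)
  qed
  ultimately show ?thesis
    unfolding det_def[abs_def] by simp
qed

text \<open>Jacobi's formula, reduced to the identity matrix by multiplying with the constant
  inverse \<open>N\<close> of \<open>M x\<close>.\<close>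

lemma det_has_derivative:
  fixes M :: "'a::real_normed_vector \<Rightarrow> real^'n^'n"
  assumes "(M has_derivative D) (at x)" "N ** M x = mat 1"
  shows "((\<lambda>y. det (M y)) has_derivative (\<lambda>v. det (M x) * trace (N ** D v))) (at x)"
proof -
  have MN: "M x ** N = mat 1" by (rule matrix_left_right_inverse[THEN iffD1, OF assms(2)])
  have "((\<lambda>y. N ** M y) has_derivative (\<lambda>v. N ** D v)) (at x)"
    by (rule bounded_linear.has_derivative[OF
        bounded_bilinear.bounded_linear_right[OF bounded_bilinear_matrix_mult] assms(1)])
  from has_derivative_compose[OF this det_has_derivative_mat_1[where 'n='n, folded assms(2)]]
  have "((\<lambda>y. det (M x) * det (N ** M y)) has_derivative (\<lambda>v. det (M x) * trace (N ** D v))) (at x)"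
    by (rule has_derivative_mult_right)
  moreover have "det (M x) * det (N ** M y) = det (M y)" for y
    unfolding det_mul[symmetric] matrix_mul_assoc MN by simp
  ultimately show ?thesis by simp
qed

section \<open>Calculus in charts\<close>

text \<open>Relational companion of \<open>deriv_in\<close>: it carries differentiability along, so
  the rules for sums, products and chart changes hold without side conditions on a chosen
  derivative.\<close>

definition has_deriv_in ::
  "('m, 'k::finite) chart \<Rightarrow> ('m \<Rightarrow> 'b::real_normed_vector) \<Rightarrow> 'm \<Rightarrow> (real ^ 'k \<Rightarrow> 'b) \<Rightarrow> bool" where
  "has_deriv_in c f p D \<longleftrightarrow> ((f \<circ> chart_inv c) has_derivative D) (at (snd c p))"

lemma has_deriv_inD: "has_deriv_in c f p D \<Longrightarrow> deriv_in c f p v = D v"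
  unfolding has_deriv_in_def deriv_in_def using frechet_derivative_at by metis

lemma has_deriv_in_const: "has_deriv_in c (\<lambda>_. a) p (\<lambda>_. 0)"
  by (simp add: has_deriv_in_def o_def)

lemma has_deriv_in_bounded_linear:
  "bounded_linear L \<Longrightarrow> has_deriv_in c f p D \<Longrightarrow> has_deriv_in c (\<lambda>q. L (f q)) p (\<lambda>v. L (D v))"
  unfolding has_deriv_in_def o_def by (rule bounded_linear.has_derivative)

locale manifold =
  fixes A :: "('m::{t2_space, second_countable_topology}, 'k::finite) atlas"
  assumes atlas: "smooth_atlas A"
begin

lemma chart_open: "c \<in> A \<Longrightarrow> open (fst c)"
  using atlas by (auto simp: smooth_atlas_def)

lemma chart_exists: "\<exists>c\<in>A. p \<in> fst c"
  using atlas by (auto simp: smooth_atlas_def)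

lemma chart_homeomorphism: "c \<in> A \<Longrightarrow> homeomorphism (fst c) (snd c ` fst c) (snd c) (chart_inv c)"
  using atlas by (auto simp: smooth_atlas_def)

lemma chart_inv_chart [simp]: "c \<in> A \<Longrightarrow> p \<in> fst c \<Longrightarrow> chart_inv c (snd c p) = p"
  using chart_homeomorphism by (auto simp: homeomorphism_def)

lemma open_coords:
  assumes "c \<in> A" "open U"
  shows "open (snd c ` (fst c \<inter> U))"
proof -
  have "openin (top_of_set (snd c ` fst c)) (snd c ` (fst c \<inter> U))"
    using assms by (intro homeomorphism_imp_open_map[OF chart_homeomorphism]) auto
  moreover have "open (snd c ` fst c)"
    using atlas assms(1) by (auto simp: smooth_atlas_def)
  ultimately show ?thesis using openin_open_eq by blast
qed

lemma open_chart_vimage: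
  assumes "c \<in> A" "open B"
  shows "open {p \<in> fst c. snd c p \<in> B}"
proof -
  have "continuous_on (fst c) (snd c)"
    using chart_homeomorphism[OF assms(1)] by (simp add: homeomorphism_def)
  then have "open (snd c -` B \<inter> fst c)"
    using assms chart_open continuous_on_open_vimage by blast
  then show ?thesis by (simp add: vimage_def Int_def conj_commute)
qed

lemma smooth_in_cong:
  assumes "c \<in> A" "open U" "\<And>q. q \<in> fst c \<inter> U \<Longrightarrow> f q = g q"
  shows "smooth_in c U f \<longleftrightarrow> smooth_in c U g"
  unfolding smooth_in_def by (intro smooth_on_cong open_coords) (use assms in auto)

lemma smooth_in_subset: "smooth_in c U f \<Longrightarrow> V \<subseteq> U \<Longrightarrow> smooth_in c V f"
  unfolding smooth_in_def by (erule smooth_on_subset) auto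

lemma smooth_in_Int_chart: "smooth_in c (fst c \<inter> U) f \<longleftrightarrow> smooth_in c U f"
  unfolding smooth_in_def by (simp add: Int_left_absorb)

lemma smooth_in_local:
  assumes "c \<in> A" "\<And>p. p \<in> fst c \<inter> U \<Longrightarrow> \<exists>V. open V \<and> p \<in> V \<and> smooth_in c V f"
  shows "smooth_in c U f"
  unfolding smooth_in_def
proof (rule smooth_on_local)
  fix x assume "x \<in> snd c ` (fst c \<inter> U)"
  then obtain p where p: "p \<in> fst c \<inter> U" "x = snd c p" by auto
  from assms(2)[OF p(1)] obtain V where "open V" "p \<in> V" "smooth_in c V f" by blast
  then show "\<exists>T. open T \<and> x \<in> T \<and> smooth_on T (f \<circ> chart_inv c)"
    using p assms(1) by (intro exI[of _ "snd c ` (fst c \<inter> V)"]) (auto simp: open_coords smooth_in_def)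
qed

lemma smooth_in_const: "c \<in> A \<Longrightarrow> open U \<Longrightarrow> smooth_in c U (\<lambda>_. a)"
  unfolding smooth_in_def o_def by (intro smooth_on_const open_coords)

lemma smooth_in_bounded_linear:
  "c \<in> A \<Longrightarrow> open U \<Longrightarrow> bounded_linear L \<Longrightarrow> smooth_in c U f \<Longrightarrow> smooth_in c U (\<lambda>q. L (f q))"
  unfolding smooth_in_def o_def by (rule smooth_on_bounded_linear[OF open_coords])

lemma smooth_in_add:
  "c \<in> A \<Longrightarrow> open U \<Longrightarrow> smooth_in c U f \<Longrightarrow> smooth_in c U g \<Longrightarrow> smooth_in c U (\<lambda>q. f q + g q)"
  unfolding smooth_in_def o_def by (intro smooth_on_add open_coords)

lemma smooth_in_diff:
  "c \<in> A \<Longrightarrow> open U \<Longrightarrow> smooth_in c U f \<Longrightarrow> smooth_in c U g \<Longrightarrow> smooth_in c U (\<lambda>q. f q - g q)"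
  unfolding smooth_in_def o_def by (intro smooth_on_diff open_coords)

lemma smooth_in_bilinear:
  "bounded_bilinear pr \<Longrightarrow> c \<in> A \<Longrightarrow> open U \<Longrightarrow> smooth_in c U f \<Longrightarrow> smooth_in c U g
    \<Longrightarrow> smooth_in c U (\<lambda>q. pr (f q) (g q))"
  unfolding smooth_in_def o_def by (rule smooth_on_bilinear[OF _ open_coords])

lemma smooth_in_sum:
  "c \<in> A \<Longrightarrow> open U \<Longrightarrow> finite S \<Longrightarrow> (\<And>j. j \<in> S \<Longrightarrow> smooth_in c U (f j))
    \<Longrightarrow> smooth_in c U (\<lambda>q. \<Sum>j\<in>S. f j q)"
  unfolding smooth_in_def o_def by (intro smooth_on_sum open_coords)

lemma smooth_in_powr:
  fixes N :: "'m \<Rightarrow> real"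
  assumes "c \<in> A" "open U" "smooth_in c U N" "\<And>q. q \<in> fst c \<inter> U \<Longrightarrow> N q > 0"
  shows "smooth_in c U (\<lambda>q. N q powr r)"
  using assms unfolding smooth_in_def o_def by (intro smooth_on_powr open_coords) auto

lemmas smooth_in_intros = smooth_in_const smooth_in_add smooth_in_diff
  smooth_in_bilinear[OF bounded_bilinear_mult] smooth_in_bilinear[OF bounded_bilinear_scaleR]
  smooth_in_bilinear[OF bounded_bilinear_inner]
  smooth_in_bilinear[OF bounded_bilinear_matrix_mult]
  smooth_in_bilinear[OF bounded_bilinear_matrix_vector_mult]
  smooth_in_bilinear[OF bounded_bilinear_outer]
  smooth_in_bounded_linear[OF _ _ bounded_linear_trace]

lemma smooth_in_has_deriv:
  assumes "smooth_in c U f" "p \<in> fst c \<inter> U"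
  shows "has_deriv_in c f p (deriv_in c f p)"
  using smooth_on_has_derivative[of "snd c ` (fst c \<inter> U)" "f \<circ> chart_inv c" "snd c p"] assms
  unfolding smooth_in_def has_deriv_in_def deriv_in_def by auto

lemma smooth_in_deriv:
  assumes "c \<in> A" "open U" "smooth_in c U f"
  shows "smooth_in c U (\<lambda>p. deriv_in c f p v)"
proof -
  have "smooth_on (snd c ` (fst c \<inter> U)) (\<lambda>x. frechet_derivative (f \<circ> chart_inv c) (at x) v)"
    using assms(3) unfolding smooth_in_def by (rule smooth_on_deriv)
  then show ?thesis
    unfolding smooth_in_def
    by (subst smooth_on_cong[OF open_coords[OF assms(1,2)]]) (auto simp: deriv_in_def assms(1))
qed

lemma has_deriv_in_linear: "has_deriv_in c f p D \<Longrightarrow> linear D"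
  unfolding has_deriv_in_def by (rule has_derivative_linear)

lemma has_deriv_in_bilinear:
  assumes "bounded_bilinear pr" "c \<in> A" "p \<in> fst c" "has_deriv_in c f p D" "has_deriv_in c g p E"
  shows "has_deriv_in c (\<lambda>q. pr (f q) (g q)) p (\<lambda>v. pr (f p) (E v) + pr (D v) (g p))"
  using bounded_bilinear.FDERIV[OF assms(1) assms(4,5)[unfolded has_deriv_in_def]] assms(2,3)
  unfolding has_deriv_in_def o_def by simp

lemma has_deriv_in_transform:
  assumes "c \<in> A" "open U" "p \<in> fst c \<inter> U" "\<And>q. q \<in> fst c \<inter> U \<Longrightarrow> f q = g q"
    and "has_deriv_in c f p D"
  shows "has_deriv_in c g p D"
  unfolding has_deriv_in_def
  by (rule has_derivative_transform_within_open[OF assms(5)[unfolded has_deriv_in_def]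
        open_coords[OF assms(1,2)]]) (use assms(1,3,4) in auto)

lemma deriv_in_cong:
  assumes "c \<in> A" "open U" "p \<in> fst c \<inter> U" "\<And>q. q \<in> fst c \<inter> U \<Longrightarrow> f q = g q"
  shows "deriv_in c f p v = deriv_in c g p v"
proof -
  have "has_deriv_in c f p D \<longleftrightarrow> has_deriv_in c g p D" for D
    using has_deriv_in_transform[OF assms(1-3)] assms(4) by metis
  then show ?thesis
    unfolding has_deriv_in_def deriv_in_def frechet_derivative_def by simp
qed

section \<open>Coordinate changes and their Jacobians\<close>

lemma smooth_in_coords:
  assumes "c \<in> A" "d \<in> A"
  shows "smooth_in c (fst d) (snd d)"
  using atlas assms unfolding smooth_atlas_def smooth_in_def by auto

lemma jac_has_deriv:
  assumes "c \<in> A" "d \<in> A" "p \<in> fst c \<inter> fst d"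
  shows "has_deriv_in c (snd d) p (\<lambda>v. jac c d p *v v)"
proof -
  have *: "has_deriv_in c (snd d) p (deriv_in c (snd d) p)"
    using smooth_in_has_deriv[OF smooth_in_coords[OF assms(1,2)]] assms(3) by simp
  have "jac c d p = matrix (deriv_in c (snd d) p)"
    by (simp add: differential_def deriv_in_def[abs_def] o_def)
  then have "deriv_in c (snd d) p = (\<lambda>v. jac c d p *v v)"
    using matrix_vector_mul(2)[OF has_deriv_in_linear[OF *]] by simp
  then show ?thesis using * by simp
qed

lemma jac_apply: "c \<in> A \<Longrightarrow> d \<in> A \<Longrightarrow> p \<in> fst c \<inter> fst d \<Longrightarrow> jac c d p *v v = deriv_in c (snd d) p v"
  using has_deriv_inD[OF jac_has_deriv] by metis

text \<open>Chain rule through the transition map. Inserting \<open>chart_inv d (snd d q)\<close>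
  for \<open>q\<close> is legitimate only on the overlap, hence the final transformation on an open
  set.\<close>

lemma has_deriv_in_change:
  assumes "c \<in> A" "d \<in> A" "p \<in> fst c \<inter> fst d" "has_deriv_in d f p D"
  shows "has_deriv_in c f p (\<lambda>v. D (jac c d p *v v))"
proof -
  have 1: "((snd d \<circ> chart_inv c) has_derivative (\<lambda>v. jac c d p *v v)) (at (snd c p))"
    using jac_has_deriv[OF assms(1-3)] by (simp add: has_deriv_in_def)
  have "((\<lambda>x. (f \<circ> chart_inv d) ((snd d \<circ> chart_inv c) x)) has_derivative
      (\<lambda>v. D (jac c d p *v v))) (at (snd c p))"
    by (rule has_derivative_compose[OF 1]) (use assms(1,3,4) in \<open>simp add: has_deriv_in_def comp_def\<close>)
  then have "has_deriv_in c (\<lambda>q. f (chart_inv d (snd d q))) p (\<lambda>v. D (jac c d p *v v))"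
    by (simp add: has_deriv_in_def o_def)
  then show ?thesis
    by (rule has_deriv_in_transform[OF assms(1) chart_open[OF assms(2)] assms(3), rotated])
       (use assms(2) in auto)
qed

lemma jac_cocycle:
  assumes "c \<in> A" "d \<in> A" "e \<in> A" "p \<in> fst c \<inter> fst d \<inter> fst e"
  shows "jac c e p = jac d e p ** jac c d p"
proof (rule matrix_eqI)
  fix v
  have "has_deriv_in c (snd e) p (\<lambda>v. jac d e p *v (jac c d p *v v))"
    using assms by (intro has_deriv_in_change jac_has_deriv) auto
  from has_deriv_inD[OF this]
  show "jac c e p *v v = (jac d e p ** jac c d p) *v v"
    using assms by (subst jac_apply) (auto simp: matrix_vector_mul_assoc)
qed

lemma jac_self:
  assumes "c \<in> A" "p \<in> fst c"
  shows "jac c c p = mat 1"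
proof (rule matrix_eqI)
  fix v
  have "((\<lambda>x. x) has_derivative (\<lambda>v. v)) (at (snd c p))" by (rule has_derivative_ident)
  then have "((snd c \<circ> chart_inv c) has_derivative (\<lambda>v. v)) (at (snd c p))"
    by (rule has_derivative_transform_within_open[OF _ open_coords[OF assms(1) open_UNIV]])
      (use assms in auto)
  then have "has_deriv_in c (snd c) p (\<lambda>v. v)" by (simp add: has_deriv_in_def)
  from has_deriv_inD[OF this] show "jac c c p *v v = mat 1 *v v"
    using assms by (subst jac_apply) auto
qed

lemma jac_inverse:
  assumes "c \<in> A" "d \<in> A" "p \<in> fst c \<inter> fst d"
  shows "jac d c p ** jac c d p = mat 1"
  using jac_cocycle[of c d c p] jac_self[of c p] assms by simp

lemma jac_cancel:
  assumes "c \<in> A" "d \<in> A" "p \<in> fst c \<inter> fst d" "X ** jac c d p = Y ** jac c d p"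
  shows "X = Y"
proof -
  have "jac c d p ** jac d c p = mat 1" using jac_inverse[of d c p] assms by auto
  then show ?thesis
    using arg_cong[OF assms(4), of "\<lambda>Z. Z ** jac d c p"] by (simp add: matrix_mul_assoc[symmetric])
qed

lemma det_jac_nonzero:
  assumes "c \<in> A" "d \<in> A" "p \<in> fst c \<inter> fst d"
  shows "det (jac c d p) \<noteq> 0"
  using arg_cong[OF jac_inverse[OF assms], of det] by (auto simp: det_mul)

lemma matrix_inv_jac:
  assumes "c \<in> A" "d \<in> A" "p \<in> fst c \<inter> fst d"
  shows "matrix_inv (jac c d p) = jac d c p"
proof -
  have "jac c d p ** jac d c p = mat 1" using jac_inverse[of d c p] assms by auto
  then have "\<exists>X. jac c d p ** X = mat 1 \<and> X ** jac c d p = mat 1"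
    using jac_inverse[OF assms] by blast
  then have "jac c d p ** matrix_inv (jac c d p) = mat 1 \<and> matrix_inv (jac c d p) ** jac c d p = mat 1"
    unfolding matrix_inv_def by (rule someI_ex)
  then have "matrix_inv (jac c d p) ** jac c d p = jac d c p ** jac c d p"
    by (simp add: jac_inverse[OF assms])
  then show ?thesis by (rule jac_cancel[OF assms])
qed

lemma matrix_as_sum: "M = (\<Sum>j\<in>UNIV. outer (M *v axis j 1) (axis j 1))" for M :: "real^'n^'l"
proof (rule matrix_eqI)
  fix w
  have "M *v w = (\<Sum>j\<in>UNIV. w $ j *\<^sub>R column j M)"
    by (simp add: matrix_mult_sum scalar_mult_eq_scaleR)
  then show "M *v w = (\<Sum>j\<in>UNIV. outer (M *v axis j 1) (axis j 1)) *v w"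
    by (simp only: bounded_bilinear.sum_left[OF bounded_bilinear_matrix_vector_mult]
        outer_mult_vector matrix_vector_mult_basis inner_axis')
       (simp add: inner_commute)
qed

lemma smooth_in_matrixI:
  fixes M :: "'m \<Rightarrow> real^'n^'l"
  assumes "c \<in> A" "open U" "\<And>v. smooth_in c U (\<lambda>q. M q *v v)"
  shows "smooth_in c U M"
proof -
  have "smooth_in c U (\<lambda>q. \<Sum>j\<in>UNIV. outer (M q *v axis j 1) (axis j 1))"
    by (intro smooth_in_sum smooth_in_bilinear[OF bounded_bilinear_outer] smooth_in_const assms finite)
  then show ?thesis unfolding matrix_as_sum[symmetric] .
qed

lemma smooth_in_jac:
  assumes "c \<in> A" "d \<in> A"
  shows "smooth_in c (fst d) (jac c d)"
proof (rule smooth_in_matrixI[OF assms(1) chart_open[OF assms(2)]])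
  fix v
  show "smooth_in c (fst d) (\<lambda>q. jac c d q *v v)"
    by (subst smooth_in_cong[OF assms(1) chart_open[OF assms(2)] jac_apply[OF assms]])
       (auto intro!: smooth_in_deriv smooth_in_coords assms chart_open)
qed

lemma smooth_in_change:
  assumes "c \<in> A" "d \<in> A" "open U" "U \<subseteq> fst c" "smooth_in c U f"
  shows "smooth_in d U f"
proof -
  have "smooth_on (snd d ` (fst d \<inter> U)) (\<lambda>x. (f \<circ> chart_inv c) ((snd c \<circ> chart_inv d) x))"
  proof (rule smooth_on_compose)
    show "smooth_on (snd d ` (fst d \<inter> U)) (snd c \<circ> chart_inv d)"
      using assms(4) by (intro smooth_on_subset[OF smooth_in_coords[OF assms(2,1), unfolded smooth_in_def]]) auto
    show "smooth_on (snd c ` (fst c \<inter> U)) (f \<circ> chart_inv c)"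
      using assms(5) by (simp add: smooth_in_def)
    show "(snd c \<circ> chart_inv d) x \<in> snd c ` (fst c \<inter> U)" if "x \<in> snd d ` (fst d \<inter> U)" for x
      using that assms(2,4) by auto
  qed (intro open_coords assms)+
  then show ?thesis
    unfolding smooth_in_def
    by (subst smooth_on_cong[OF open_coords[OF assms(2,3)], where g="\<lambda>x. (f \<circ> chart_inv c) ((snd c \<circ> chart_inv d) x)"])
       (use assms in auto)
qed

text \<open>The field with constant components \<open>v\<close> in the chart \<open>c\<close>. Such
  fields are the test fields for the Nijenhuis tensor.\<close>

lemma coordinate_vector_field:
  assumes "c \<in> A"
  shows "vector_field A (fst c) (\<lambda>d q. jac c d q *v v)"
  unfolding vector_field_def
proof (intro conjI ballI)
  fix d assume d: "d \<in> A"
  have "smooth_in c (fst c \<inter> fst d) (\<lambda>q. jac c d q *v v)"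
    using smooth_in_bilinear[OF bounded_bilinear_matrix_vector_mult assms chart_open[OF d]
        smooth_in_jac[OF assms d] smooth_in_const[OF assms chart_open[OF d]]]
    by (rule smooth_in_subset) auto
  then have "smooth_in d (fst c \<inter> fst d) (\<lambda>q. jac c d q *v v)"
    by (intro smooth_in_change[OF assms d]) (auto intro!: open_Int chart_open assms d)
  then show "smooth_in d (fst c) (\<lambda>q. jac c d q *v v)"
    using smooth_in_Int_chart[of d "fst c"] by (metis Int_commute)
  fix e p assume "e \<in> A" "p \<in> fst d \<inter> fst e \<inter> fst c"
  then show "jac c e p *v v = jac d e p *v (jac c d p *v v)"
    using jac_cocycle[OF assms d] by (simp add: matrix_vector_mul_assoc)
qed

section \<open>Transformation laws of connections and endomorphism fields\<close>

lemma has_deriv_jac: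
  assumes "c \<in> A" "d \<in> A" "p \<in> fst c \<inter> fst d"
  shows "has_deriv_in c (jac c d) p (deriv_in c (jac c d) p)"
  using smooth_in_has_deriv[OF smooth_in_jac[OF assms(1,2)]] assms(3) by simp

lemma affine_connection_transform:
  assumes "affine_connection A U \<Gamma>" "c \<in> A" "d \<in> A" "p \<in> fst c \<inter> fst d \<inter> U"
  shows "\<Gamma> d p (jac c d p *v v) ** jac c d p = jac c d p ** \<Gamma> c p v - deriv_in c (jac c d) p v"
proof (rule matrix_eqI)
  fix w
  have "has_deriv_in c (\<lambda>q. jac c d q *v w) p (\<lambda>v. deriv_in c (jac c d) p v *v w)"
    using assms(4) has_deriv_jac[OF assms(2,3)]
    by (intro has_deriv_in_bounded_linear[of "\<lambda>M. M *v w"]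
        bounded_bilinear.bounded_linear_left[OF bounded_bilinear_matrix_vector_mult]) auto
  from has_deriv_inD[OF this]
  show "(\<Gamma> d p (jac c d p *v v) ** jac c d p) *v w =
      (jac c d p ** \<Gamma> c p v - deriv_in c (jac c d) p v) *v w"
    using assms unfolding affine_connection_def
    by (simp add: matrix_vector_mul_assoc[symmetric] matrix_vector_simps(3))
qed

text \<open>The weight factor at s = 0 is 1 only because the Jacobian determinant does not vanish:
  \<open>powr\<close> sends base 0 to 0 even for exponent 0.\<close>

lemma endo_fieldD:
  assumes "endo_field A U B" "c \<in> A" "d \<in> A" "p \<in> fst c \<inter> fst d \<inter> U"
  shows "B d p ** jac c d p = jac c d p ** B c p"
  using assms(1)[unfolded endo_density_def, THEN conjunct2, rule_format, OF assms(2-4)]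
    det_jac_nonzero[OF assms(2,3)] assms(4) by simp

lemma endo_fieldI:
  assumes "\<And>c. c \<in> A \<Longrightarrow> smooth_in c U (B c)"
    and "\<And>c d p. c \<in> A \<Longrightarrow> d \<in> A \<Longrightarrow> p \<in> fst c \<inter> fst d \<inter> U \<Longrightarrow> B d p ** jac c d p = jac c d p ** B c p"
  shows "endo_field A U B"
  unfolding endo_density_def
proof (intro conjI ballI)
  fix c d p assume "c \<in> A" "d \<in> A" "p \<in> fst c \<inter> fst d \<inter> U"
  then show "B d p ** jac c d p = \<bar>det (jac c d p)\<bar> powr - 0 *\<^sub>R (jac c d p ** B c p)"
    using assms(2)[of c d p] det_jac_nonzero[of c d p] by simp
qed (rule assms(1))

lemma endo_field_smooth: "endo_field A U B \<Longrightarrow> c \<in> A \<Longrightarrow> smooth_in c U (B c)"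
  by (simp add: endo_density_def)

lemma endo_field_subset: "endo_field A U B \<Longrightarrow> V \<subseteq> U \<Longrightarrow> endo_field A V B"
  unfolding endo_density_def by (blast intro: smooth_in_subset)

lemma trace_change:
  assumes "c \<in> A" "d \<in> A" "p \<in> fst c \<inter> fst d" "X ** jac c d p = jac c d p ** Y"
  shows "trace X = trace Y"
proof -
  have J: "jac c d p ** jac d c p = mat 1"
    using jac_inverse[of d c p] assms by auto
  have "trace X = trace (X ** jac c d p ** jac d c p)"
    by (simp add: matrix_mul_assoc[symmetric] J)
  also have "\<dots> = trace (jac d c p ** (jac c d p ** Y))"
    unfolding assms(4) by (rule trace_mul_sym)
  also have "\<dots> = trace Y"
    using jac_inverse[OF assms(1-3)] by (simp add: matrix_mul_assoc)
  finally show ?thesis .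
qed

lemma endo_field_mult:
  assumes "open U" "endo_field A U B" "endo_field A U C"
  shows "endo_field A U (\<lambda>c p. B c p ** C c p)"
proof (rule endo_fieldI)
  show "smooth_in c U (\<lambda>p. B c p ** C c p)" if "c \<in> A" for c
    by (rule smooth_in_bilinear[OF bounded_bilinear_matrix_mult that assms(1)
          endo_field_smooth[OF assms(2) that] endo_field_smooth[OF assms(3) that]])
  show "B d p ** C d p ** jac c d p = jac c d p ** (B c p ** C c p)"
    if "c \<in> A" "d \<in> A" "p \<in> fst c \<inter> fst d \<inter> U" for c d p
    using endo_fieldD[OF assms(2) that] endo_fieldD[OF assms(3) that]
    by (metis matrix_mul_assoc)
qed

text \<open>Differentiating the transformation law of B produces derivatives of the Jacobian; they
  cancel against the inhomogeneous term in the law of \<Gamma>.\<close>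

lemma cov_endo_transform:
  assumes "affine_connection A U \<Gamma>" "endo_field A V B" "open V" "V \<subseteq> U" "c \<in> A" "d \<in> A"
    "p \<in> fst c \<inter> fst d \<inter> V"
  shows "cov_endo \<Gamma> 0 B d p (jac c d p *v v) ** jac c d p = jac c d p ** cov_endo \<Gamma> 0 B c p v"
proof -
  let ?J = "jac c d p" and ?dJ = "deriv_in c (jac c d) p v"
  have dJ: "has_deriv_in c (jac c d) p (deriv_in c (jac c d) p)"
    using assms by (intro has_deriv_jac) auto
  have pc: "p \<in> fst c" using assms(7) by simp
  have "has_deriv_in d (B d) p (deriv_in d (B d) p)"
    using assms by (intro smooth_in_has_deriv[OF endo_field_smooth]) auto
  then have Bd: "has_deriv_in c (B d) p (\<lambda>v. deriv_in d (B d) p (jac c d p *v v))"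
    using assms by (intro has_deriv_in_change) auto
  have Bc: "has_deriv_in c (B c) p (deriv_in c (B c) p)"
    using assms by (intro smooth_in_has_deriv[OF endo_field_smooth]) auto
  have "has_deriv_in c (\<lambda>q. B d q ** jac c d q) p
      (\<lambda>v. B d p ** deriv_in c (jac c d) p v + deriv_in d (B d) p (?J *v v) ** ?J)"
    by (rule has_deriv_in_bilinear[OF bounded_bilinear_matrix_mult assms(5) pc Bd dJ])
  then have "has_deriv_in c (\<lambda>q. jac c d q ** B c q) p
      (\<lambda>v. B d p ** deriv_in c (jac c d) p v + deriv_in d (B d) p (?J *v v) ** ?J)"
    by (rule has_deriv_in_transform[where U="fst d \<inter> V", rotated -1])
       (use assms in \<open>auto intro!: open_Int chart_open endo_fieldD[OF assms(2)]\<close>)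
  \<comment> \<open>Both sides of the law of B are differentiated in the chart \<open>c\<close>, and
    the two Leibniz expansions are equated.\<close>
  from has_deriv_inD[OF this, of v]
    has_deriv_inD[OF has_deriv_in_bilinear[OF bounded_bilinear_matrix_mult assms(5) pc dJ Bc], of v]
  have leib: "deriv_in d (B d) p (?J *v v) ** ?J
      = ?J ** deriv_in c (B c) p v + ?dJ ** B c p - B d p ** ?dJ"
    by (simp add: algebra_simps)
  have BJ: "B d p ** ?J = ?J ** B c p"
    using assms by (intro endo_fieldD[OF assms(2)]) auto
  have GJ: "\<Gamma> d p (?J *v v) ** ?J = ?J ** \<Gamma> c p v - ?dJ"
    using assms by (intro affine_connection_transform[OF assms(1)]) auto
  have "cov_endo \<Gamma> 0 B d p (?J *v v) ** ?J = deriv_in d (B d) p (?J *v v) ** ?J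
      + ((\<Gamma> d p (?J *v v) ** ?J) ** B c p - B d p ** (\<Gamma> d p (?J *v v) ** ?J))"
    unfolding cov_endo_def using BJ by (simp add: matrix_ring_simps)
  also have "\<dots> = ?J ** deriv_in c (B c) p v + (?J ** \<Gamma> c p v ** B c p - (B d p ** ?J) ** \<Gamma> c p v)"
    unfolding leib GJ by (simp add: matrix_ring_simps algebra_simps)
  also have "\<dots> = ?J ** cov_endo \<Gamma> 0 B c p v"
    unfolding cov_endo_def BJ by (simp add: matrix_ring_simps)
  finally show ?thesis .
qed

lemma cov_endo_mult:
  assumes "endo_field A V B" "endo_field A V C" "c \<in> A" "p \<in> fst c \<inter> V"
  shows "cov_endo \<Gamma> 0 (\<lambda>c p. B c p ** C c p) c p v
     = cov_endo \<Gamma> 0 B c p v ** C c p + B c p ** cov_endo \<Gamma> 0 C c p v"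
proof -
  have "has_deriv_in c (\<lambda>q. B c q ** C c q) p
      (\<lambda>v. B c p ** deriv_in c (C c) p v + deriv_in c (B c) p v ** C c p)"
    using assms by (intro has_deriv_in_bilinear[OF bounded_bilinear_matrix_mult]
        smooth_in_has_deriv[OF endo_field_smooth]) auto
  from has_deriv_inD[OF this, of v] show ?thesis
    by (simp add: cov_endo_def matrix_ring_simps algebra_simps)
qed

text \<open>A constant multiple of the identity is parallel for every connection. Applied to the
  relations of an admissible frame, this supplies the last six hypotheses of
  \<open>derivation_coefs\<close>.\<close>

lemma cov_endo_anticommutator:
  assumes "endo_field A V B" "endo_field A V C" "c \<in> A" "open V" "p \<in> fst c \<inter> V"
    and const: "\<And>q. q \<in> fst c \<inter> V \<Longrightarrow> B c q ** C c q + C c q ** B c q = r *\<^sub>R mat 1"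
  shows "cov_endo \<Gamma> 0 B c p v ** C c p + B c p ** cov_endo \<Gamma> 0 C c p v
     + (cov_endo \<Gamma> 0 C c p v ** B c p + C c p ** cov_endo \<Gamma> 0 B c p v) = 0"
proof -
  let ?BC = "\<lambda>q. B c q ** C c q" and ?CB = "\<lambda>q. C c q ** B c q"
  have "has_deriv_in c ?BC p (deriv_in c ?BC p)" "has_deriv_in c ?CB p (deriv_in c ?CB p)"
    using endo_field_mult[OF assms(4,1,2)] endo_field_mult[OF assms(4,2,1)] assms(3,5)
    by (auto intro: smooth_in_has_deriv dest: endo_field_smooth)
  then have "has_deriv_in c (\<lambda>q. ?BC q + ?CB q) p (\<lambda>v. deriv_in c ?BC p v + deriv_in c ?CB p v)"
    unfolding has_deriv_in_def o_def by (rule has_derivative_add)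
  then have "has_deriv_in c (\<lambda>q. r *\<^sub>R mat 1) p (\<lambda>v. deriv_in c ?BC p v + deriv_in c ?CB p v)"
    by (rule has_deriv_in_transform[OF assms(3,4,5), rotated]) (rule const)
  from has_deriv_inD[OF this] has_deriv_inD[OF has_deriv_in_const]
  have D: "deriv_in c ?BC p v + deriv_in c ?CB p v = 0" by metis
  have "cov_endo \<Gamma> 0 (\<lambda>c p. B c p ** C c p) c p v + cov_endo \<Gamma> 0 (\<lambda>c p. C c p ** B c p) c p v
    = (deriv_in c ?BC p v + deriv_in c ?CB p v)
      + (\<Gamma> c p v ** (?BC p + ?CB p) - (?BC p + ?CB p) ** \<Gamma> c p v)"
    by (simp add: cov_endo_def matrix_ring_simps algebra_simps)
  also have "\<dots> = 0"
    unfolding D const[OF assms(5)] by (simp add: matrix_ring_simps)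
  finally show ?thesis
    unfolding cov_endo_mult[OF assms(1,2,3,5)] cov_endo_mult[OF assms(2,1,3,5)] .
qed

lemma cov_endo_linear:
  assumes "affine_connection A U \<Gamma>" "endo_field A V B" "c \<in> A" "p \<in> fst c \<inter> V" "V \<subseteq> U"
  shows "linear (cov_endo \<Gamma> 0 B c p)"
proof -
  have 1: "linear (deriv_in c (B c) p)"
    using assms by (intro has_deriv_in_linear[OF smooth_in_has_deriv[OF endo_field_smooth]]) auto
  have 2: "linear (\<Gamma> c p)" using assms by (auto simp: affine_connection_def)
  show ?thesis
    using 1 2 by (auto simp: linear_iff cov_endo_def matrix_ring_simps algebra_simps)
qed

lemma cov_endo_smooth:
  assumes "affine_connection A U \<Gamma>" "endo_field A V B" "open V" "V \<subseteq> U" "c \<in> A"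
  shows "smooth_in c V (\<lambda>p. cov_endo \<Gamma> 0 B c p v)"
proof -
  have G: "smooth_in c V (\<lambda>p. \<Gamma> c p v)"
    by (rule smooth_in_subset[of c U]) (use assms in \<open>auto simp: affine_connection_def\<close>)
  have B: "smooth_in c V (B c)"
    by (rule endo_field_smooth[OF assms(2,5)])
  have "smooth_in c V (\<lambda>p. deriv_in c (B c) p v + (\<Gamma> c p v ** B c p - B c p ** \<Gamma> c p v))"
    by (intro smooth_in_intros smooth_in_deriv assms(3,5) G B)
  then show ?thesis by (simp add: cov_endo_def)
qed

end

section \<open>Frames and difference tensors\<close>

text \<open>The tensor S as a function of the fibre of Q and \<theta>. The triple is an arbitrary
  choice made separately at each point and in each chart; neither smoothness nor compatibility of
  the choices is required of it.\<close>

definition Q_tensor :: "(real^'k^'k) set \<Rightarrow> real^'k \<Rightarrow> real^'k \<Rightarrow> real^'k^'k" where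
  "Q_tensor S \<theta> v = (case SOME (J1, J2, J3). quaternion_triple J1 J2 J3 \<and> S = span {J1, J2, J3}
     of (J1, J2, J3) \<Rightarrow> quaternion_frame.quat_tensor J1 J2 J3 \<theta> v)"

text \<open>The tensors built from two triples of the same fibre are both symmetric, preserve the
  fibre and have the same trace, so their difference is a difference tensor of trace zero.\<close>

lemma (in quaternion_frame) Q_tensor_eq:
  assumes S: "S = span {J1, J2, J3}"
  shows "Q_tensor S \<theta> v = quat_tensor \<theta> v"
proof -
  obtain K1 K2 K3 where K: "(SOME (J1, J2, J3). quaternion_triple J1 J2 J3 \<and> S = span {J1, J2, J3}) = (K1, K2, K3)"
    by (rule prod_cases3)
  have KS: "case (K1, K2, K3) of (J1, J2, J3) \<Rightarrow> quaternion_triple J1 J2 J3 \<and> S = span {J1, J2, J3}"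
    unfolding K[symmetric] by (rule someI[where x="(J1, J2, J3)"]) (use S triple in simp)
  interpret K: quaternion_frame K1 K2 K3 + K': quaternion_frame J1 J2 J3
    using KS by unfold_locales (simp_all add: triple)
  have SK: "S = span {K1, K2, K3}"
    using KS by simp
  have "K.quat_tensor \<theta> v - quat_tensor \<theta> v = 0" for v
  proof (rule difference_tensor_trace_zero)
    show "linear (\<lambda>v. K.quat_tensor \<theta> v - quat_tensor \<theta> v)"
      by (intro linear_compose_sub K.linear_quat_tensor linear_quat_tensor)
    show "(K.quat_tensor \<theta> v - quat_tensor \<theta> v) *v w = (K.quat_tensor \<theta> w - quat_tensor \<theta> w) *v v" for v w
      using K.quat_tensor_sym[of \<theta> v w] quat_tensor_sym[of \<theta> v w] by (simp add: matrix_vector_simps(3))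
    show "trace (K.quat_tensor \<theta> v - quat_tensor \<theta> v) = 0" for v
      by (simp add: trace_simps K.trace_quat_tensor trace_quat_tensor)
    fix v B assume B: "B \<in> span {J1, J2, J3}"
    have "K.quat_tensor \<theta> v ** B - B ** K.quat_tensor \<theta> v \<in> span {J1, J2, J3}"
      using K.quat_tensor_preserves[of B \<theta> v] B unfolding SK[symmetric] S by blast
    then have "(K.quat_tensor \<theta> v ** B - B ** K.quat_tensor \<theta> v)
        - (quat_tensor \<theta> v ** B - B ** quat_tensor \<theta> v) \<in> span {J1, J2, J3}"
      using quat_tensor_preserves[OF B] by (rule span_diff)
    then show "(K.quat_tensor \<theta> v - quat_tensor \<theta> v) ** B - B ** (K.quat_tensor \<theta> v - quat_tensor \<theta> v)
        \<in> span {J1, J2, J3}"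
      by (simp add: matrix_ring_simps algebra_simps)
  qed
  then show ?thesis by (simp add: Q_tensor_def K)
qed

lemma (in quaternion_frame) quat_tensor_transform:
  assumes "quaternion_frame K1 K2 K3"
    and K: "K1 ** J = J ** J1" "K2 ** J = J ** J2" "K3 ** J = J ** J3"
    and \<theta>: "\<And>v. \<theta>' \<bullet> (J *v v) = \<theta> \<bullet> v"
  shows "quaternion_frame.quat_tensor K1 K2 K3 \<theta>' (J *v v) ** J = J ** quat_tensor \<theta> v"
proof (rule matrix_eqI)
  fix w
  interpret K: quaternion_frame K1 K2 K3 by fact
  have Kv: "K1 *v (J *v x) = J *v (J1 *v x)" "K2 *v (J *v x) = J *v (J2 *v x)"
    "K3 *v (J *v x) = J *v (J3 *v x)" for x
    by (simp_all add: matrix_vector_mul_assoc K)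
  show "(K.quat_tensor \<theta>' (J *v v) ** J) *v w = (J ** quat_tensor \<theta> v) *v w"
    unfolding matrix_vector_mul_assoc[symmetric] K.quat_tensor_apply quat_tensor_apply Kv \<theta>
    by (simp add: matrix_vector_simps(2,4,8))
qed

context manifold
begin

section \<open>Operations on endomorphism fields and the Nijenhuis tensor\<close>

lemma endo_field_add:
  assumes "open U" "endo_field A U B" "endo_field A U C"
  shows "endo_field A U (\<lambda>c p. B c p + C c p)"
proof (rule endo_fieldI)
  show "smooth_in c U (\<lambda>p. B c p + C c p)" if "c \<in> A" for c
    by (rule smooth_in_add[OF that assms(1)
          endo_field_smooth[OF assms(2) that] endo_field_smooth[OF assms(3) that]])
qed (simp add: matrix_ring_simps endo_fieldD[OF assms(2)] endo_fieldD[OF assms(3)])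

lemma endo_field_scale:
  assumes "open U" "endo_field A U B" "\<And>c. c \<in> A \<Longrightarrow> smooth_in c U (f c)"
    and "\<And>c d p. c \<in> A \<Longrightarrow> d \<in> A \<Longrightarrow> p \<in> fst c \<inter> fst d \<inter> U \<Longrightarrow> f d p = f c p"
  shows "endo_field A U (\<lambda>c p. f c p *\<^sub>R B c p)"
proof (rule endo_fieldI)
  show "smooth_in c U (\<lambda>p. f c p *\<^sub>R B c p)" if "c \<in> A" for c
    by (rule smooth_in_bilinear[OF bounded_bilinear_scaleR that assms(1)
          assms(3)[OF that] endo_field_smooth[OF assms(2) that]])
  show "(f d p *\<^sub>R B d p) ** jac c d p = jac c d p ** (f c p *\<^sub>R B c p)"
    if "c \<in> A" "d \<in> A" "p \<in> fst c \<inter> fst d \<inter> U" for c d p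
    using assms(4)[OF that] endo_fieldD[OF assms(2) that] by (simp add: matrix_ring_simps)
qed

lemma open_positive:
  fixes f :: "'m \<Rightarrow> real"
  assumes "c \<in> A" "open U" "smooth_in c U f"
  shows "open {q \<in> fst c \<inter> U. f q > 0}"
proof -
  let ?S = "snd c ` (fst c \<inter> U)"
  have "continuous_on ?S (f \<circ> chart_inv c)"
    using assms(3) unfolding smooth_in_def by (rule smooth_on_continuous)
  then have "open ((f \<circ> chart_inv c) -` {0<..} \<inter> ?S)"
    by (rule continuous_on_open_vimage[OF open_coords[OF assms(1,2)], THEN iffD1, rule_format]) simp
  from open_Int[OF open_chart_vimage[OF assms(1) this] assms(2)]
  have "open ({q \<in> fst c. snd c q \<in> (f \<circ> chart_inv c) -` {0<..} \<inter> ?S} \<inter> U)" .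
  moreover have "{q \<in> fst c \<inter> U. f q > 0}
      = {q \<in> fst c. snd c q \<in> (f \<circ> chart_inv c) -` {0<..} \<inter> ?S} \<inter> U"
    by (auto simp: assms(1)) (metis assms(1) chart_inv_chart)
  ultimately show ?thesis by simp
qed

text \<open>The Nijenhuis tensor of \<open>I\<close>, rewritten with a torsion-free connection in place of Lie brackets.\<close>

lemma nijenhuis_cov:
  assumes "complex_structure A I" "torsion_free A UNIV \<Gamma>" "c \<in> A" "p \<in> fst c"
  shows "cov_endo \<Gamma> 0 I c p (I c p *v x) *v y - I c p *v (cov_endo \<Gamma> 0 I c p x *v y)
    = cov_endo \<Gamma> 0 I c p (I c p *v y) *v x - I c p *v (cov_endo \<Gamma> 0 I c p y *v x)"
proof -
  \<comment> \<open>Fields constant in the chart \<open>c\<close>: their own derivatives vanish at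
    p, and the brackets retain only derivatives of \<open>I\<close>.\<close>
  define X where "X v = (\<lambda>d q. jac c d q *v v)" for v
  have X: "vector_field A (fst c) (X v)" for v
    unfolding X_def by (rule coordinate_vector_field[OF assms(3)])
  have Ie: "endo_field A UNIV I" and I2: "I c p ** I c p = - mat 1"
    using assms(1,3,4) by (auto simp: complex_structure_def)
  have dI: "has_deriv_in c (I c) p (deriv_in c (I c) p)"
    by (rule smooth_in_has_deriv[OF endo_field_smooth[OF Ie assms(3)]]) (simp add: assms(4))
  have Xc: "X v c q = v" if "q \<in> fst c" for v q
    using that jac_self[OF assms(3)] by (simp add: X_def)
  have dX: "deriv_in c (X v c) p u = 0" for u v
  proof -
    have "deriv_in c (X v c) p u = deriv_in c (\<lambda>_. v) p u"
      by (rule deriv_in_cong[OF assms(3) chart_open[OF assms(3)]]) (use Xc assms(4) in auto)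
    also have "\<dots> = 0" by (rule has_deriv_inD[OF has_deriv_in_const])
    finally show ?thesis .
  qed
  have dIX: "deriv_in c (app_endo I (X v) c) p u = deriv_in c (I c) p u *v v" for u v
  proof -
    have "has_deriv_in c (\<lambda>q. I c q *v v) p (\<lambda>u. deriv_in c (I c) p u *v v)"
      by (intro has_deriv_in_bounded_linear[OF _ dI]
          bounded_bilinear.bounded_linear_left[OF bounded_bilinear_matrix_vector_mult])
    from has_deriv_inD[OF this]
    have "deriv_in c (\<lambda>q. I c q *v v) p u = deriv_in c (I c) p u *v v" .
    moreover have "deriv_in c (app_endo I (X v) c) p u = deriv_in c (\<lambda>q. I c q *v v) p u"
      by (rule deriv_in_cong[OF assms(3) chart_open[OF assms(3)]]) (use Xc assms(4) in \<open>auto simp: app_endo_def\<close>)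
    ultimately show ?thesis by simp
  qed
  have "Lie_bracket (app_endo I (X x)) (app_endo I (X y)) c p
           - I c p *v Lie_bracket (app_endo I (X x)) (X y) c p
           - I c p *v Lie_bracket (X x) (app_endo I (X y)) c p
           - Lie_bracket (X x) (X y) c p = 0"
    using assms(1) X[of x] X[of y] chart_open[OF assms(3)] assms(3,4)
    unfolding complex_structure_def by blast
  then have N: "deriv_in c (I c) p (I c p *v x) *v y - deriv_in c (I c) p (I c p *v y) *v x
      + I c p *v (deriv_in c (I c) p y *v x) - I c p *v (deriv_in c (I c) p x *v y) = 0"
    using assms(4) by (simp add: Lie_bracket_def dIX dX Xc) (simp add: app_endo_def Xc matrix_vector_simps(6))
  have sym: "\<Gamma> c p v *v w = \<Gamma> c p w *v v" for v w
    using assms(2-4) by (auto simp: torsion_free_def)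
  have cov: "cov_endo \<Gamma> 0 I c p v *v w
      = deriv_in c (I c) p v *v w + \<Gamma> c p v *v (I c p *v w) - I c p *v (\<Gamma> c p v *v w)" for v w
    by (simp add: cov_endo_def matrix_vector_simps)
  have II: "I c p *v (I c p *v w) = - w" for w
    unfolding matrix_vector_mul_assoc I2 by (simp add: matrix_vector_simps)
  show ?thesis
    unfolding cov matrix_vector_simps(2,4) II
    using N sym[of "I c p *v x" "I c p *v y"] sym[of "I c p *v x" y] sym[of x "I c p *v y"] sym[of x y]
    by (simp add: algebra_simps)
qed

end

text \<open>Explicit representing vector: smoothness in a parameter follows from that of finitely
  many values of \<open>f\<close>, which an existence statement would not provide.\<close>

definition covector :: "('a::euclidean_space \<Rightarrow> real) \<Rightarrow> 'a" where
  "covector f = (\<Sum>b\<in>Basis. f b *\<^sub>R b)"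

lemma covector_inner:
  assumes "linear f"
  shows "covector f \<bullet> v = f v"
proof -
  have "f v = f (\<Sum>b\<in>Basis. (v \<bullet> b) *\<^sub>R b)" by (simp add: euclidean_representation)
  also have "\<dots> = (\<Sum>b\<in>Basis. (v \<bullet> b) * f b)"
    by (simp add: linear_sum[OF assms] linear_cmul[OF assms])
  finally show ?thesis by (simp add: covector_def inner_sum_left mult.commute[of "f _"] inner_commute[of v])
qed

locale quaternionic = manifold A
  for A :: "('m::{t2_space, second_countable_topology}, 'k::finite) atlas" +
  fixes Q :: "('m, 'k) endo_bundle" and n :: nat
  assumes quaternionic: "quaternionic_manifold n A Q"
begin

section \<open>Fibres of the quaternionic bundle and local frames\<close>

lemma almost_quaternionic: "almost_quaternionic A Q"
  using quaternionic by (simp add: quaternionic_manifold_def)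

lemma dimension: "CARD('k) = 4 * n" "n \<ge> 1"
  using quaternionic by (simp_all add: quaternionic_manifold_def)

lemma triple_at:
  assumes "c \<in> A" "p \<in> fst c"
  obtains J1 J2 J3 where "quaternion_frame J1 J2 J3" "Q c p = span {J1, J2, J3}"
proof -
  have "\<exists>J1 J2 J3. quaternion_triple J1 J2 J3 \<and> Q c p = span {J1, J2, J3}"
    using almost_quaternionic assms unfolding almost_quaternionic_def by blast
  then show ?thesis using that quaternion_frame.intro by blast
qed

lemma subspace_Q: "c \<in> A \<Longrightarrow> p \<in> fst c \<Longrightarrow> subspace (Q c p)"
  by (metis triple_at subspace_span)

lemma Q_transform:
  assumes "c \<in> A" "d \<in> A" "p \<in> fst c \<inter> fst d" "X ** jac c d p = jac c d p ** Y" "Y \<in> Q c p"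
  shows "X \<in> Q d p"
proof -
  have "X = jac c d p ** Y ** matrix_inv (jac c d p)"
    unfolding matrix_inv_jac[OF assms(1-3)] assms(4)[symmetric]
    using jac_inverse[of d c p] assms(1-3) by (simp add: matrix_mul_assoc[symmetric])
  then show ?thesis
    using almost_quaternionic assms(1-3,5) unfolding almost_quaternionic_def by blast
qed

text \<open>A triple at p in the chart \<open>c\<close>, conjugated by the Jacobian, is a triple for
  the fibre in the chart \<open>d\<close>. \<open>Q_tensor_eq\<close> allows it to replace the
  unrelated choice made there.\<close>

lemma Q_tensor_transform:
  assumes "c \<in> A" "d \<in> A" "p \<in> fst c \<inter> fst d" "\<And>v. \<theta>' \<bullet> (jac c d p *v v) = \<theta> \<bullet> v"
  shows "Q_tensor (Q d p) \<theta>' (jac c d p *v v) ** jac c d p = jac c d p ** Q_tensor (Q c p) \<theta> v"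
proof -
  let ?J = "jac c d p" and ?J' = "jac d c p"
  have JJ: "?J' ** ?J = mat 1" "?J ** ?J' = mat 1"
    using jac_inverse[of c d p] jac_inverse[of d c p] assms by auto
  then have JJl: "?J' ** (?J ** X) = X" for X by (simp add: matrix_mul_assoc)
  obtain J1 J2 J3 where J: "quaternion_frame J1 J2 J3" and QJ: "Q c p = span {J1, J2, J3}"
    using triple_at assms(1,3) by blast
  obtain L1 L2 L3 where L: "quaternion_frame L1 L2 L3" and QL: "Q d p = span {L1, L2, L3}"
    using triple_at assms(2,3) by blast
  interpret J: quaternion_frame J1 J2 J3 by fact
  interpret L: quaternion_frame L1 L2 L3 by fact
  let ?K = "\<lambda>B. ?J ** B ** ?J'"
  have K: "?K B ** ?J = ?J ** B" for B
    by (simp add: matrix_mul_assoc[symmetric] JJ)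
  have KK: "?K X ** ?K Y = ?K (X ** Y)" for X Y
    by (simp add: matrix_mul_assoc[symmetric] JJl)
  have t: "quaternion_triple (?K J1) (?K J2) (?K J3)"
    unfolding quaternion_triple_def KK J.J_mult by (simp add: matrix_ring_simps JJ)
  interpret K: quaternion_frame "?K J1" "?K J2" "?K J3" by unfold_locales (rule t)
  have "?K B \<in> Q d p" if "B \<in> {J1, J2, J3}" for B
    using that by (intro Q_transform[OF assms(1-3) K]) (auto simp: QJ intro: span_base)
  then have "span {?K J1, ?K J2, ?K J3} = Q d p"
    unfolding QL by (intro L.span_triple_eqI[OF t]) auto
  then have "Q_tensor (Q d p) \<theta>' (?J *v v) = K.quat_tensor \<theta>' (?J *v v)"
    by (intro K.Q_tensor_eq) simp
  then show ?thesis
    unfolding J.Q_tensor_eq[OF QJ]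
    using J.quat_tensor_transform[OF K.quaternion_frame_axioms K K K assms(4)] by simp
qed

lemma Q_section_frame:
  assumes "admissible_frame A Q V I1 I2 I3"
  shows "Q_section A Q V 0 I1" "Q_section A Q V 0 I2" "Q_section A Q V 0 I3"
  using assms by (auto simp: admissible_frame_def Q_section_def intro: span_base)

lemma admissible_frame_at:
  assumes "admissible_frame A Q V I1 I2 I3" "c \<in> A" "p \<in> fst c \<inter> V"
  shows "quaternion_frame (I1 c p) (I2 c p) (I3 c p)" "Q c p = span {I1 c p, I2 c p, I3 c p}"
  using assms by (auto simp: admissible_frame_def quaternion_frame_def)

text \<open>Gram-Schmidt in the fibre metric starting from I, which has norm 1. By dimension, one of
  the local generators of Q is independent of I at p; its part orthogonal to I is normalised, and
  the third section is the product.\<close>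

lemma local_admissible_frame:
  assumes I: "Q_section A Q UNIV 0 I" and sq: "\<And>c p. c \<in> A \<Longrightarrow> p \<in> fst c \<Longrightarrow> I c p ** I c p = - mat 1"
  obtains W I2 I3 where "open W" "p \<in> W" "admissible_frame A Q W I I2 I3"
proof -
  let ?k = "real CARD('k)"
  have Ie: "endo_field A UNIV I" and IQ: "\<And>c p. c \<in> A \<Longrightarrow> p \<in> fst c \<Longrightarrow> I c p \<in> Q c p"
    using I by (auto simp: Q_section_def)
  obtain c0 where c0: "c0 \<in> A" "p \<in> fst c0" using chart_exists by blast
  obtain V B1 B2 B3 where V: "open V" "p \<in> V"
    and Be: "endo_field A V B1" "endo_field A V B2" "endo_field A V B3"
    and QB: "\<And>c q. c \<in> A \<Longrightarrow> q \<in> fst c \<inter> V \<Longrightarrow> Q c q = span {B1 c q, B2 c q, B3 c q} \<and> dim (Q c q) = 3"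
    using almost_quaternionic unfolding almost_quaternionic_def by metis
  have "\<not> {B1 c0 p, B2 c0 p, B3 c0 p} \<subseteq> span {I c0 p}"
  proof
    assume "{B1 c0 p, B2 c0 p, B3 c0 p} \<subseteq> span {I c0 p}"
    then have "Q c0 p \<subseteq> span {I c0 p}"
      using QB[of c0 p] c0 V by (metis IntI span_minimal subspace_span)
    then have "dim (Q c0 p) \<le> dim {I c0 p}"
      using dim_subset dim_span by metis
    also have "\<dots> \<le> card {I c0 p}" by (rule dim_le_card') simp
    finally have "dim (Q c0 p) \<le> 1" by simp
    moreover have "dim (Q c0 p) = 3" using QB c0 V by blast
    ultimately show False by linarith
  qed
  then obtain B where "endo_field A V B" and BQ: "\<And>c q. c \<in> A \<Longrightarrow> q \<in> fst c \<inter> V \<Longrightarrow> B c q \<in> Q c q"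
    and B0: "B c0 p \<notin> span {I c0 p}"
  proof -
    assume *: "\<And>B. endo_field A V B \<Longrightarrow> (\<And>c q. c \<in> A \<Longrightarrow> q \<in> fst c \<inter> V \<Longrightarrow> B c q \<in> Q c q)
      \<Longrightarrow> B c0 p \<notin> span {I c0 p} \<Longrightarrow> thesis"
    show thesis
      using \<open>\<not> _ \<subseteq> span {I c0 p}\<close> *[OF Be(1)] *[OF Be(2)] *[OF Be(3)] QB
      by (simp add: span_base) blast
  qed
  note Be = this(1)
  have IV: "endo_field A V I" by (rule endo_field_subset[OF Ie]) simp
  \<comment> \<open>Minus the inner product of \<open>B\<close> and \<open>I\<close> in the fibre
    metric, so that adding \<open>t\<close> times \<open>I\<close> removes the component of
    \<open>B\<close> along \<open>I\<close>.\<close>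
  define t where "t c q = (1 / ?k) * trace (B c q ** I c q)" for c q
  define B' where "B' c q = B c q + t c q *\<^sub>R I c q" for c q
  have endo_trace: "smooth_in c V (\<lambda>q. trace (C c q))" if "endo_field A V C" "c \<in> A" for C c
    by (rule smooth_in_bounded_linear[OF that(2) V(1) bounded_linear_trace endo_field_smooth[OF that]])
  have trace_inv: "trace (C d q) = trace (C c q)"
    if "endo_field A V C" "c \<in> A" "d \<in> A" "q \<in> fst c \<inter> fst d \<inter> V" for C c d q
    using that(4) by (intro trace_change[OF that(2,3) _ endo_fieldD[OF that]]) auto
  have BI: "endo_field A V (\<lambda>c q. B c q ** I c q)" by (rule endo_field_mult[OF V(1) Be IV])
  have "endo_field A V (\<lambda>c q. t c q *\<^sub>R I c q)"
  proof (rule endo_field_scale[OF V(1) IV])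
    show "smooth_in c V (t c)" if "c \<in> A" for c
      unfolding t_def
      by (rule smooth_in_bilinear[OF bounded_bilinear_mult that V(1) smooth_in_const[OF that V(1)]
            endo_trace[OF BI that]])
    show "t d q = t c q" if "c \<in> A" "d \<in> A" "q \<in> fst c \<inter> fst d \<inter> V" for c d q
      unfolding t_def trace_inv[OF BI that] ..
  qed
  then have B'e: "endo_field A V B'"
    unfolding B'_def by (rule endo_field_add[OF V(1) Be])
  have BB: "endo_field A V (\<lambda>c q. B' c q ** B' c q)" by (rule endo_field_mult[OF V(1) B'e B'e])
  define N where "N c q = (- 1 / ?k) * trace (B' c q ** B' c q)" for c q
  have N: "smooth_in c V (N c)" if "c \<in> A" for c
    unfolding N_def
    by (rule smooth_in_bilinear[OF bounded_bilinear_mult that V(1) smooth_in_const[OF that V(1)]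
          endo_trace[OF BB that]])
  have Ninv: "N d q = N c q" if "c \<in> A" "d \<in> A" "q \<in> fst c \<inter> fst d \<inter> V" for c d q
    using trace_inv[OF BB that] by (simp add: N_def)
  \<comment> \<open>The squared norm \<open>N\<close> does not depend on the chart, so positivity is
    imposed in one chart around p and then holds in all of them.\<close>
  define W where "W = {q \<in> fst c0 \<inter> V. N c0 q > 0}"
  have W: "open W" "W \<subseteq> V"
    unfolding W_def using open_positive[OF c0(1) V(1) N[OF c0(1)]] by auto
  have Npos: "N c q > 0" if "c \<in> A" "q \<in> fst c \<inter> W" for c q
    using that Ninv[of c0 c q] c0 by (auto simp: W_def)
  have B'Q: "B' c q \<in> Q c q" if "c \<in> A" "q \<in> fst c \<inter> V" for c q
  proof -
    have "subspace (Q c q)" "I c q \<in> Q c q" using that subspace_Q IQ by auto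
    then show ?thesis unfolding B'_def by (intro subspace_add subspace_scale BQ[OF that])
  qed
  have "p \<in> W"
  proof -
    obtain J1 J2 J3 where J: "quaternion_frame J1 J2 J3" and QJ: "Q c0 p = span {J1, J2, J3}"
      using triple_at c0 by blast
    have "B' c0 p \<noteq> 0"
    proof
      assume "B' c0 p = 0"
      then have "B c0 p = - (t c0 p *\<^sub>R I c0 p)" unfolding B'_def by (simp only: eq_neg_iff_add_eq_0)
      then show False using B0 by (simp add: span_neg span_scale span_base)
    qed
    then have "trace (B' c0 p ** B' c0 p) < 0"
      using quaternion_frame.span_square_neg[OF J] B'Q[OF c0(1)] c0 V QJ by auto
    then show ?thesis using c0 V by (simp add: W_def N_def divide_neg_pos)
  qed
  define I2 where "I2 c q = (N c q powr (- 1 / 2)) *\<^sub>R B' c q" for c q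
  have I2e: "endo_field A W I2"
    unfolding I2_def
  proof (rule endo_field_scale[OF W(1) endo_field_subset[OF B'e W(2)]])
    show "smooth_in c W (\<lambda>q. N c q powr (- 1 / 2))" if "c \<in> A" for c
      by (rule smooth_in_powr[OF that W(1) smooth_in_subset[OF N[OF that] W(2)] Npos[OF that]])
    show "N d q powr (- 1 / 2) = N c q powr (- 1 / 2)"
      if "c \<in> A" "d \<in> A" "q \<in> fst c \<inter> fst d \<inter> W" for c d q
      using Ninv[OF that(1,2), of q] that(3) W(2) by auto
  qed
  have IW: "endo_field A W I" by (rule endo_field_subset[OF Ie]) simp
  have "quaternion_triple (I c q) (I2 c q) (I c q ** I2 c q)
      \<and> Q c q = span {I c q, I2 c q, I c q ** I2 c q}" if cq: "c \<in> A" "q \<in> fst c \<inter> W" for c q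
  proof -
    have q: "q \<in> fst c \<inter> V" using cq W(2) by auto
    obtain J1 J2 J3 where J: "quaternion_frame J1 J2 J3" and QJ: "Q c q = span {J1, J2, J3}"
      using triple_at cq by blast
    interpret J: quaternion_frame J1 J2 J3 by (rule J)
    let ?s = "N c q powr (- 1 / 2)"
    have "trace (I c q ** I2 c q) = 0"
      unfolding I2_def B'_def t_def using sq[of c q] cq trace_mul_sym[of "I c q" "B c q"]
      by (simp add: matrix_ring_simps trace_simps trace_I)
    moreover have "trace (I2 c q ** I2 c q) = - ?k"
    proof -
      have "?s * ?s = inverse (N c q)"
        using powr_add[of "N c q" "- 1 / 2" "- 1 / 2"] powr_neg_one[OF Npos[OF cq]]
        by (simp only: inverse_eq_divide) (simp del: powr_neg_one)
      moreover have "trace (B' c q ** B' c q) = - ?k * N c q" by (simp add: N_def)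
      ultimately show ?thesis
        unfolding I2_def using Npos[OF cq]
        by (simp add: matrix_ring_simps trace_simps mult.assoc[symmetric])
    qed
    moreover have "I2 c q \<in> span {J1, J2, J3}" "I c q \<in> span {J1, J2, J3}"
      using B'Q[OF cq(1) q] IQ[of c q] cq unfolding I2_def QJ by (auto intro: span_scale)
    ultimately show ?thesis
      using J.orthonormal_triple[of "I c q" "I2 c q"] sq[of c q] cq QJ by auto
  qed
  then have "admissible_frame A Q W I I2 (\<lambda>c q. I c q ** I2 c q)"
    unfolding admissible_frame_def using IW I2e endo_field_mult[OF W(1) IW I2e] by blast
  then show ?thesis using that W(1) \<open>p \<in> W\<close> by blast
qed

lemma one_form_covector:
  assumes lin: "\<And>c p. c \<in> A \<Longrightarrow> p \<in> fst c \<inter> U \<Longrightarrow> linear (f c p)"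
    and "open U" "\<And>c v. c \<in> A \<Longrightarrow> smooth_in c U (\<lambda>p. f c p v)"
    and "\<And>c d p v. c \<in> A \<Longrightarrow> d \<in> A \<Longrightarrow> p \<in> fst c \<inter> fst d \<inter> U \<Longrightarrow> f d p (jac c d p *v v) = f c p v"
  shows "one_form A U (\<lambda>c p. covector (f c p))"
  unfolding one_form_def
proof (intro conjI ballI allI)
  show "smooth_in c U (\<lambda>p. covector (f c p))" if "c \<in> A" for c
    unfolding covector_def
    by (intro smooth_in_sum smooth_in_bilinear[OF bounded_bilinear_scaleR] smooth_in_const assms that)
       simp
qed (use assms in \<open>simp add: covector_inner\<close>)

text \<open>\<open>eta_form\<close> constrains \<eta> only through one-forms satisfying
  \<open>frame_forms\<close>; their existence is what makes that condition usable.\<close>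

lemma frame_forms_exist:
  assumes \<Gamma>: "quaternionic_connection A Q UNIV \<Gamma>"
    and V: "open V" "admissible_frame A Q V I1 I2 I3"
  obtains \<omega>1 \<omega>2 \<omega>3 where "frame_forms A V \<Gamma> I1 I2 I3 \<omega>1 \<omega>2 \<omega>3"
proof -
  have aff: "affine_connection A UNIV \<Gamma>"
    using \<Gamma> by (simp add: quaternionic_connection_def)
  have Ie: "endo_field A V I1" "endo_field A V I2" "endo_field A V I3"
    using V by (auto simp: admissible_frame_def)
  have covQ: "cov_endo \<Gamma> 0 B c p v \<in> Q c p" if "Q_section A Q V 0 B" "c \<in> A" "p \<in> fst c \<inter> V" for B c p v
    using \<Gamma> V(1) that unfolding quaternionic_connection_def by blast
  \<comment> \<open>The C-coordinate of the derivative of B. The choices (I2, I3), (I3, I1), (I1,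
    I2) for (B, C) give the three frame forms.\<close>
  define f where "f B C c p v = coef (C c p) (cov_endo \<Gamma> 0 B c p v)" for B C :: "('m, 'k) matrix_comp" and c p v
  have lin: "linear (f B C c p)" if "endo_field A V B" "c \<in> A" "p \<in> fst c \<inter> V" for B C c p
    unfolding f_def
    using linear_compose[OF cov_endo_linear[OF aff that subset_UNIV] linear_coef] by (simp add: o_def)
  have form: "one_form A V (\<lambda>c p. covector (f B C c p))" if B: "endo_field A V B" and C: "endo_field A V C" for B C
  proof (rule one_form_covector[OF lin[OF B] V(1)])
    fix c v assume c: "c \<in> A"
    have "smooth_in c V (\<lambda>p. (- 1 / real CARD('k)) * trace (cov_endo \<Gamma> 0 B c p v ** C c p))"
      by (intro smooth_in_bilinear[OF bounded_bilinear_mult] smooth_in_const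
          smooth_in_bounded_linear[OF _ _ bounded_linear_trace]
          smooth_in_bilinear[OF bounded_bilinear_matrix_mult] c V(1) endo_field_smooth[OF C]
          cov_endo_smooth[OF aff B V(1) subset_UNIV])
    then show "smooth_in c V (\<lambda>p. f B C c p v)" by (simp add: f_def coef_def)
  next
    fix c d p v assume cd: "c \<in> A" "d \<in> A" "p \<in> fst c \<inter> fst d \<inter> V"
    have "cov_endo \<Gamma> 0 B d p (jac c d p *v v) ** C d p ** jac c d p
        = jac c d p ** (cov_endo \<Gamma> 0 B c p v ** C c p)"
      using cov_endo_transform[OF aff B V(1) subset_UNIV cd, of v] endo_fieldD[OF C cd]
      by (metis matrix_mul_assoc)
    then show "f B C d p (jac c d p *v v) = f B C c p v"
      unfolding f_def coef_def using cd by (subst trace_change[of c d p]) auto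
  qed auto
  have "frame_forms A V \<Gamma> I1 I2 I3 (\<lambda>c p. covector (f I2 I3 c p)) (\<lambda>c p. covector (f I3 I1 c p))
      (\<lambda>c p. covector (f I1 I2 c p))"
    unfolding frame_forms_def
  proof (intro conjI form Ie, intro ballI allI)
    fix c p v assume c: "c \<in> A" and p: "p \<in> fst c \<inter> V"
    note fr = admissible_frame_at[OF V(2)]
    note QS = Q_section_frame[OF V(2)]
    interpret J: quaternion_frame "I1 c p" "I2 c p" "I3 c p" by (rule fr(1)[OF c p])
    have ac: "I1 c q ** I1 c q + I1 c q ** I1 c q = (-2) *\<^sub>R mat 1"
      "I2 c q ** I2 c q + I2 c q ** I2 c q = (-2) *\<^sub>R mat 1"
      "I3 c q ** I3 c q + I3 c q ** I3 c q = (-2) *\<^sub>R mat 1"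
      "I1 c q ** I2 c q + I2 c q ** I1 c q = 0 *\<^sub>R mat 1"
      "I2 c q ** I3 c q + I3 c q ** I2 c q = 0 *\<^sub>R mat 1"
      "I3 c q ** I1 c q + I1 c q ** I3 c q = 0 *\<^sub>R mat 1" if "q \<in> fst c \<inter> V" for q
      by (simp_all add: quaternion_frame.J_mult[OF fr(1)[OF c that]] vec_eq_iff)
    let ?C1 = "cov_endo \<Gamma> 0 I1 c p v" and ?C2 = "cov_endo \<Gamma> 0 I2 c p v" and ?C3 = "cov_endo \<Gamma> 0 I3 c p v"
    \<comment> \<open>For B = C the anticommutator identity yields the desired relation
      doubled.\<close>
    have half: "X = 0" if "X + X = 0" for X :: "real^'k^'k"
      using that by (simp add: add_eq_0_iff self_eq_neg_zero)
    note anti = cov_endo_anticommutator[OF _ _ c V(1) p]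
    have prem: "?C1 \<in> span {I1 c p, I2 c p, I3 c p}" "?C2 \<in> span {I1 c p, I2 c p, I3 c p}"
      "?C3 \<in> span {I1 c p, I2 c p, I3 c p}"
      "?C1 ** I1 c p + I1 c p ** ?C1 = 0" "?C2 ** I2 c p + I2 c p ** ?C2 = 0"
      "?C3 ** I3 c p + I3 c p ** ?C3 = 0"
      "?C1 ** I2 c p + I1 c p ** ?C2 + (?C2 ** I1 c p + I2 c p ** ?C1) = 0"
      "?C2 ** I3 c p + I2 c p ** ?C3 + (?C3 ** I2 c p + I3 c p ** ?C2) = 0"
      "?C3 ** I1 c p + I3 c p ** ?C1 + (?C1 ** I3 c p + I1 c p ** ?C3) = 0"
      using covQ[OF QS(1) c p] covQ[OF QS(2) c p] covQ[OF QS(3) c p]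
        half[OF anti[OF Ie(1,1) ac(1)]] half[OF anti[OF Ie(2,2) ac(2)]] half[OF anti[OF Ie(3,3) ac(3)]]
        anti[OF Ie(1,2) ac(4)] anti[OF Ie(2,3) ac(5)] anti[OF Ie(3,1) ac(6)]
      unfolding fr(2)[OF c p] by simp_all
    have cv: "covector (f B C c p) \<bullet> v = coef (C c p) (cov_endo \<Gamma> 0 B c p v)" if "endo_field A V B" for B C
      by (simp add: covector_inner[OF lin[OF that c p]]) (simp add: f_def)
    show "?C1 = (covector (f I1 I2 c p) \<bullet> v) *\<^sub>R I2 c p - (covector (f I3 I1 c p) \<bullet> v) *\<^sub>R I3 c p \<and>
      ?C2 = (covector (f I2 I3 c p) \<bullet> v) *\<^sub>R I3 c p - (covector (f I1 I2 c p) \<bullet> v) *\<^sub>R I1 c p \<and>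
      ?C3 = (covector (f I3 I1 c p) \<bullet> v) *\<^sub>R I1 c p - (covector (f I2 I3 c p) \<bullet> v) *\<^sub>R I2 c p"
      unfolding cv[OF Ie(1)] cv[OF Ie(2)] cv[OF Ie(3)] by (intro conjI J.derivation_coefs[OF prem])
  qed
  then show ?thesis using that by blast
qed

text \<open>In a difference of covariant derivatives the derivative of the section cancels, so the
  condition on sections becomes pointwise. Local generators of Q realise enough fibre elements by
  sections, and linearity gives the rest.\<close>

lemma connection_difference:
  assumes U: "open U" "quaternionic_connection A Q U \<Gamma>" "quaternionic_connection A Q U \<Gamma>'"
    and p: "c \<in> A" "p \<in> fst c \<inter> U"
  defines "D \<equiv> \<lambda>v. \<Gamma>' c p v - \<Gamma> c p v"
  shows "linear D" "\<And>v w. D v *v w = D w *v v"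
    "\<And>v B. B \<in> Q c p \<Longrightarrow> D v ** B - B ** D v \<in> Q c p"
proof -
  have "linear (\<Gamma> c p)" "linear (\<Gamma>' c p)"
    using U p by (auto simp: quaternionic_connection_def affine_connection_def)
  then show "linear D" unfolding D_def by (intro linear_compose_sub) auto
  have "\<Gamma> c p v *v w = \<Gamma> c p w *v v" "\<Gamma>' c p v *v w = \<Gamma>' c p w *v v" for v w
    using U p by (auto simp: quaternionic_connection_def torsion_free_def)
  then show "D v *v w = D w *v v" for v w by (simp add: D_def matrix_vector_simps(3))
  have ss: "subspace (Q c p)" using subspace_Q p by simp
  obtain V B1 B2 B3 where V: "open V" "p \<in> V"
    and Be: "endo_field A V B1" "endo_field A V B2" "endo_field A V B3"
    and QB: "\<And>c q. c \<in> A \<Longrightarrow> q \<in> fst c \<inter> V \<Longrightarrow> Q c q = span {B1 c q, B2 c q, B3 c q}"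
    using almost_quaternionic unfolding almost_quaternionic_def by metis
  have "D v ** B c p - B c p ** D v \<in> Q c p"
    if B: "endo_field A V B" "\<And>c q. c \<in> A \<Longrightarrow> q \<in> fst c \<inter> V \<Longrightarrow> B c q \<in> {B1 c q, B2 c q, B3 c q}" for B v
  proof -
    have "Q_section A Q (V \<inter> U) 0 B"
      using endo_field_subset[OF B(1), of "V \<inter> U"] B(2) QB unfolding Q_section_def
      by (auto intro: span_base)
    then have "cov_endo \<Gamma>' 0 B c p v \<in> Q c p" "cov_endo \<Gamma> 0 B c p v \<in> Q c p"
      using U p V unfolding quaternionic_connection_def by (meson IntI IntE open_Int inf_le2)+
    then have "cov_endo \<Gamma>' 0 B c p v - cov_endo \<Gamma> 0 B c p v \<in> Q c p"
      by (rule subspace_diff[OF ss])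
    then show ?thesis by (simp add: cov_endo_def D_def matrix_ring_simps algebra_simps)
  qed
  note gen = this[OF Be(1)] this[OF Be(2)] this[OF Be(3)]
  show "D v ** B - B ** D v \<in> Q c p" if "B \<in> Q c p" for v B
  proof -
    have "B \<in> span {B1 c p, B2 c p, B3 c p}" using that QB p V by auto
    then show ?thesis
    proof (induction rule: span_induct)
      case base
      show ?case
      proof (rule subspaceI)
        show "x + y \<in> {B. D v ** B - B ** D v \<in> Q c p}"
          if "x \<in> {B. D v ** B - B ** D v \<in> Q c p}" "y \<in> {B. D v ** B - B ** D v \<in> Q c p}" for x y
          using subspace_add[OF ss, of "D v ** x - x ** D v" "D v ** y - y ** D v"] that
          by (simp add: matrix_ring_simps algebra_simps)
        show "r *\<^sub>R x \<in> {B. D v ** B - B ** D v \<in> Q c p}"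
          if "x \<in> {B. D v ** B - B ** D v \<in> Q c p}" for r x
          using subspace_scale[OF ss, of "D v ** x - x ** D v" r] that
          by (simp add: matrix_ring_simps algebra_simps)
      qed (simp add: matrix_ring_simps subspace_0[OF ss])
    qed (use gen in auto)
  qed
qed

text \<open>A parallel nowhere vanishing density fixes the trace of the connection, and a difference
  tensor of trace zero vanishes.\<close>

lemma connections_agree_volume:
  assumes "open U" "quaternionic_connection A Q U \<Gamma>" "quaternionic_connection A Q U \<Gamma>'"
    and "\<And>c p v. c \<in> A \<Longrightarrow> p \<in> fst c \<inter> U \<Longrightarrow> trace (\<Gamma>' c p v) = trace (\<Gamma> c p v)"
  shows "connections_agree A U \<Gamma>' \<Gamma>"
  unfolding connections_agree_def
proof (intro ballI allI)
  fix c p v assume cp: "c \<in> A" "p \<in> fst c \<inter> U"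
  obtain J1 J2 J3 where J: "quaternion_frame J1 J2 J3" and QJ: "Q c p = span {J1, J2, J3}"
    using triple_at cp by blast
  note D = connection_difference[OF assms(1-3) cp, unfolded QJ]
  have "\<Gamma>' c p v - \<Gamma> c p v = 0"
    by (rule quaternion_frame.difference_tensor_trace_zero[OF J D]) (simp_all add: trace_simps assms(4)[OF cp])
  then show "\<Gamma>' c p v = \<Gamma> c p v" by simp
qed

text \<open>A frame with first member I is needed at each point, since the rigidity used is
  commutation with the first member of a triple.\<close>

lemma connections_agree_parallel:
  assumes "quaternionic_connection A Q UNIV \<Gamma>" "quaternionic_connection A Q UNIV \<Gamma>'"
    and I: "Q_section A Q UNIV 0 I" "\<And>c p. c \<in> A \<Longrightarrow> p \<in> fst c \<Longrightarrow> I c p ** I c p = - mat 1"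
    and "parallel_endo A UNIV \<Gamma> I" "parallel_endo A UNIV \<Gamma>' I"
  shows "connections_agree A UNIV \<Gamma>' \<Gamma>"
  unfolding connections_agree_def
proof (intro ballI allI)
  fix c p v assume cp: "c \<in> A" "p \<in> fst c \<inter> UNIV"
  obtain W I2 I3 where W: "open W" "p \<in> W" "admissible_frame A Q W I I2 I3"
    by (rule local_admissible_frame[OF I, of p])
  have J: "quaternion_frame (I c p) (I2 c p) (I3 c p)" and QJ: "Q c p = span {I c p, I2 c p, I3 c p}"
    using admissible_frame_at[OF W(3)] cp W(2) by auto
  note D = connection_difference[OF open_UNIV assms(1,2) cp, unfolded QJ]
  have "cov_endo \<Gamma>' 0 I c p v = cov_endo \<Gamma> 0 I c p v" for v
    using assms(5,6) cp by (auto simp: parallel_endo_def)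
  then have "\<Gamma>' c p v ** I c p - I c p ** \<Gamma>' c p v = \<Gamma> c p v ** I c p - I c p ** \<Gamma> c p v" for v
    by (simp add: cov_endo_def)
  then have com: "(\<Gamma>' c p v - \<Gamma> c p v) ** I c p = I c p ** (\<Gamma>' c p v - \<Gamma> c p v)" for v
    by (simp add: matrix_ring_simps algebra_simps)
  have "\<Gamma>' c p v - \<Gamma> c p v = 0"
    by (rule quaternion_frame.difference_tensor_commuting[OF J D com])
  then show "\<Gamma>' c p v = \<Gamma> c p v" by simp
qed

end

section \<open>The connection preserving the complex structure\<close>

lemma abs_has_derivative: "x \<noteq> 0 \<Longrightarrow> (abs has_derivative (\<lambda>h. sgn x * h)) (at x)" for x :: real
  using has_derivative_norm[of x] by (simp add: real_norm_def[abs_def] mult.commute)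

text \<open>The cyclic sum, with skewness in the first pair already inserted, is contracted over x.
  Up to the order of arguments the two traces on the right are Ricci tensors.\<close>

lemma trace_first_bianchi:
  fixes R :: "real^'k \<Rightarrow> real^'k \<Rightarrow> real^'k^'k"
  assumes bianchi: "\<And>x. R x v *v w + R v w *v x - R x w *v v = 0"
    and "linear (\<lambda>x. R x v *v w)" "linear (\<lambda>x. R x w *v v)"
  shows "trace (R v w) = trace (matrix (\<lambda>x. R x w *v v)) - trace (matrix (\<lambda>x. R x v *v w))"
proof -
  have "R v w = matrix (\<lambda>x. R x w *v v) - matrix (\<lambda>x. R x v *v w)"
    by (rule matrix_eqI)
       (use bianchi in \<open>simp add: matrix_vector_simps(3) matrix_works assms(2,3) algebra_simps\<close>)
  then show ?thesis by (simp add: trace_simps)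
qed

context manifold
begin

text \<open>By the first Bianchi identity the skew part of \<open>Ric\<close> is the curvature on volume forms.\<close>

lemma symmetric_Ricci_trace_closed:
  assumes aff: "affine_connection A UNIV \<Gamma>" and tf: "torsion_free A UNIV \<Gamma>"
    and ric: "symmetric_Ricci A UNIV \<Gamma>" and c: "c \<in> A" "p \<in> fst c"
  shows "trace (deriv_in c (\<lambda>q. \<Gamma> c q w) p v) = trace (deriv_in c (\<lambda>q. \<Gamma> c q v) p w)"
proof -
  let ?d = "\<lambda>v x. deriv_in c (\<lambda>q. \<Gamma> c q v) p x"
  have hd: "has_deriv_in c (\<lambda>q. \<Gamma> c q v) p (?d v)" for v
    using aff c unfolding affine_connection_def
    by (intro smooth_in_has_deriv[of _ UNIV]) auto
  have \<Gamma>sym: "\<Gamma> c q v *v w = \<Gamma> c q w *v v" if "q \<in> fst c" for q v w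
    using tf c that by (auto simp: torsion_free_def)
  have hdw: "has_deriv_in c (\<lambda>q. \<Gamma> c q v *v w) p (\<lambda>x. ?d v x *v w)" for v w
    by (rule has_deriv_in_bounded_linear[OF
          bounded_bilinear.bounded_linear_left[OF bounded_bilinear_matrix_vector_mult] hd])
  have dsym: "?d v x *v w = ?d w x *v v" for v w x
  proof -
    have "has_deriv_in c (\<lambda>q. \<Gamma> c q w *v v) p (\<lambda>x. ?d v x *v w)"
      by (rule has_deriv_in_transform[OF c(1) open_UNIV _ _ hdw]) (use c \<Gamma>sym in auto)
    from has_deriv_inD[OF this] has_deriv_inD[OF hdw] show ?thesis by metis
  qed
  have lin\<Gamma>: "linear (\<Gamma> c p)"
    using aff c by (auto simp: affine_connection_def)
  have lind: "linear (?d v)" for v by (rule has_deriv_in_linear[OF hd])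
  have lind2: "linear (\<lambda>x. ?d x v *v w)" for v w
    unfolding dsym[of _ v w] linear_iff by (simp add: matrix_vector_simps(2,8))
  have R: "curvature \<Gamma> c p a b *v u = ?d b a *v u - ?d a b *v u
      + \<Gamma> c p a *v (\<Gamma> c p b *v u) - \<Gamma> c p b *v (\<Gamma> c p a *v u)" for a b u
    by (simp add: curvature_def matrix_vector_simps)
  have linR: "linear (\<lambda>x. curvature \<Gamma> c p x a *v b)" for a b
    unfolding R using lind[of a] lind2[of a b] lin\<Gamma>
    by (simp add: linear_iff matrix_vector_simps(1,2,7,8) algebra_simps)
  have "curvature \<Gamma> c p x v *v w + curvature \<Gamma> c p v w *v x - curvature \<Gamma> c p x w *v v = 0" for x
    unfolding R using c dsym[of v x w] dsym[of x w v] dsym[of w v x]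
      \<Gamma>sym[of p v w] \<Gamma>sym[of p x w] \<Gamma>sym[of p v x]
    by (simp add: algebra_simps)
  from trace_first_bianchi[where R="curvature \<Gamma> c p", OF this linR linR]
  have "trace (curvature \<Gamma> c p v w) = Ricci \<Gamma> c p w v - Ricci \<Gamma> c p v w"
    by (simp add: Ricci_def)
  also have "\<dots> = 0"
    using ric c by (auto simp: symmetric_Ricci_def)
  \<comment> \<open>The quadratic part of the curvature is a commutator and has trace zero; what
    remains is the exterior derivative of the trace of \<Gamma>.\<close>
  finally show ?thesis
    by (simp add: curvature_def trace_simps trace_mul_sym[of "\<Gamma> c p v"])
qed

lemma affine_connection_subset: "affine_connection A UNIV \<Gamma> \<Longrightarrow> affine_connection A U \<Gamma>"
  unfolding affine_connection_def by (blast intro: smooth_in_subset)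

end

context quaternionic
begin

section \<open>Changing a quaternionic connection by a one-form\<close>

lemma quaternionic_connection_subset:
  "quaternionic_connection A Q UNIV \<Gamma> \<Longrightarrow> quaternionic_connection A Q U \<Gamma>"
  unfolding quaternionic_connection_def
  by (auto intro: affine_connection_subset simp: torsion_free_def)

definition shift ::
  "('m, 'k) connection_comp \<Rightarrow> ('m, 'k) vector_comp \<Rightarrow> ('m, 'k) connection_comp" where
  "shift \<Gamma> \<theta> c p v = \<Gamma> c p v + Q_tensor (Q c p) (\<theta> c p) v"

lemma Q_tensor_at:
  assumes "c \<in> A" "p \<in> fst c"
  shows "linear (Q_tensor (Q c p) \<theta>)" "Q_tensor (Q c p) \<theta> v *v w = Q_tensor (Q c p) \<theta> w *v v"
    "B \<in> Q c p \<Longrightarrow> Q_tensor (Q c p) \<theta> v ** B - B ** Q_tensor (Q c p) \<theta> v \<in> Q c p"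
    "trace (Q_tensor (Q c p) \<theta> v) = 4 * (real n + 1) * (\<theta> \<bullet> v)"
proof -
  obtain J1 J2 J3 where J: "quaternion_frame J1 J2 J3" and QJ: "Q c p = span {J1, J2, J3}"
    using triple_at assms by blast
  interpret J: quaternion_frame J1 J2 J3 by (rule J)
  have eq: "Q_tensor (Q c p) \<theta> = J.quat_tensor \<theta>"
    using J.Q_tensor_eq[OF QJ] by blast
  show "linear (Q_tensor (Q c p) \<theta>)" unfolding eq by (rule J.linear_quat_tensor)
  show "Q_tensor (Q c p) \<theta> v *v w = Q_tensor (Q c p) \<theta> w *v v"
    unfolding eq by (rule J.quat_tensor_sym)
  show "B \<in> Q c p \<Longrightarrow> Q_tensor (Q c p) \<theta> v ** B - B ** Q_tensor (Q c p) \<theta> v \<in> Q c p"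
    unfolding eq unfolding QJ by (rule J.quat_tensor_preserves)
  show "trace (Q_tensor (Q c p) \<theta> v) = 4 * (real n + 1) * (\<theta> \<bullet> v)"
    unfolding eq J.trace_quat_tensor by (simp add: dimension(1))
qed

lemma cov_endo_shift:
  "cov_endo (shift \<Gamma> \<theta>) 0 B c p v = cov_endo \<Gamma> 0 B c p v
     + (Q_tensor (Q c p) (\<theta> c p) v ** B c p - B c p ** Q_tensor (Q c p) (\<theta> c p) v)"
  by (simp add: cov_endo_def shift_def matrix_ring_simps algebra_simps)

text \<open>The pointwise choice of triples may jump, but on the domain of an admissible frame the
  tensor equals the polynomial expression in that frame, which is smooth.\<close>

lemma smooth_in_Q_tensor:
  assumes \<theta>: "one_form A UNIV \<theta>" and c: "c \<in> A"
    and frames: "\<And>p. \<exists>W I1 I2 I3. open W \<and> p \<in> W \<and> admissible_frame A Q W I1 I2 I3"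
  shows "smooth_in c UNIV (\<lambda>p. Q_tensor (Q c p) (\<theta> c p) v)"
proof (rule smooth_in_local[OF c])
  fix p assume "p \<in> fst c \<inter> UNIV"
  obtain W I1 I2 I3 where W: "open W" "p \<in> W" "admissible_frame A Q W I1 I2 I3"
    using frames[of p] by (elim exE conjE)
  have Is: "smooth_in c W (I1 c)" "smooth_in c W (I2 c)" "smooth_in c W (I3 c)"
    using W(3) c by (auto simp: admissible_frame_def endo_density_def)
  have \<theta>s: "smooth_in c W (\<theta> c)"
    using \<theta> c smooth_in_subset[of c UNIV "\<theta> c" W] by (auto simp: one_form_def)
  let ?T = "\<lambda>q. (\<theta> c q \<bullet> v) *\<^sub>R mat 1 + outer v (\<theta> c q)
     - ((\<theta> c q \<bullet> (I1 c q *v v)) *\<^sub>R I1 c q + outer (I1 c q *v v) (\<theta> c q) ** I1 c q)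
     - ((\<theta> c q \<bullet> (I2 c q *v v)) *\<^sub>R I2 c q + outer (I2 c q *v v) (\<theta> c q) ** I2 c q)
     - ((\<theta> c q \<bullet> (I3 c q *v v)) *\<^sub>R I3 c q + outer (I3 c q *v v) (\<theta> c q) ** I3 c q)"
  have "smooth_in c W ?T"
    by (intro smooth_in_intros c W(1) Is \<theta>s)
  moreover have "Q_tensor (Q c q) (\<theta> c q) v = ?T q" if "q \<in> fst c \<inter> W" for q
    using quaternion_frame.Q_tensor_eq[OF admissible_frame_at[OF W(3) c that]]
      quaternion_frame.quat_tensor_def[OF admissible_frame_at(1)[OF W(3) c that]] by simp
  ultimately have "smooth_in c W (\<lambda>p. Q_tensor (Q c p) (\<theta> c p) v)"
    using smooth_in_cong[OF c W(1), of "\<lambda>p. Q_tensor (Q c p) (\<theta> c p) v" ?T] by blast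
  then show "\<exists>V. open V \<and> p \<in> V \<and> smooth_in c V (\<lambda>p. Q_tensor (Q c p) (\<theta> c p) v)"
    using W by blast
qed

lemma quaternionic_connection_shift:
  assumes \<Gamma>: "quaternionic_connection A Q UNIV \<Gamma>" and \<theta>: "one_form A UNIV \<theta>"
    and frames: "\<And>p. \<exists>W I1 I2 I3. open W \<and> p \<in> W \<and> admissible_frame A Q W I1 I2 I3"
  shows "quaternionic_connection A Q UNIV (shift \<Gamma> \<theta>)"
proof -
  have aff: "affine_connection A UNIV \<Gamma>" and tf: "torsion_free A UNIV \<Gamma>"
    and pres: "\<And>V B c p v. open V \<Longrightarrow> Q_section A Q V 0 B \<Longrightarrow> c \<in> A \<Longrightarrow> p \<in> fst c \<inter> V
      \<Longrightarrow> cov_endo \<Gamma> 0 B c p v \<in> Q c p"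
    using \<Gamma> unfolding quaternionic_connection_def by auto
  have "affine_connection A UNIV (shift \<Gamma> \<theta>)"
    unfolding affine_connection_def
  proof (intro conjI ballI allI)
    show "linear (shift \<Gamma> \<theta> c p)" if "c \<in> A" "p \<in> fst c \<inter> UNIV" for c p
      unfolding shift_def[abs_def]
      using that aff Q_tensor_at(1)[of c p] by (intro linear_compose_add) (auto simp: affine_connection_def)
    show "smooth_in c UNIV (\<lambda>p. shift \<Gamma> \<theta> c p v)" if "c \<in> A" for c v
      unfolding shift_def using that aff
      by (intro smooth_in_add smooth_in_Q_tensor[OF \<theta> _ frames]) (auto simp: affine_connection_def)
    fix c d p v w assume cd: "c \<in> A" "d \<in> A" "p \<in> fst c \<inter> fst d \<inter> UNIV"
    have "\<theta> d p \<bullet> (jac c d p *v u) = \<theta> c p \<bullet> u" for u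
      using \<theta> cd by (auto simp: one_form_def)
    \<comment> \<open>The added term transforms homogeneously, so the inhomogeneous part of the law
      is that of \<Gamma> unchanged.\<close>
    from Q_tensor_transform[OF cd(1,2) _ this, of v] cd(3)
    have "Q_tensor (Q d p) (\<theta> d p) (jac c d p *v v) *v (jac c d p *v w)
        = jac c d p *v (Q_tensor (Q c p) (\<theta> c p) v *v w)"
      by (simp add: matrix_vector_mul_assoc)
    moreover have "\<Gamma> d p (jac c d p *v v) *v (jac c d p *v w) =
        jac c d p *v (\<Gamma> c p v *v w) - deriv_in c (\<lambda>q. jac c d q *v w) p v"
      using aff cd unfolding affine_connection_def by blast
    ultimately show "shift \<Gamma> \<theta> d p (jac c d p *v v) *v (jac c d p *v w) =
        jac c d p *v (shift \<Gamma> \<theta> c p v *v w) - deriv_in c (\<lambda>q. jac c d q *v w) p v"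
      by (simp add: shift_def matrix_vector_simps(1,2))
  qed
  moreover have "torsion_free A UNIV (shift \<Gamma> \<theta>)"
    unfolding torsion_free_def
  proof (intro ballI allI)
    fix c p v w assume cp: "c \<in> A" "p \<in> fst c \<inter> UNIV"
    then have "\<Gamma> c p v *v w = \<Gamma> c p w *v v" using tf by (auto simp: torsion_free_def)
    then show "shift \<Gamma> \<theta> c p v *v w = shift \<Gamma> \<theta> c p w *v v"
      using cp Q_tensor_at(2)[of c p "\<theta> c p" v w] by (simp add: shift_def matrix_vector_simps(1))
  qed
  moreover have "cov_endo (shift \<Gamma> \<theta>) 0 B c p v \<in> Q c p"
    if "open V" "Q_section A Q V 0 B" "c \<in> A" "p \<in> fst c \<inter> V" for V B c p v
  proof -
    have "B c p \<in> Q c p" using that by (auto simp: Q_section_def)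
    then show ?thesis
      unfolding cov_endo_shift using that
      by (intro subspace_add[OF subspace_Q] pres Q_tensor_at(3)) auto
  qed
  ultimately show ?thesis
    unfolding quaternionic_connection_def by blast
qed

text \<open>The derivative of I has components along I2 and I3 only, and so has the commutator of
  the tensor with I. Integrability makes the two components depend on a single form, and one
  \<theta> can cancel both.\<close>

lemma parallel_shift_eta:
  assumes \<Gamma>: "quaternionic_connection A Q UNIV \<Gamma>"
    and I: "compatible_complex_structure A Q I" and \<eta>: "eta_form A Q \<Gamma> I \<eta>"
  shows "parallel_endo A UNIV (shift \<Gamma> (\<lambda>c p. (- 1 / 4) *\<^sub>R \<eta> c p)) I"
  unfolding parallel_endo_def
proof (intro ballI allI)
  fix c p v assume c: "c \<in> A" and "p \<in> fst c \<inter> UNIV"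
  then have p: "p \<in> fst c" by simp
  have Is: "Q_section A Q UNIV 0 I" and cs: "complex_structure A I"
    and sq: "\<And>c p. c \<in> A \<Longrightarrow> p \<in> fst c \<Longrightarrow> I c p ** I c p = - mat 1"
    using I by (auto simp: compatible_complex_structure_def complex_structure_def)
  obtain W I2 I3 where W: "open W" "p \<in> W" "admissible_frame A Q W I I2 I3"
    by (rule local_admissible_frame[OF Is sq, of p])
  obtain \<omega>1 \<omega>2 \<omega>3 where \<omega>: "frame_forms A W \<Gamma> I I2 I3 \<omega>1 \<omega>2 \<omega>3"
    by (rule frame_forms_exist[OF \<Gamma> W(1,3)])
  have pW: "p \<in> fst c \<inter> W" using p W(2) by simp
  interpret J: quaternion_frame "I c p" "I2 c p" "I3 c p"
    by (rule admissible_frame_at(1)[OF W(3) c pW])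
  have QJ: "Q c p = span {I c p, I2 c p, I3 c p}"
    by (rule admissible_frame_at(2)[OF W(3) c pW])
  have C: "cov_endo \<Gamma> 0 I c p v = (\<omega>3 c p \<bullet> v) *\<^sub>R I2 c p - (\<omega>2 c p \<bullet> v) *\<^sub>R I3 c p" for v
    using \<omega> c pW unfolding frame_forms_def by blast
  have tf: "torsion_free A UNIV \<Gamma>" using \<Gamma> by (simp add: quaternionic_connection_def)
  \<comment> \<open>Integrability of I enters here.\<close>
  have w2: "\<omega>2 c p \<bullet> x = \<omega>3 c p \<bullet> (I c p *v x)" for x
    by (rule J.nijenhuis_coefs[OF C nijenhuis_cov[OF cs tf c p]])
       (simp_all add: linear_iff inner_add_right)
  have w23: "\<omega>2 c p \<bullet> (I2 c p *v x) = \<omega>3 c p \<bullet> (I3 c p *v x)" for x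
    unfolding w2 by (simp add: J.quaternion_simps)
  have e: "\<eta> c p \<bullet> x = 2 * (\<omega>3 c p \<bullet> (I3 c p *v x))" for x
    using \<eta> W(1,3) \<omega> c pW w23[of x] unfolding eta_form_def by fastforce
  have e2: "\<eta> c p \<bullet> (I2 c p *v v) = - 2 * (\<omega>2 c p \<bullet> v)"
    unfolding e w2 by (simp add: J.quaternion_simps)
  have e3: "\<eta> c p \<bullet> (I3 c p *v v) = - 2 * (\<omega>3 c p \<bullet> v)"
    unfolding e by (simp add: J.quaternion_simps)
  \<comment> \<open>The factor 2 of the commutator, the factor -2 in \<open>e2\<close> and
    \<open>e3\<close>, and -1/4 multiply to 1, so the commutator is exactly the negative of the
    derivative of I.\<close>
  show "cov_endo (shift \<Gamma> (\<lambda>c p. (- 1 / 4) *\<^sub>R \<eta> c p)) 0 I c p v = 0"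
    unfolding cov_endo_shift J.Q_tensor_eq[OF QJ] J.quat_tensor_commutator1 C
    by (simp add: e2 e3)
qed

lemma trace_shift_eta:
  assumes "c \<in> A" "p \<in> fst c"
  shows "trace (shift \<Gamma> (\<lambda>c p. (- 1 / 4) *\<^sub>R \<eta> c p) c p v) = trace (\<Gamma> c p v) - (real n + 1) * (\<eta> c p \<bullet> v)"
  unfolding shift_def trace_simps Q_tensor_at(4)[OF assms] by (simp add: field_simps)

section \<open>Parallel volume forms and twistor functions\<close>

text \<open>Written in one chart because the trace of a connection changes between charts by the
  logarithmic derivative of the Jacobian determinant. Within the chart it is a closed form, to which
  the Poincare lemma applies on a coordinate ball.\<close>

lemma trace_connection_primitive:
  assumes \<Gamma>: "quaternionic_connection A Q UNIV \<Gamma>" "symmetric_Ricci A UNIV \<Gamma>"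
    and \<eta>: "closed_one_form A UNIV \<eta>" and c: "c \<in> A" "p \<in> fst c"
  shows "\<exists>B f. open B \<and> snd c p \<in> B \<and> (\<forall>q\<in>fst c. snd c q \<in> B \<longrightarrow>
    has_deriv_in c (\<lambda>q. f (snd c q)) q (\<lambda>v. trace (shift \<Gamma> (\<lambda>c p. (- 1 / 4) *\<^sub>R \<eta> c p) c q v)))"
proof -
  let ?\<Gamma>I = "shift \<Gamma> (\<lambda>c p. (- 1 / 4) *\<^sub>R \<eta> c p)"
  have aff: "affine_connection A UNIV \<Gamma>" and tf: "torsion_free A UNIV \<Gamma>"
    using \<Gamma> by (auto simp: quaternionic_connection_def)
  have lin\<Gamma>: "linear (\<lambda>v. trace (\<Gamma> c q v))" if "q \<in> fst c" for q
    using aff c that linear_compose[OF _ linear_trace, of "\<Gamma> c q"]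
    by (auto simp: affine_connection_def o_def)
  have sm\<Gamma>: "smooth_in c UNIV (\<lambda>q. \<Gamma> c q v)" for v
    using aff c by (auto simp: affine_connection_def)
  have sm\<eta>: "smooth_in c UNIV (\<eta> c)"
    using \<eta> c by (auto simp: closed_one_form_def one_form_def)
  \<comment> \<open>The component vector of the trace of the shifted connection in the chart
    \<open>c\<close>; it is expressed through \<Gamma> and \<eta>, whose smoothness and closedness
    are given.\<close>
  define a where "a q = covector (\<lambda>v. trace (\<Gamma> c q v)) - (real n + 1) *\<^sub>R \<eta> c q" for q
  have sma: "smooth_in c UNIV a"
    unfolding a_def covector_def
    by (intro smooth_in_diff smooth_in_sum smooth_in_bilinear[OF bounded_bilinear_scaleR]
        smooth_in_const smooth_in_bounded_linear[OF _ _ bounded_linear_trace] sm\<Gamma> sm\<eta> c(1) open_UNIV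
        finite_Basis)
  have a: "a q \<bullet> v = trace (?\<Gamma>I c q v)" if "q \<in> fst c" for q v
    unfolding trace_shift_eta[OF c(1) that]
    by (simp add: a_def covector_inner[OF lin\<Gamma>[OF that]] inner_diff_left)
  have hda: "has_deriv_in c a q (deriv_in c a q)" if "q \<in> fst c" for q
    using that by (intro smooth_in_has_deriv[OF sma]) auto
  have sym: "deriv_in c a q v \<bullet> w = deriv_in c a q w \<bullet> v" if q: "q \<in> fst c" for q v w
  proof -
    have da: "deriv_in c a q v \<bullet> w = trace (deriv_in c (\<lambda>q. \<Gamma> c q w) q v)
        - (real n + 1) * (deriv_in c (\<eta> c) q v \<bullet> w)" for v w
    proof -
      have 1: "has_deriv_in c (\<lambda>q. a q \<bullet> w) q (\<lambda>v. deriv_in c a q v \<bullet> w)"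
        by (rule has_deriv_in_bounded_linear[OF bounded_linear_inner_left hda[OF q]])
      have 2: "has_deriv_in c (\<lambda>q. a q \<bullet> w) q (\<lambda>v. trace (deriv_in c (\<lambda>q. \<Gamma> c q w) q v)
        - (real n + 1) * (deriv_in c (\<eta> c) q v \<bullet> w))"
      proof (rule has_deriv_in_transform[OF c(1) open_UNIV])
        have "has_deriv_in c (\<lambda>q. trace (\<Gamma> c q w)) q (\<lambda>v. trace (deriv_in c (\<lambda>q. \<Gamma> c q w) q v))"
          using q by (intro has_deriv_in_bounded_linear[OF bounded_linear_trace] smooth_in_has_deriv[OF sm\<Gamma>]) auto
        moreover have "has_deriv_in c (\<lambda>q. (real n + 1) * (\<eta> c q \<bullet> w)) q
            (\<lambda>v. (real n + 1) * (deriv_in c (\<eta> c) q v \<bullet> w))"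
          using q by (intro has_deriv_in_bounded_linear[OF bounded_linear_mult_right]
              has_deriv_in_bounded_linear[OF bounded_linear_inner_left] smooth_in_has_deriv[OF sm\<eta>]) auto
        ultimately show "has_deriv_in c (\<lambda>q. trace (\<Gamma> c q w) - (real n + 1) * (\<eta> c q \<bullet> w)) q
            (\<lambda>v. trace (deriv_in c (\<lambda>q. \<Gamma> c q w) q v) - (real n + 1) * (deriv_in c (\<eta> c) q v \<bullet> w))"
          unfolding has_deriv_in_def o_def by (rule has_derivative_diff)
      qed (use q in \<open>auto simp: a_def covector_inner[OF lin\<Gamma>] inner_diff_left\<close>)
      show ?thesis using has_deriv_inD[OF 1, of v] has_deriv_inD[OF 2, of v] by simp
    qed
    have "deriv_in c (\<eta> c) q v \<bullet> w = deriv_in c (\<eta> c) q w \<bullet> v"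
      using \<eta> c q by (force simp: closed_one_form_def)
    then show ?thesis
      unfolding da using symmetric_Ricci_trace_closed[OF aff tf \<Gamma>(2) c(1) q, of w v] by simp
  qed
  have "open (snd c ` fst c)" using open_coords[OF c(1) open_UNIV] by simp
  then obtain r where r: "r > 0" "ball (snd c p) r \<subseteq> snd c ` fst c"
    using c by (meson imageI openE)
  let ?B = "ball (snd c p) r" and ?g = "a \<circ> chart_inv c"
  have inB: "\<exists>q\<in>fst c. x = snd c q" if "x \<in> ?B" for x using that r by auto
  have "\<exists>f. \<forall>x\<in>?B. (f has_derivative (\<lambda>v. ?g x \<bullet> v)) (at x)"
  proof (rule closed_form_has_primitive_on_ball[of "snd c p" r ?g "\<lambda>x. deriv_in c a (chart_inv c x)"])
    fix x assume "x \<in> ?B"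
    then obtain q where q: "q \<in> fst c" "x = snd c q" using inB by blast
    then have iq: "chart_inv c x = q" using c by simp
    show "(?g has_derivative deriv_in c a (chart_inv c x)) (at x)"
      using hda[OF q(1)] unfolding has_deriv_in_def iq q(2)[symmetric] .
    show "deriv_in c a (chart_inv c x) v \<bullet> w = deriv_in c a (chart_inv c x) w \<bullet> v" for v w
      unfolding iq by (rule sym[OF q(1)])
  next
    fix v
    have "smooth_in c UNIV (\<lambda>q. deriv_in c a q v)"
      by (rule smooth_in_deriv[OF c(1) open_UNIV sma])
    then have "continuous_on (snd c ` fst c) (\<lambda>x. deriv_in c a (chart_inv c x) v)"
      unfolding smooth_in_def by (simp add: o_def smooth_on_continuous)
    then show "continuous_on ?B (\<lambda>x. deriv_in c a (chart_inv c x) v)"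
      using r(2) by (rule continuous_on_subset)
  qed
  then obtain f where f: "\<forall>x\<in>?B. (f has_derivative (\<lambda>v. ?g x \<bullet> v)) (at x)" by blast
  show ?thesis
  proof (intro exI[of _ ?B] exI[of _ f] conjI ballI impI)
    fix q assume q: "q \<in> fst c" "snd c q \<in> ?B"
    have "(f has_derivative (\<lambda>v. trace (?\<Gamma>I c q v))) (at (snd c q))"
      using f[rule_format, OF q(2)] unfolding o_def chart_inv_chart[OF c(1) q(1)] a[OF q(1)] .
    then have "((\<lambda>x. f (snd c (chart_inv c x))) has_derivative (\<lambda>v. trace (?\<Gamma>I c q v))) (at (snd c q))"
      by (rule has_derivative_transform_within_open[OF _ open_coords[OF c(1) open_UNIV]])
         (use q c in auto)
    then show "has_deriv_in c (\<lambda>q. f (snd c q)) q (\<lambda>v. trace (?\<Gamma>I c q v))"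
      by (simp add: has_deriv_in_def o_def)
  qed (use r in auto)
qed

text \<open>Parallelism as a first-order linear equation, with positivity so that real powers make
  sense. Smoothness is not demanded but recovered from the equation.\<close>

definition parallel_positive :: "'m set \<Rightarrow> ('m, 'k) connection_comp \<Rightarrow> ('m, 'k) scalar_comp \<Rightarrow> bool" where
  "parallel_positive U \<Gamma> \<nu> \<longleftrightarrow>
     (\<forall>c\<in>A. \<forall>p\<in>fst c \<inter> U. \<nu> c p > 0 \<and> has_deriv_in c (\<nu> c) p (\<lambda>v. trace (\<Gamma> c p v) * \<nu> c p)) \<and>
     (\<forall>c\<in>A. \<forall>d\<in>A. \<forall>p\<in>fst c \<inter> fst d \<inter> U. \<nu> c p = \<bar>det (jac c d p)\<bar> * \<nu> d p)"

text \<open>The volume form is the coordinate volume of the chart \<open>c\<close> times \<open>exp f\<close>.\<close>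

lemma parallel_positive_exists:
  assumes aff: "affine_connection A UNIV \<Gamma>" and c: "c \<in> A" and U: "open U" "U \<subseteq> fst c"
    and f: "\<And>q. q \<in> U \<Longrightarrow> has_deriv_in c f q (\<lambda>v. trace (\<Gamma> c q v))"
  shows "parallel_positive U \<Gamma> (\<lambda>d q. \<bar>det (jac d c q)\<bar> * exp (f q))"
  unfolding parallel_positive_def
proof (intro conjI ballI)
  fix d q assume d: "d \<in> A" and q: "q \<in> fst d \<inter> U"
  then have qdc: "q \<in> fst d \<inter> fst c" "q \<in> fst c \<inter> fst d" "q \<in> fst d" using U by auto
  let ?J = "jac d c q" and ?N = "jac c d q"
  have NJ: "?N ** ?J = mat 1" by (rule jac_inverse[OF d c qdc(1)])
  have d0: "det ?J \<noteq> 0" by (rule det_jac_nonzero[OF d c qdc(1)])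
  then show "\<bar>det ?J\<bar> * exp (f q) > 0" by simp
  have "((\<lambda>x. det ((jac d c \<circ> chart_inv d) x)) has_derivative
      (\<lambda>v. det ((jac d c \<circ> chart_inv d) (snd d q)) * trace (?N ** deriv_in d (jac d c) q v))) (at (snd d q))"
    by (rule det_has_derivative[OF has_deriv_jac[OF d c qdc(1), unfolded has_deriv_in_def]])
       (simp add: d qdc NJ)
  then have D: "((\<lambda>x. det (jac d c (chart_inv d x))) has_derivative
      (\<lambda>v. det ?J * trace (?N ** deriv_in d (jac d c) q v))) (at (snd d q))"
    by (simp add: d qdc o_def)
  have A: "(abs has_derivative (\<lambda>h. sgn (det ?J) * h)) (at (det (jac d c (chart_inv d (snd d q)))))"
    using abs_has_derivative[OF d0] by (simp add: d qdc)
  from has_derivative_compose[OF D A]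
  have 1: "has_deriv_in d (\<lambda>q. \<bar>det (jac d c q)\<bar>) q
      (\<lambda>v. sgn (det ?J) * (det ?J * trace (?N ** deriv_in d (jac d c) q v)))"
    unfolding has_deriv_in_def o_def .
  have "has_deriv_in d f q (\<lambda>v. trace (\<Gamma> c q (?J *v v)))"
    by (rule has_deriv_in_change[OF d c qdc(1) f]) (use q in simp)
  then have "((\<lambda>x. exp (f (chart_inv d x))) has_derivative
      (\<lambda>v. exp (f (chart_inv d (snd d q))) * trace (\<Gamma> c q (?J *v v)))) (at (snd d q))"
    unfolding has_deriv_in_def o_def by (auto intro!: derivative_eq_intros)
  then have 2: "has_deriv_in d (\<lambda>q. exp (f q)) q (\<lambda>v. exp (f q) * trace (\<Gamma> c q (?J *v v)))"
    by (simp add: has_deriv_in_def o_def d qdc)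
  \<comment> \<open>The trace of the transformation law: the correction is the logarithmic
    derivative of the Jacobian determinant, which the determinant factor of the volume form
    compensates.\<close>
  have tr: "trace (\<Gamma> c q (?J *v v)) = trace (\<Gamma> d q v) - trace (?N ** deriv_in d (jac d c) q v)" for v
  proof -
    have "\<Gamma> c q (?J *v v) ** ?J = ?J ** \<Gamma> d q v - deriv_in d (jac d c) q v"
      using affine_connection_transform[OF aff d c] qdc by simp
    also have "\<dots> = ?J ** (\<Gamma> d q v - ?N ** deriv_in d (jac d c) q v)"
      using jac_inverse[OF c d qdc(2)] by (simp add: matrix_ring_simps(3,4) matrix_mul_assoc)
    finally show ?thesis
      using trace_change[OF d c qdc(1)] by (simp add: trace_simps)
  qed
  have "has_deriv_in d (\<lambda>q. \<bar>det (jac d c q)\<bar> * exp (f q)) q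
      (\<lambda>v. \<bar>det ?J\<bar> * (exp (f q) * trace (\<Gamma> c q (?J *v v)))
        + sgn (det ?J) * (det ?J * trace (?N ** deriv_in d (jac d c) q v)) * exp (f q))"
    by (rule has_deriv_in_bilinear[OF bounded_bilinear_mult d qdc(3) 1 2])
  moreover have "\<bar>det ?J\<bar> * (exp (f q) * trace (\<Gamma> c q (?J *v v)))
        + sgn (det ?J) * (det ?J * trace (?N ** deriv_in d (jac d c) q v)) * exp (f q)
      = trace (\<Gamma> d q v) * (\<bar>det ?J\<bar> * exp (f q))" for v
    unfolding tr abs_sgn[of "det ?J"] by (simp add: algebra_simps)
  ultimately show "has_deriv_in d (\<lambda>q. \<bar>det (jac d c q)\<bar> * exp (f q)) q
      (\<lambda>v. trace (\<Gamma> d q v) * (\<bar>det ?J\<bar> * exp (f q)))"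
    by simp
next
  fix d e q assume "d \<in> A" "e \<in> A" "q \<in> fst d \<inter> fst e \<inter> U"
  then have "jac d c q = jac e c q ** jac d e q"
    using c U by (intro jac_cocycle) auto
  then show "\<bar>det (jac d c q)\<bar> * exp (f q) = \<bar>det (jac d e q)\<bar> * (\<bar>det (jac e c q)\<bar> * exp (f q))"
    by (simp add: det_mul abs_mult)
qed

text \<open>The power s multiplies the logarithmic derivative by s, matching the connection on
  \<open>L\<close> to the power s.\<close>

lemma parallel_positive_powr:
  assumes aff: "affine_connection A UNIV \<Gamma>" and U: "open U" and \<nu>: "parallel_positive U \<Gamma> \<nu>"
  shows "density A U s (\<lambda>c p. \<nu> c p powr s)"
    and "c \<in> A \<Longrightarrow> p \<in> fst c \<inter> U \<Longrightarrow> cov_density \<Gamma> s (\<lambda>c p. \<nu> c p powr s) c p v = 0"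
    and "c \<in> A \<Longrightarrow> p \<in> fst c \<inter> U \<Longrightarrow>
      has_deriv_in c (\<lambda>p. \<nu> c p powr s) p (\<lambda>v. (s * trace (\<Gamma> c p v)) * (\<nu> c p powr s))"
proof -
  have pos: "\<nu> c p > 0" and der: "has_deriv_in c (\<nu> c) p (\<lambda>v. trace (\<Gamma> c p v) * \<nu> c p)"
    if "c \<in> A" "p \<in> fst c \<inter> U" for c p
    using \<nu> that unfolding parallel_positive_def by blast+
  have trans: "\<nu> c p = \<bar>det (jac c d p)\<bar> * \<nu> d p" if "c \<in> A" "d \<in> A" "p \<in> fst c \<inter> fst d \<inter> U" for c d p
    using \<nu> that unfolding parallel_positive_def by blast
  show hd: "has_deriv_in c (\<lambda>p. \<nu> c p powr s) p (\<lambda>v. (s * trace (\<Gamma> c p v)) * (\<nu> c p powr s))"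
    if "c \<in> A" "p \<in> fst c \<inter> U" for c p
  proof -
    have ci: "chart_inv c (snd c p) = p" using that by simp
    have "((\<lambda>y. y powr s) has_derivative (\<lambda>h. (s * (\<nu> c p powr (s - 1))) * h))
        (at ((\<nu> c \<circ> chart_inv c) (snd c p)))"
      using has_real_derivative_powr[OF pos[OF that], of s]
      by (simp add: has_field_derivative_def ci)
    from has_derivative_compose[OF der[OF that, unfolded has_deriv_in_def] this]
    have "has_deriv_in c (\<lambda>p. \<nu> c p powr s) p
        (\<lambda>v. (s * (\<nu> c p powr (s - 1))) * (trace (\<Gamma> c p v) * \<nu> c p))"
      by (simp add: has_deriv_in_def o_def)
    moreover have "\<nu> c p powr (s - 1) * \<nu> c p = \<nu> c p powr s"
      using powr_mult_base[of "\<nu> c p" "s - 1"] pos[OF that] by (simp add: mult.commute)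
    then have "(s * (\<nu> c p powr (s - 1))) * (trace (\<Gamma> c p v) * \<nu> c p)
        = (s * trace (\<Gamma> c p v)) * (\<nu> c p powr s)" for v
      by (metis (no_types, opaque_lifting) mult.assoc mult.commute)
    ultimately show ?thesis by simp
  qed
  show "cov_density \<Gamma> s (\<lambda>c p. \<nu> c p powr s) c p v = 0" if "c \<in> A" "p \<in> fst c \<inter> U" for c p v
    by (simp add: cov_density_def has_deriv_inD[OF hd[OF that]])
  show "density A U s (\<lambda>c p. \<nu> c p powr s)"
    unfolding density_def
  proof (intro conjI ballI)
    fix c assume c: "c \<in> A"
    show "smooth_in c U (\<lambda>p. \<nu> c p powr s)"
      unfolding smooth_in_def
    \<comment> \<open>The coefficients s trace \<Gamma> are smooth, so the solution is.\<close>
    proof (rule smooth_on_linear_ode[OF open_coords[OF c U]])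
      have "smooth_in c UNIV (\<lambda>p. \<Gamma> c p v)" for v
        using aff c by (auto simp: affine_connection_def)
      then have "smooth_in c U (\<lambda>p. \<Gamma> c p v)" for v
        by (rule smooth_in_subset) simp
      then have "smooth_in c U (\<lambda>p. s * trace (\<Gamma> c p v))" for v
        by (intro smooth_in_bilinear[OF bounded_bilinear_mult c U smooth_in_const[OF c U]]
            smooth_in_bounded_linear[OF c U bounded_linear_trace])
      then show "smooth_on (snd c ` (fst c \<inter> U)) (\<lambda>x. s * trace (\<Gamma> c (chart_inv c x) v))" for v
        unfolding smooth_in_def o_def .
      fix x assume "x \<in> snd c ` (fst c \<inter> U)"
      then obtain p where p: "p \<in> fst c \<inter> U" "x = snd c p" by blast
      then show "((\<lambda>p. \<nu> c p powr s) \<circ> chart_inv c has_derivative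
          (\<lambda>v. s * trace (\<Gamma> c (chart_inv c x) v) * ((\<lambda>p. \<nu> c p powr s) \<circ> chart_inv c) x)) (at x)"
        using hd[OF c p(1)] c by (simp add: has_deriv_in_def)
    qed
    fix d p assume d: "d \<in> A" and p: "p \<in> fst c \<inter> fst d \<inter> U"
    have "\<bar>det (jac c d p)\<bar> powr - s * (\<bar>det (jac c d p)\<bar> powr s) = 1"
      using det_jac_nonzero[OF c d] p by (simp add: powr_add[symmetric])
    then show "\<nu> d p powr s = \<bar>det (jac c d p)\<bar> powr - s * \<nu> c p powr s"
      unfolding trans[OF c d p] powr_mult by (simp add: mult.assoc[symmetric])
  qed
qed

text \<open>A tensor product of parallel sections is parallel, so the twistor equation holds with
  \<xi> = 0. As I has norm 1, both the induced complex structure and the induced volume form are the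
  given ones.\<close>

lemma local_twistor_function:
  assumes \<Gamma>: "quaternionic_connection A Q UNIV \<Gamma>"
    and par: "parallel_endo A UNIV \<Gamma> I" and I: "Q_section A Q UNIV 0 I"
    and sq: "\<And>c p. c \<in> A \<Longrightarrow> p \<in> fst c \<Longrightarrow> I c p ** I c p = - mat 1"
    and U: "open U" and \<nu>: "parallel_positive U \<Gamma> \<nu>"
  defines "\<mu> \<equiv> \<lambda>c p. (\<nu> c p powr s0 n) *\<^sub>R I c p"
  shows "twistor_function n A Q U \<mu>" "nowhere_zero A U \<mu>" "induces n A Q U \<mu> I"
    "mu_connection n A Q U \<mu> \<Gamma>"
proof -
  let ?e = "\<lambda>c p. \<nu> c p powr s0 n"
  have aff: "affine_connection A UNIV \<Gamma>" using \<Gamma> by (simp add: quaternionic_connection_def)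
  have \<Gamma>U: "quaternionic_connection A Q U \<Gamma>" by (rule quaternionic_connection_subset[OF \<Gamma>])
  have Ie: "endo_field A U I" and IQ: "\<And>c p. c \<in> A \<Longrightarrow> p \<in> fst c \<Longrightarrow> I c p \<in> Q c p"
    using I endo_field_subset[of UNIV I U] by (auto simp: Q_section_def)
  have pos: "\<nu> c p > 0" if "c \<in> A" "p \<in> fst c \<inter> U" for c p
    using \<nu> that unfolding parallel_positive_def by blast
  note e = parallel_positive_powr[OF aff U \<nu>, where s="s0 n"]
  have e_smooth: "smooth_in c U (?e c)" if "c \<in> A" for c
    using e(1) that by (auto simp: density_def)
  have \<mu>Q: "Q_section A Q U (s0 n) \<mu>"
    unfolding Q_section_def endo_density_def
  proof (intro conjI ballI)
    show "smooth_in c U (\<mu> c)" if "c \<in> A" for c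
      unfolding \<mu>_def
      by (rule smooth_in_bilinear[OF bounded_bilinear_scaleR that U e_smooth[OF that] endo_field_smooth[OF Ie that]])
    show "\<mu> d p ** jac c d p = \<bar>det (jac c d p)\<bar> powr - s0 n *\<^sub>R (jac c d p ** \<mu> c p)"
      if "c \<in> A" "d \<in> A" "p \<in> fst c \<inter> fst d \<inter> U" for c d p
    proof -
      have "?e d p = \<bar>det (jac c d p)\<bar> powr - s0 n * ?e c p"
        using e(1) that unfolding density_def by blast
      then show ?thesis
        using endo_fieldD[OF Ie that] by (simp add: \<mu>_def matrix_ring_simps)
    qed
    show "\<mu> c p \<in> Q c p" if "c \<in> A" "p \<in> fst c \<inter> U" for c p
      using that subspace_scale[OF subspace_Q IQ] by (simp add: \<mu>_def)
  qed
  \<comment> \<open>The derivative of the density factor yields exactly the trace term that the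
    weight \<open>s0 n\<close> subtracts.\<close>
  have \<mu>par: "cov_endo \<Gamma> (s0 n) \<mu> c p v = 0" if cp: "c \<in> A" "p \<in> fst c \<inter> U" for c p v
  proof -
    have "has_deriv_in c (\<mu> c) p (\<lambda>v. ?e c p *\<^sub>R deriv_in c (I c) p v
        + (s0 n * trace (\<Gamma> c p v) * ?e c p) *\<^sub>R I c p)"
      unfolding \<mu>_def using cp
      by (intro has_deriv_in_bilinear[OF bounded_bilinear_scaleR cp(1) _ e(3)[OF cp]]
          smooth_in_has_deriv[OF endo_field_smooth[OF Ie cp(1)] cp(2)]) simp
    from has_deriv_inD[OF this, of v]
    have "cov_endo \<Gamma> (s0 n) \<mu> c p v = ?e c p *\<^sub>R cov_endo \<Gamma> 0 I c p v"
      by (simp add: cov_endo_def) (simp add: \<mu>_def matrix_ring_simps algebra_simps)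
    then show ?thesis using par cp by (auto simp: parallel_endo_def)
  qed
  have zero_form: "one_form A W (\<lambda>c p. 0)" if "open W" for W
    using that by (auto simp: one_form_def intro: smooth_in_const)
  have frame: "\<exists>W I1 I2 I3 \<xi>. open W \<and> p \<in> W \<and> W \<subseteq> V \<and>
      admissible_frame A Q W I1 I2 I3 \<and> one_form A W \<xi> \<and>
      (\<forall>c\<in>A. \<forall>q\<in>fst c \<inter> W. \<forall>v.
         cov_endo \<Gamma> (s0 n) \<mu> c q v =
           e' c q *\<^sub>R ((\<xi> c q \<bullet> (I1 c q *v v)) *\<^sub>R I1 c q
                    + (\<xi> c q \<bullet> (I2 c q *v v)) *\<^sub>R I2 c q
                    + (\<xi> c q \<bullet> (I3 c q *v v)) *\<^sub>R I3 c q))"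
    if V: "open V" "V \<subseteq> U" "p \<in> V" for V p and e' :: "('m, 'k) scalar_comp"
  proof -
    obtain W I2 I3 where W: "open W" "p \<in> W" "admissible_frame A Q W I I2 I3"
      by (rule local_admissible_frame[OF I sq, of p])
    have "admissible_frame A Q (W \<inter> V) I I2 I3"
      using W(3) endo_field_subset[of W _ "W \<inter> V"] unfolding admissible_frame_def by auto
    then show ?thesis
      using W V \<mu>par zero_form[of "W \<inter> V"]
      by (intro exI[of _ "W \<inter> V"] exI[of _ I] exI[of _ I2] exI[of _ I3] exI[of _ "\<lambda>c p. 0"])
         (auto intro: open_Int)
  qed
  show "twistor_function n A Q U \<mu>"
    unfolding twistor_function_def
    by (intro conjI \<mu>Q exI[of _ \<Gamma>] \<Gamma>U allI impI ballI frame) auto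
  have I0: "I c p \<noteq> 0" if "c \<in> A" "p \<in> fst c" for c p
  proof
    assume "I c p = 0"
    then have "mat 1 = (0 :: real^'k^'k)"
      using sq[OF that] by (simp add: matrix_ring_simps)
    then have "trace (mat 1 :: real^'k^'k) = 0" by (simp add: trace_simps)
    then show False by (simp add: trace_I)
  qed
  show "nowhere_zero A U \<mu>"
    unfolding nowhere_zero_def \<mu>_def using pos I0 by (simp add: less_imp_neq[symmetric])
  have norm: "Q_norm n (I c p) = 1" if "c \<in> A" "p \<in> fst c" for c p
    using sq[OF that] dimension by (simp add: Q_norm_def trace_simps trace_I)
  have dens: "density A U 1 \<nu>"
  proof -
    \<comment> \<open>Reading \<nu> as its own first power transfers to it the smoothness and the
      density law obtained for powers.\<close>
    have 1: "\<nu> c p powr 1 = \<nu> c p" if "c \<in> A" "p \<in> fst c \<inter> U" for c p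
      using pos[OF that] by simp
    have d1: "density A U 1 (\<lambda>c p. \<nu> c p powr 1)" by (rule parallel_positive_powr(1)[OF aff U \<nu>])
    show ?thesis
      unfolding density_def
    proof (intro conjI ballI)
      show "smooth_in c U (\<nu> c)" if c: "c \<in> A" for c
      proof -
        have "smooth_in c U (\<lambda>p. \<nu> c p powr 1)" using d1 c unfolding density_def by blast
        then show ?thesis
          by (rule smooth_in_cong[OF c U, THEN iffD1, rotated]) (rule 1[OF c])
      qed
      fix c d p assume cd: "c \<in> A" "d \<in> A" "p \<in> fst c \<inter> fst d \<inter> U"
      then have "p \<in> fst c \<inter> U" "p \<in> fst d \<inter> U" by auto
      then show "\<nu> d p = \<bar>det (jac c d p)\<bar> powr - 1 * \<nu> c p"
        using d1 cd unfolding density_def by (metis 1)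
    qed
  qed
  have pair: "associated_pair n A U ?e \<nu>"
    unfolding associated_pair_def
  proof (intro conjI dens e(1) ballI)
    show "nowhere_zero A U \<nu>" using pos by (force simp: nowhere_zero_def)
    fix c p assume cp: "c \<in> A" "p \<in> fst c \<inter> U"
    have "?e c p ^ (2 * (n + 1)) = \<nu> c p powr (real (2 * (n + 1)) * s0 n)"
      using pos[OF cp] by (intro powr_power) simp
    \<comment> \<open>The normalisation behind \<open>s0\<close>: the total exponent is -1, the
      weight of the dual volume form.\<close>
    also have "real (2 * (n + 1)) * s0 n = - 1" by (simp add: s0_def field_simps)
    finally show "?e c p ^ (2 * (n + 1)) = inverse (\<nu> c p)"
      using pos[OF cp] by (simp add: inverse_eq_divide)
  qed
  have dec: "decomposes n A Q U \<mu> I ?e \<nu>"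
    unfolding decomposes_def using pair Ie IQ by (simp add: Q_section_def \<mu>_def)
  show "induces n A Q U \<mu> I"
    unfolding induces_def using dec norm by (intro exI[of _ I] exI[of _ ?e] exI[of _ \<nu>]) auto
  have vol: "mu_volume n A Q U \<mu> \<nu>"
    unfolding mu_volume_def using dec norm by (intro exI[of _ I] exI[of _ ?e] exI[of _ \<nu>]) auto
  have d\<nu>: "deriv_in c (\<nu> c) p v = trace (\<Gamma> c p v) * \<nu> c p" if "c \<in> A" "p \<in> fst c \<inter> U" for c p v
  proof -
    have "has_deriv_in c (\<nu> c) p (\<lambda>v. trace (\<Gamma> c p v) * \<nu> c p)"
      using \<nu> that unfolding parallel_positive_def by blast
    then show ?thesis by (rule has_deriv_inD)
  qed
  show "mu_connection n A Q U \<mu> \<Gamma>"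
    unfolding mu_connection_def
  proof (intro exI[of _ \<nu>] conjI vol \<Gamma>U allI impI)
    show "parallel_volume A U \<Gamma> \<nu>"
      by (simp add: parallel_volume_def cov_density_def d\<nu>)
    fix \<Gamma>' assume \<Gamma>': "quaternionic_connection A Q U \<Gamma>' \<and> parallel_volume A U \<Gamma>' \<nu>"
    show "connections_agree A U \<Gamma>' \<Gamma>"
    proof (rule connections_agree_volume[OF U \<Gamma>U])
      fix c p v assume cp: "c \<in> A" "p \<in> fst c \<inter> U"
      have "deriv_in c (\<nu> c) p v - 1 * trace (\<Gamma>' c p v) * \<nu> c p = 0"
        using \<Gamma>' cp unfolding parallel_volume_def cov_density_def by blast
      then show "trace (\<Gamma>' c p v) = trace (\<Gamma> c p v)"
        unfolding d\<nu>[OF cp] using pos[OF cp] by (simp add: less_imp_neq[symmetric])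
    qed (use \<Gamma>' in simp)
  qed
qed

end

theorem proposition3p31:
  fixes A :: "('m::{t2_space, second_countable_topology}, 'k::finite) atlas"
    and Q :: "('m, 'k) endo_bundle"
    and I :: "('m, 'k) matrix_comp"
    and \<rho> :: "complex \<Rightarrow> 'm \<Rightarrow> 'm"
    and n :: nat
  assumes "quaternionic_manifold n A Q"
    and "compatible_complex_structure A Q I"
    and "circle_action A \<rho>"
    and "preserves_bundle A \<rho> Q"
    and "preserves_endo A \<rho> I"
    and "closed_type A Q I"
  shows "\<exists>\<Gamma>. quaternionic_connection A Q UNIV \<Gamma> \<and> parallel_endo A UNIV \<Gamma> I \<and>
           (\<forall>\<Gamma>'. quaternionic_connection A Q UNIV \<Gamma>' \<and> parallel_endo A UNIV \<Gamma>' I \<longrightarrow>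
              connections_agree A UNIV \<Gamma>' \<Gamma>) \<and>
           (\<forall>p. \<exists>U \<mu>. open U \<and> p \<in> U \<and>
              twistor_function n A Q U \<mu> \<and> nowhere_zero A U \<mu> \<and>
              induces n A Q U \<mu> I \<and> mu_connection n A Q U \<mu> \<Gamma>)"
proof -
  interpret quaternionic A Q n
    by unfold_locales (use assms(1) in \<open>auto simp: quaternionic_manifold_def\<close>)
  obtain \<Gamma>0 \<eta> where \<Gamma>0: "quaternionic_connection A Q UNIV \<Gamma>0" "symmetric_Ricci A UNIV \<Gamma>0"
    and \<eta>: "eta_form A Q \<Gamma>0 I \<eta>" "closed_one_form A UNIV \<eta>"
    using assms(6) by (auto simp: closed_type_def)
  have I: "Q_section A Q UNIV 0 I"
    and sq: "\<And>c p. c \<in> A \<Longrightarrow> p \<in> fst c \<Longrightarrow> I c p ** I c p = - mat 1"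
    using assms(2) by (auto simp: compatible_complex_structure_def complex_structure_def)
  define \<Gamma> where "\<Gamma> = shift \<Gamma>0 (\<lambda>c p. (- 1 / 4) *\<^sub>R \<eta> c p)"
  have form: "one_form A UNIV (\<lambda>c p. (- 1 / 4) *\<^sub>R \<eta> c p)"
    unfolding one_form_def
  proof (intro conjI ballI allI)
    show "smooth_in c UNIV (\<lambda>p. (- 1 / 4) *\<^sub>R \<eta> c p)" if "c \<in> A" for c
      using \<eta>(2) that unfolding closed_one_form_def one_form_def
      by (intro smooth_in_bilinear[OF bounded_bilinear_scaleR] smooth_in_const) auto
  qed (use \<eta>(2) in \<open>auto simp: closed_one_form_def one_form_def\<close>)
  have frames: "\<exists>W I1 I2 I3. open W \<and> p \<in> W \<and> admissible_frame A Q W I1 I2 I3" for p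
    by (rule local_admissible_frame[OF I sq, of p]) blast+
  have qc: "quaternionic_connection A Q UNIV \<Gamma>"
    unfolding \<Gamma>_def by (rule quaternionic_connection_shift[OF \<Gamma>0(1) form frames])
  have par: "parallel_endo A UNIV \<Gamma> I"
    unfolding \<Gamma>_def by (rule parallel_shift_eta[OF \<Gamma>0(1) assms(2) \<eta>(1)])
  have aff: "affine_connection A UNIV \<Gamma>" using qc by (simp add: quaternionic_connection_def)
  have "\<exists>U \<mu>. open U \<and> p \<in> U \<and> twistor_function n A Q U \<mu> \<and> nowhere_zero A U \<mu> \<and>
      induces n A Q U \<mu> I \<and> mu_connection n A Q U \<mu> \<Gamma>" for p
  proof -
    obtain c where c: "c \<in> A" "p \<in> fst c" using chart_exists by blast
    obtain B f where B: "open B" "snd c p \<in> B" and f: "\<forall>q\<in>fst c. snd c q \<in> B \<longrightarrow>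
        has_deriv_in c (\<lambda>q. f (snd c q)) q (\<lambda>v. trace (\<Gamma> c q v))"
      using trace_connection_primitive[OF \<Gamma>0 \<eta>(2) c] unfolding \<Gamma>_def by blast
    \<comment> \<open>The part of the chart over which the primitive of the trace is available; the
      parallel volume form lives there.\<close>
    define U where "U = {q \<in> fst c. snd c q \<in> B}"
    have U: "open U" "U \<subseteq> fst c" "p \<in> U"
      unfolding U_def using open_chart_vimage[OF c(1) B(1)] B c by auto
    have "parallel_positive U \<Gamma> (\<lambda>d q. \<bar>det (jac d c q)\<bar> * exp (f (snd c q)))"
      by (rule parallel_positive_exists[OF aff c(1) U(1,2)]) (use f in \<open>auto simp: U_def\<close>)
    from local_twistor_function[OF qc par I sq U(1) this] show ?thesis
      using U by blast
  qed
  moreover have "connections_agree A UNIV \<Gamma>' \<Gamma>"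
    if "quaternionic_connection A Q UNIV \<Gamma>'" "parallel_endo A UNIV \<Gamma>' I" for \<Gamma>'
    by (rule connections_agree_parallel[OF qc that(1) I sq par that(2)])
  ultimately show ?thesis using qc par by blast
qed

end
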